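(* Let $m\geq1$ and let $M=\mathbb{S}^{2m+1}\subset\mathbb{C}^{m+1}$ carry the round metric $g$ of sectional curvature $1$, its canonical spin structure, and the Sasakian structure given by $\xi_x=ix$. Assume the existence of a non-zero $(\alpha,\beta)$-transversal Killing spinor $\psi$ on $(\mathbb{S}^{2m+1},g)$ for complex $\alpha,\beta$. Then $\alpha\beta=0$ and: (i) If $\alpha=0$, then $m=1$, $\beta^2=1$, and $\psi$ is one of the $(0,\pm1)$-transversal Killing spinors on $\mathbb{S}^3$ induced, via the Hopf fibration $\mathbb{S}^3\to\mathbb{C}\mathrm{P}^1$, by the $\pm1$-Killing spinors of $\mathbb{C}\mathrm{P}^1$. (ii) If $\alpha\neq0$, then $\beta=0$, $\alpha=\epsilon\frac{m+1}{2}$ for some $\epsilon\in\{\pm1\}$, and $\psi$ is one of the following spinors: the elements of the $1$-dimensional space of $(-\frac{m+1}{2},0)$-transversal Killing spinors lying pointwise in $\Sigma_0M$, and the elements of the $1$-dimensional space of $((-1)^m\frac{m+1}{2},0)$-transversal Killing spinors lying pointwise in $\Sigma_mM$.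
   Context: A Riemannian flow is a Riemannian manifold $(M^{n+1},g)$ with a smooth unit vector field $\xi$ such that $(\mathcal{L}_\xi g)(Z,W)=0$ for all $Z,W\perp\xi$. Put $Q=\xi^\perp$, $h(Z)=\nabla^M_Z\xi$ for $Z\in Q$ (with $\nabla^M$ the Levi-Civita connection), $\kappa=\nabla^M_\xi\xi$, $\Omega(Z,W)=g(h(Z),W)$ on $Q$ extended by $\Omega(\xi,\cdot)=0$. The connection $\nabla$ on $Q$ is $\nabla_\xi Z=[\xi,Z]^Q$, $\nabla_XZ=(\nabla^M_XZ)^Q$ for $X\in\Gamma(Q)$, where $(\cdot)^Q$ is the orthogonal projection onto $Q$. A Sasakian manifold is a Riemannian flow with $\kappa=0$, $h^2=-\mathrm{Id}_Q$, $\nabla h=0$ (so $n=2m$). The sphere above is Sasakian, $h$ being the standard complex structure $J$ of $\mathbb{C}^{m+1}$ restricted to $Q$; it is oriented so that $\{e_1,\dots,e_{2m+1}\}$ is positively oriented in $T_x\mathbb{S}^{2m+1}$ iff $\{x,e_1,\ldots,e_{2m+1}\}$ is positively oriented in $\mathbb{C}^{m+1}$. On the spinor bundle $\Sigma M$ of a spin Sasakian manifold, with Clifford multiplication "$\cdot$" ($X\cdot X=-|X|^2$; $e_i\wedge e_j$ acts as $e_i\cdot e_j\cdot$ for orthonormal $e_i,e_j$, $i\neq j$), the transversal connection is $\nabla_\xi\varphi=\nabla^M_\xi\varphi-\frac12\Omega\cdot\varphi$, $\nabla_Z\varphi=\nabla^M_Z\varphi-\frac12\xi\cdot h(Z)\cdot\varphi$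 for $Z\in\Gamma(Q)$. An $(\alpha,\beta)$-transversal Killing spinor is a smooth section $\psi$ of $\Sigma M$ with $\nabla_\xi\psi=\alpha\,\xi\cdot\psi$ and $\nabla_Z\psi=\beta\,\xi\cdot Z\cdot\psi$ for all $Z\in\Gamma(Q)$. One has $\Sigma M=\bigoplus_{r=0}^m\Sigma_rM$, where $\Sigma_rM$ is the eigenbundle of the Clifford action of $\Omega$ for the eigenvalue $i(2r-m)$; Clifford multiplication is normalized so that $i\xi\cdot=(-1)^r\mathrm{Id}$ on $\Sigma_rM$. For (i): the Hopf fibration $\pi:\mathbb{S}^3\to\mathbb{C}\mathrm{P}^1$, with $\mathbb{C}\mathrm{P}^1$ carrying the Fubini-Study metric of holomorphic sectional curvature $4$ (i.e. $\mathbb{S}^2$ with $\frac14\mathrm{can}$), is an $\mathbb{S}^1$-bundle and a Riemannian submersion with totally geodesic fibres tangent to $\xi$. One has $Q\cong\pi^*T\mathbb{C}\mathrm{P}^1$ and $\Sigma\mathbb{S}^3\cong\pi^*\Sigma\mathbb{C}\mathrm{P}^1$ with $\xi\cdot X^*\cdot=X\cdot_{\mathbb{C}\mathrm{P}^1}$ ($X^*$ the horizontal lift of $X$), and a $\beta$-Killing spinor $\varphi$ of $\mathbb{C}\mathrm{P}^1$ (i.e. $\nabla_X\varphi=\beta X\cdot\varphi$ for all $X$) induces the $(0,\beta)$-transversal Killing spinor $\varphi\circ\pi$ on $\mathbb{S}^3$.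
   Formalization: In (ii), for odd m both 1-dimensional spaces have the same α = -(m+1)/2, so sums of an element of each are also transversal Killing spinors lying in neither; the formal statement therefore also allows, for m odd, ψ to be such a sum. *)

theory Defs
  imports "HOL-Analysis.Analysis"
begin

section \<open>Smooth maps\<close>

primrec Ck_on :: "nat \<Rightarrow> 'a::real_normed_vector set \<Rightarrow> ('a \<Rightarrow> 'b::real_normed_vector) \<Rightarrow> bool" where
  "Ck_on 0 = (\<lambda>U f. continuous_on U f)"
| "Ck_on (Suc k) = (\<lambda>U f. \<exists>f'. (\<forall>x\<in>U. (f has_derivative f' x) (at x)) \<and>
                              (\<forall>v. Ck_on k U (\<lambda>x. f' x v)))"

text \<open>Smoothness on a subset (here always an embedded submanifold): locally the restriction of a
  smooth map on an open set.\<close>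

definition smooth_on :: "'a::real_normed_vector set \<Rightarrow> ('a \<Rightarrow> 'b::real_normed_vector) \<Rightarrow> bool" where
  "smooth_on S f \<longleftrightarrow>
     (\<forall>x\<in>S. \<exists>U g. open U \<and> x \<in> U \<and> (\<forall>k. Ck_on k U g) \<and> (\<forall>y\<in>S \<inter> U. g y = f y))"


section \<open>The spin group of a Euclidean space\<close>

text \<open>Representations of the Clifford algebra of a Euclidean space \<open>E\<close>,
  with the convention \<open>v \<cdot> v = - |v|\<^sup>2\<close>.\<close>

definition clifford_rep :: "('e::euclidean_space \<Rightarrow> complex^'w^'w) \<Rightarrow> bool" where
  "clifford_rep \<gamma> \<longleftrightarrow> linear \<gamma> \<and> (\<forall>v. \<gamma> v ** \<gamma> v = mat (- of_real ((norm v)\<^sup>2)))"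

text \<open>The even products of unit vectors. Every representation of the Clifford algebra is faithful on
  its even part if \<open>DIM('e)\<close> is even (the complexified algebra is simple) or is 3 (the even part is
  the algebra of quaternions); so in these cases, the only ones used, this is \<open>Spin(E)\<close>.\<close>

inductive_set Spin :: "('e::euclidean_space \<Rightarrow> complex^'w^'w) \<Rightarrow> (complex^'w^'w) set"
  for \<gamma> where
  one: "mat 1 \<in> Spin \<gamma>"
| mult: "p \<in> Spin \<gamma> \<Longrightarrow> norm u = 1 \<Longrightarrow> norm v = 1 \<Longrightarrow> p ** \<gamma> u ** \<gamma> v \<in> Spin \<gamma>"

text \<open>The two-fold covering \<open>Spin(E) \<rightarrow> SO(E)\<close>: the rotation \<open>v \<mapsto> p v p\<^sup>-\<^sup>1\<close>.\<close>

definition spin_rot :: "('e::euclidean_space \<Rightarrow> complex^'w^'w) \<Rightarrow> complex^'w^'w \<Rightarrow> 'e \<Rightarrow> 'e" where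
  "spin_rot \<gamma> p v = (THE u. p ** \<gamma> v = \<gamma> u ** p)"


section \<open>Spinors on round spheres\<close>

text \<open>
  Let \<open>S\<close> be the sphere of radius \<open>R\<close> in an oriented Euclidean space \<open>E\<close>, and fix a unit vector
  \<open>e\<close> of \<open>E\<close> (below an element of \<^const>\<open>Basis\<close>).
  An oriented orthonormal frame of \<open>S\<close> at \<open>x\<close> is an isometry \<open>e\<^sup>\<bottom> \<rightarrow> T\<^sub>x S = x\<^sup>\<bottom>\<close>, and corresponds to the
  rotation of \<open>E\<close> which extends it and maps \<open>e\<close> to \<open>x/R\<close>; so frames are oriented by the
  outward-normal-first convention. Thus the oriented frame bundle of \<open>S\<close> is \<open>SO(E)\<close>, and the spin
  structure is the covering \<open>Spin(E) \<rightarrow> SO(E)\<close>: the spin frame \<open>p\<close> lies over the point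
  \<open>R \<cdot> spin_rot \<gamma> p e\<close>, and its frame is \<open>spin_rot \<gamma> p\<close> restricted to \<open>e\<^sup>\<bottom>\<close>.
  The structure group \<open>Spin(e\<^sup>\<bottom>)\<close> is the stabilizer of \<open>e\<close>.

  The Clifford algebra of \<open>e\<^sup>\<bottom>\<close> acts through the usual isomorphism \<open>v \<mapsto> e \<cdot> v\<close> onto the even part of
  the Clifford algebra of \<open>E\<close>. Let \<open>\<Sigma>\<close> be a module for the latter. The spinor bundle is
  \<open>Spin(E) \<times> \<Sigma>\<close> modulo \<open>Spin(e\<^sup>\<bottom>)\<close>, and its sections are the equivariant maps
  \<open>Spin(E) \<rightarrow> \<Sigma>\<close>. They are required to vanish off \<open>Spin(E)\<close> so that equality of functions is
  equality of sections.\<close>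

definition spinor_field ::
  "('e::euclidean_space \<Rightarrow> complex^'w^'w) \<Rightarrow> 'e \<Rightarrow> (complex^'w) set \<Rightarrow> (complex^'w^'w \<Rightarrow> complex^'w) \<Rightarrow> bool"
where
  "spinor_field \<gamma> e \<Sigma> \<psi> \<longleftrightarrow>
     (\<forall>p\<in>Spin \<gamma>. \<psi> p \<in> \<Sigma>) \<and> (\<forall>p. p \<notin> Spin \<gamma> \<longrightarrow> \<psi> p = 0) \<and>
     (\<forall>p\<in>Spin \<gamma>. \<forall>s\<in>Spin \<gamma>. spin_rot \<gamma> s e = e \<longrightarrow> s *v \<psi> (p ** s) = \<psi> p) \<and>
     smooth_on (Spin \<gamma>) \<psi>"

text \<open>Clifford multiplication by the tangent vector \<open>X\<close>, in the spin frame \<open>p\<close>.\<close>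

definition cmult ::
  "('e::euclidean_space \<Rightarrow> complex^'w^'w) \<Rightarrow> 'e \<Rightarrow> complex^'w^'w \<Rightarrow> 'e \<Rightarrow> complex^'w \<Rightarrow> complex^'w" where
  "cmult \<gamma> e p X w = (\<gamma> e ** \<gamma> (inv (spin_rot \<gamma> p) X)) *v w"

text \<open>Curves \<open>q\<close> of spin frames with \<open>q 0 = p\<close>, over a curve with initial velocity \<open>X\<close>, whose
  underlying orthonormal frames are parallel for the Levi-Civita connection: the derivative of each
  frame vector is normal to the sphere.\<close>

definition horizontal_curve ::
  "('e::euclidean_space \<Rightarrow> complex^'w^'w) \<Rightarrow> 'e \<Rightarrow> real \<Rightarrow> complex^'w^'w \<Rightarrow> 'e \<Rightarrow> (real \<Rightarrow> complex^'w^'w) \<Rightarrow> bool"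
where
  "horizontal_curve \<gamma> e R p X q \<longleftrightarrow>
     q 0 = p \<and> (\<forall>t. q t \<in> Spin \<gamma> \<and> q differentiable (at t)) \<and>
     ((\<lambda>t. R *\<^sub>R spin_rot \<gamma> (q t) e) has_vector_derivative X) (at 0) \<and>
     (\<forall>t v. v \<bullet> e = 0 \<longrightarrow>
        (\<exists>a. ((\<lambda>s. spin_rot \<gamma> (q s) v) has_vector_derivative a *\<^sub>R spin_rot \<gamma> (q t) e) (at t)))"

text \<open>The covariant derivative \<open>\<nabla>\<^sub>X \<psi>\<close> for the Levi-Civita connection, in the spin frame \<open>p\<close>.
  For smooth \<open>\<psi>\<close> and tangent \<open>X\<close> it does not depend on \<open>q\<close>.\<close>

definition spin_cov ::
  "('e::euclidean_space \<Rightarrow> complex^'w^'w) \<Rightarrow> 'e \<Rightarrow> real \<Rightarrow> (complex^'w^'w \<Rightarrow> complex^'w) \<Rightarrow>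
   complex^'w^'w \<Rightarrow> 'e \<Rightarrow> complex^'w" where
  "spin_cov \<gamma> e R \<psi> p X =
     (THE w. \<forall>q. horizontal_curve \<gamma> e R p X q \<longrightarrow> ((\<lambda>t. \<psi> (q t)) has_vector_derivative w) (at 0))"

definition killing_spinor ::
  "('e::euclidean_space \<Rightarrow> complex^'w^'w) \<Rightarrow> 'e \<Rightarrow> real \<Rightarrow> (complex^'w) set \<Rightarrow> complex \<Rightarrow>
   (complex^'w^'w \<Rightarrow> complex^'w) \<Rightarrow> bool" where
  "killing_spinor \<gamma> e R \<Sigma> \<beta> \<phi> \<longleftrightarrow>
     spinor_field \<gamma> e \<Sigma> \<phi> \<and>
     (\<forall>p\<in>Spin \<gamma>. \<forall>X. X \<bullet> spin_rot \<gamma> p e = 0 \<longrightarrow>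
        spin_cov \<gamma> e R \<phi> p X = \<beta> *s cmult \<gamma> e p X (\<phi> p))"


section \<open>The Sasakian structure of the unit sphere of complex Euclidean space\<close>

text \<open>The orthogonal complement \<open>Q\<close> of \<open>\<xi>\<close> in the tangent space is \<open>horQ\<close>. The Riemannian metric is the real inner product of \<^typ>\<open>complex^'n\<close>. In the following
  definitions \<open>x\<close> is a point of the unit sphere.\<close>

definition xi :: "complex^'n \<Rightarrow> complex^'n" where
  "xi x = \<i> *s x"

definition horQ :: "complex^'n \<Rightarrow> (complex^'n) set" where
  "horQ x = {Z. Z \<bullet> x = 0 \<and> Z \<bullet> xi x = 0}"

definition projQ :: "complex^'n \<Rightarrow> complex^'n \<Rightarrow> complex^'n" where
  "projQ x X = X - (X \<bullet> x) *\<^sub>R x - (X \<bullet> xi x) *\<^sub>R xi x"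

text \<open>The Levi-Civita derivative at \<open>x\<close> of (the restriction of) a vector field \<open>Y\<close> is the tangential
  part of its Euclidean derivative.\<close>

definition levi_civita :: "(complex^'n \<Rightarrow> complex^'n) \<Rightarrow> complex^'n \<Rightarrow> complex^'n \<Rightarrow> complex^'n" where
  "levi_civita Y x X = (let D = frechet_derivative Y (at x) X in D - (D \<bullet> x) *\<^sub>R x)"

definition h_op :: "complex^'n \<Rightarrow> complex^'n \<Rightarrow> complex^'n" where
  "h_op x Z = levi_civita xi x Z"

definition Omega :: "complex^'n \<Rightarrow> complex^'n \<Rightarrow> complex^'n \<Rightarrow> real" where
  "Omega x X Y = h_op x (projQ x X) \<bullet> projQ x Y"

text \<open>Clifford action of the 2-form \<open>\<Omega>\<close>: the sum over pairs \<open>i < j\<close> of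
  \<open>\<Omega>(e\<^sub>i, e\<^sub>j) e\<^sub>i \<cdot> e\<^sub>j\<close> is half of the sum over all \<open>i, j\<close>. Here \<open>(e\<^sub>i)\<close> is the frame underlying \<open>p\<close>;
  its index set \<open>Basis - {e}\<close> is an orthonormal basis of \<open>e\<^sup>\<bottom>\<close> as \<open>e \<in> Basis\<close>.\<close>

definition Omega_cmult ::
  "(complex^'n \<Rightarrow> complex^'w^'w) \<Rightarrow> complex^'n \<Rightarrow> complex^'w^'w \<Rightarrow> complex^'w \<Rightarrow> complex^'w" where
  "Omega_cmult \<gamma> e p w = (1/2) *\<^sub>R
     (\<Sum>a\<in>Basis - {e}. \<Sum>b\<in>Basis - {e}.
        Omega (spin_rot \<gamma> p e) (spin_rot \<gamma> p a) (spin_rot \<gamma> p b) *\<^sub>R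
          cmult \<gamma> e p (spin_rot \<gamma> p a) (cmult \<gamma> e p (spin_rot \<gamma> p b) w))"

text \<open>The fibre of \<open>\<Sigma>\<^sub>r M\<close> in the spin frame \<open>p\<close>.\<close>

definition Sigma_r ::
  "(complex^'n \<Rightarrow> complex^'w^'w) \<Rightarrow> complex^'n \<Rightarrow> nat \<Rightarrow> (complex^'w) set \<Rightarrow> nat \<Rightarrow> complex^'w^'w \<Rightarrow> (complex^'w) set"
where
  "Sigma_r \<gamma> e m \<Sigma> r p =
     {w \<in> \<Sigma>. Omega_cmult \<gamma> e p w = (\<i> * of_real (2 * real r - real m)) *s w}"

text \<open>
  \<open>\<gamma>\<close> is an irreducible Clifford module of complex Euclidean \<open>(m+1)\<close>-space (complex dimension
  \<open>2\<^sup>m\<^sup>+\<^sup>1\<close>), and \<open>\<Sigma>\<close> is one of its two half-spinor spaces (submodules for the even part, of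
  dimension \<open>2\<^sup>m\<close>). These restrict to the two inequivalent irreducible modules of the Clifford
  algebra of \<open>e\<^sup>\<bottom>\<close>, on which the Clifford multiplications differ by a sign; exactly one of them is
  normalized such that \<open>i \<xi>\<cdot> = (-1)\<^sup>r\<close> on \<open>\<Sigma>\<^sub>r M\<close>.\<close>

definition sasaki_spinor_module ::
  "(complex^'n \<Rightarrow> complex^'w^'w) \<Rightarrow> complex^'n \<Rightarrow> nat \<Rightarrow> (complex^'w) set \<Rightarrow> bool" where
  "sasaki_spinor_module \<gamma> e m \<Sigma> \<longleftrightarrow>
     clifford_rep \<gamma> \<and> CARD('w) = 2 ^ (m + 1) \<and>
     vec.subspace \<Sigma> \<and> vec.dim \<Sigma> = 2 ^ m \<and> (\<forall>u v. \<forall>w\<in>\<Sigma>. (\<gamma> u ** \<gamma> v) *v w \<in> \<Sigma>) \<and>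
     (\<forall>p\<in>Spin \<gamma>. \<forall>r\<le>m. \<forall>w\<in>Sigma_r \<gamma> e m \<Sigma> r p.
        \<i> *s cmult \<gamma> e p (xi (spin_rot \<gamma> p e)) w = (-1) ^ r *s w)"

text \<open>The transversal connection on spinors, in the directions \<open>\<xi>\<close> and \<open>Z \<in> Q\<close>.\<close>

definition trans_cov_xi ::
  "(complex^'n \<Rightarrow> complex^'w^'w) \<Rightarrow> complex^'n \<Rightarrow> (complex^'w^'w \<Rightarrow> complex^'w) \<Rightarrow>
   complex^'w^'w \<Rightarrow> complex^'w" where
  "trans_cov_xi \<gamma> e \<psi> p =
     spin_cov \<gamma> e 1 \<psi> p (xi (spin_rot \<gamma> p e)) - (1/2) *\<^sub>R Omega_cmult \<gamma> e p (\<psi> p)"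

definition trans_cov_Q ::
  "(complex^'n \<Rightarrow> complex^'w^'w) \<Rightarrow> complex^'n \<Rightarrow> (complex^'w^'w \<Rightarrow> complex^'w) \<Rightarrow>
   complex^'w^'w \<Rightarrow> complex^'n \<Rightarrow> complex^'w" where
  "trans_cov_Q \<gamma> e \<psi> p Z =
     spin_cov \<gamma> e 1 \<psi> p Z
       - (1/2) *\<^sub>R cmult \<gamma> e p (xi (spin_rot \<gamma> p e)) (cmult \<gamma> e p (h_op (spin_rot \<gamma> p e) Z) (\<psi> p))"

definition trans_killing_spinor ::
  "(complex^'n \<Rightarrow> complex^'w^'w) \<Rightarrow> complex^'n \<Rightarrow> (complex^'w) set \<Rightarrow> complex \<Rightarrow> complex \<Rightarrow>
   (complex^'w^'w \<Rightarrow> complex^'w) \<Rightarrow> bool" where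
  "trans_killing_spinor \<gamma> e \<Sigma> \<alpha> \<beta> \<psi> \<longleftrightarrow>
     spinor_field \<gamma> e \<Sigma> \<psi> \<and>
     (\<forall>p\<in>Spin \<gamma>.
        trans_cov_xi \<gamma> e \<psi> p = \<alpha> *s cmult \<gamma> e p (xi (spin_rot \<gamma> p e)) (\<psi> p) \<and>
        (\<forall>Z\<in>horQ (spin_rot \<gamma> p e).
           trans_cov_Q \<gamma> e \<psi> p Z =
             \<beta> *s cmult \<gamma> e p (xi (spin_rot \<gamma> p e)) (cmult \<gamma> e p Z (\<psi> p))))"

definition TKS_in ::
  "(complex^'n \<Rightarrow> complex^'w^'w) \<Rightarrow> complex^'n \<Rightarrow> nat \<Rightarrow> (complex^'w) set \<Rightarrow> nat \<Rightarrow> complex \<Rightarrow> complex \<Rightarrow>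
   (complex^'w^'w \<Rightarrow> complex^'w) set" where
  "TKS_in \<gamma> e m \<Sigma> r \<alpha> \<beta> =
     {\<psi>. trans_killing_spinor \<gamma> e \<Sigma> \<alpha> \<beta> \<psi> \<and> (\<forall>p\<in>Spin \<gamma>. \<psi> p \<in> Sigma_r \<gamma> e m \<Sigma> r p)}"

definition one_dimensional :: "('a \<Rightarrow> complex^'w) set \<Rightarrow> bool" where
  "one_dimensional A \<longleftrightarrow> (\<exists>\<phi>. \<phi> \<noteq> (\<lambda>_. 0) \<and> A = range (\<lambda>a p. a *s \<phi> p))"


section \<open>The Hopf fibration\<close>

text \<open>The complex projective line with the Fubini-Study metric of holomorphic sectional curvature 4
  is the sphere of radius 1/2 in \<^typ>\<open>real^3\<close>; \<open>x \<mapsto> hopf j k x\<close> is the Hopf fibration in the complex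
  coordinates \<open>x\<^sub>j, x\<^sub>k\<close>. The spinor module on the projective line is \<^typ>\<open>complex^2\<close>, with Clifford
  multiplication by \<open>v\<close> orthogonal to \<open>e3\<close> given by \<open>pauli e3 ** pauli v\<close>.\<close>

definition hopf :: "'n::finite \<Rightarrow> 'n \<Rightarrow> complex^'n \<Rightarrow> real^3" where
  "hopf j k x = vector [Re (x $ j * cnj (x $ k)), Im (x $ j * cnj (x $ k)),
                        ((cmod (x $ j))\<^sup>2 - (cmod (x $ k))\<^sup>2) / 2]"

definition pauli :: "real^3 \<Rightarrow> complex^2^2" where
  "pauli v = vector [vector [Complex 0 (v $ 3), Complex (v $ 2) (v $ 1)],
                     vector [Complex (- (v $ 2)) (v $ 1), Complex 0 (- (v $ 3))]]"

lemma clifford_rep_pauli: "clifford_rep pauli"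
proof -
  have "linear pauli"
    by (rule linearI) (simp_all add: pauli_def vec_eq_iff forall_2 complex_eq_iff)
  moreover have "pauli v ** pauli v = mat (- of_real ((norm v)\<^sup>2))" for v
  proof -
    have "(norm v)\<^sup>2 = (v $ 1)\<^sup>2 + (v $ 2)\<^sup>2 + (v $ 3)\<^sup>2"
      unfolding power2_norm_eq_inner by (simp add: inner_vec_def sum_3 power2_eq_square)
    then show ?thesis
      by (simp add: pauli_def vec_eq_iff forall_2 matrix_matrix_mult_def sum_2 mat_def
          complex_eq_iff power2_eq_square algebra_simps)
  qed
  ultimately show ?thesis by (simp add: clifford_rep_def)
qed

definition e3 :: "real^3" where
  "e3 = axis 3 1"

text \<open>The spin frames of the projective line pulled back along the Hopf fibration.\<close>

definition hopf_pullback :: "'n::finite \<Rightarrow> 'n \<Rightarrow> ((complex^'n) \<times> (complex^2^2)) set" where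
  "hopf_pullback j k =
     {(x, q). norm x = 1 \<and> q \<in> Spin pauli \<and> hopf j k x = (1/2) *\<^sub>R spin_rot pauli q e3}"

text \<open>
  The isomorphism of \<open>Q\<close> with the pull-back of the tangent bundle of the projective line, lifted to
  spin structures. On frames it maps \<open>(f\<^sub>1, f\<^sub>2)\<close> to \<open>(\<xi>, f\<^sub>1\<^sup>*, f\<^sub>2\<^sup>*)\<close>, where \<open>*\<close> is the horizontal lift;
  \<open>\<iota>\<close> identifies the model plane \<open>e3\<^sup>\<bottom>\<close> of the tangent spaces of the projective line with the model
  plane \<open>horQ e\<close> of the fibres of \<open>Q\<close>. On spin frames it is a continuous, \<open>Spin(2)\<close>-equivariant lift,
  which for given \<open>\<iota>\<close> is unique up to a global sign.\<close>

definition hopf_spin_lift ::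
  "(complex^'n \<Rightarrow> complex^'w^'w) \<Rightarrow> complex^'n \<Rightarrow> 'n \<Rightarrow> 'n \<Rightarrow> (real^3 \<Rightarrow> complex^'n) \<Rightarrow>
   (complex^'n \<Rightarrow> complex^2^2 \<Rightarrow> complex^'w^'w) \<Rightarrow> bool" where
  "hopf_spin_lift \<gamma> e j k \<iota> \<Phi> \<longleftrightarrow>
     linear \<iota> \<and> (\<forall>v. v \<bullet> e3 = 0 \<longrightarrow> \<iota> v \<in> horQ e \<and> norm (\<iota> v) = norm v) \<and>
     continuous_on (hopf_pullback j k) (\<lambda>(x, q). \<Phi> x q) \<and>
     (\<forall>(x, q)\<in>hopf_pullback j k.
        \<Phi> x q \<in> Spin \<gamma> \<and>
        spin_rot \<gamma> (\<Phi> x q) e = x \<and>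
        spin_rot \<gamma> (\<Phi> x q) (xi e) = xi x \<and>
        (\<forall>v. v \<bullet> e3 = 0 \<longrightarrow>
           spin_rot \<gamma> (\<Phi> x q) (\<iota> v) \<in> horQ x \<and>
           frechet_derivative (hopf j k) (at x) (spin_rot \<gamma> (\<Phi> x q) (\<iota> v)) = spin_rot pauli q v) \<and>
        (\<forall>u v. u \<bullet> e3 = 0 \<longrightarrow> v \<bullet> e3 = 0 \<longrightarrow> norm u = 1 \<longrightarrow> norm v = 1 \<longrightarrow>
           \<Phi> x (q ** pauli u ** pauli v) = \<Phi> x q ** \<gamma> (\<iota> u) ** \<gamma> (\<iota> v)))"

text \<open>The spinor \<open>\<psi>\<close> on the 3-sphere is \<open>\<phi> \<circ> \<pi>\<close> for the spinor \<open>\<phi>\<close> on the projective line, where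
  \<open>\<theta>\<close> identifies the spinor modules in such a way that \<open>\<xi> \<cdot> X\<^sup>* \<cdot>\<close> corresponds to \<open>X \<cdot>\<close>.
  It is unique up to a constant factor by irreducibility.\<close>

definition hopf_induced ::
  "(complex^'n \<Rightarrow> complex^'w^'w) \<Rightarrow> complex^'n \<Rightarrow> (complex^'w) set \<Rightarrow> 'n \<Rightarrow> 'n \<Rightarrow>
   (complex^2^2 \<Rightarrow> complex^2) \<Rightarrow> (complex^'w^'w \<Rightarrow> complex^'w) \<Rightarrow> bool" where
  "hopf_induced \<gamma> e \<Sigma> j k \<phi> \<psi> \<longleftrightarrow>
     (\<exists>\<iota> \<Phi> \<theta>. hopf_spin_lift \<gamma> e j k \<iota> \<Phi> \<and>
        Vector_Spaces.linear (*s) (*s) \<theta> \<and> bij_betw \<theta> UNIV \<Sigma> \<and>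
        (\<forall>v w. v \<bullet> e3 = 0 \<longrightarrow>
           \<theta> ((pauli e3 ** pauli v) *v w) = (\<gamma> e ** \<gamma> (xi e)) *v ((\<gamma> e ** \<gamma> (\<iota> v)) *v \<theta> w)) \<and>
        (\<forall>(x, q)\<in>hopf_pullback j k. \<psi> (\<Phi> x q) = \<theta> (\<phi> q)))"

end

theory Submission imports Defs begin

text \<open>The value \<open>(m+1)/2\<close> has two sources. The trivialization contributes
  \<open>1/2\<close> of the operator \<open>x \<xi>\<close>, and half of the action of \<Omega>
  contributes \<open>m/2\<close> of the same operator on a vacuum; \<alpha> has to compensate both.
  The fixed half-spinor space contains the lowest vacua for every \<open>m\<close>, but the highest
  ones only for odd \<open>m\<close>. For even \<open>m\<close> the highest line enters as
  \<open>x \<eta>\<close>, which reverses the sign of \<alpha>. For odd \<open>m\<close> both lines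
  have the same \<alpha>, so sums of the two kinds of spinors are solutions as well; this is the
  third alternative in the theorem. The case distinction in \<open>m\<close> comes from the
  transport operator \<open>\<xi> Z\<close>. For \<open>m \<ge> 2\<close> there is a horizontal
  complex line orthogonal to \<open>Z\<close> whose bivector commutes with this operator, while that
  of \<open>Z\<close> anticommutes with it. For \<open>m = 1\<close> there is no such line; instead
  complementary bivectors agree up to sign on a half-spinor space, so special unitary rotations act
  trivially there and the transport is completely explicit. What remains is its compatibility with
  the phase rotations of the Hopf fibres.\<close>

text \<open>For a spinor \<open>\<psi>\<close>, represented by an equivariant function on the spin frames \<open>p\<close>, the vector
  \<open>F = p \<psi>(p)\<close> depends on the base point only; this trivializes the spinor bundle of the sphere by
  Killing spinors. Along a horizontal great circle \<open>x\<^sub>t = cos t x + sin t Z\<close>, the equations of a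
  transversal Killing spinor become a linear differential equation for \<open>F\<close> with constant coefficients
  in a frame moved by unitary rotations, so that \<open>F(x\<^sub>t)\<close> is an explicit expression in \<open>F(x)\<close>. All
  directions \<open>Z\<close> must give the same value at the antipode. This yields \<open>\<beta> \<in> \<int>\<close> and that
  \<open>F\<close> has components in \<open>\<Sigma>\<^sub>0\<close> and \<open>\<Sigma>\<^sub>m\<close> only; for \<open>m \<ge> 2\<close>, arcs of length \<open>\<pi>/(2\<beta>)\<close> exclude
  \<open>\<beta> \<noteq> 0\<close>. If \<open>\<beta> = 0\<close>, the components of \<open>F\<close> are, up to Clifford multiplication by \<open>x\<close>, constant
  elements of the two lines of highest and lowest weight, and the derivative along \<open>\<xi>\<close> determines
  \<open>\<alpha>\<close>. If \<open>m = 1\<close> and \<open>\<beta> \<noteq> 0\<close>, comparing the values of \<open>F\<close> along different paths with the same end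
  points gives \<open>\<alpha> = 0\<close> and \<open>\<beta>\<^sup>2 = 1\<close>, and then the value of \<open>F\<close> in one point determines the Killing
  spinor of the base that induces \<open>\<psi>\<close>.\<close>

section \<open>Smooth functions\<close>

text \<open>The Leibniz rule multiplies a derivative of order \<open>k\<close> by an
  undifferentiated factor known at order \<open>k + 1\<close>; lowering the order closes the
  induction for products.\<close>

lemma Ck_on_Suc_lower: "Ck_on (Suc k) U f \<Longrightarrow> Ck_on k U f"
proof (induction k arbitrary: f)
  case 0
  then show ?case
    by (auto intro!: continuous_at_imp_continuous_on) (metis has_derivative_continuous)
next
  case (Suc k)
  obtain f' where f': "\<And>x. x \<in> U \<Longrightarrow> (f has_derivative f' x) (at x)"
    "\<And>v. Ck_on (Suc k) U (\<lambda>x. f' x v)"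
    using Suc.prems unfolding Ck_on.simps(2)[of "Suc k"] by blast
  show ?case
    unfolding Ck_on.simps(2)[of k]
    by (intro exI[of _ f'] conjI ballI allI f' Suc.IH)
qed

lemma Ck_on_const: "Ck_on k U (\<lambda>_. c)"
proof (induction k arbitrary: c)
  case (Suc k)
  show ?case unfolding Ck_on.simps
    by (rule exI[of _ "\<lambda>x v. 0"]) (auto simp: Suc)
qed simp

lemma Ck_on_bounded_linear:
  assumes "bounded_linear L" shows "Ck_on k U L"
proof (cases k)
  case 0
  then show ?thesis using assms by (simp add: linear_continuous_on)
next
  case (Suc k')
  show ?thesis unfolding Suc Ck_on.simps
    by (rule exI[of _ "\<lambda>x. L"])
      (auto simp: Ck_on_const intro: bounded_linear_imp_has_derivative assms)
qed

lemma Ck_on_compose_linear: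
  assumes "bounded_linear L" "Ck_on k U f" shows "Ck_on k U (\<lambda>x. L (f x))"
  using assms(2)
proof (induction k arbitrary: f)
  case 0
  then show ?case
    using bounded_linear.continuous_on[OF assms(1)] by simp
next
  case (Suc k)
  obtain f' where f': "\<And>x. x \<in> U \<Longrightarrow> (f has_derivative f' x) (at x)"
    "\<And>v. Ck_on k U (\<lambda>x. f' x v)"
    using Suc.prems unfolding Ck_on.simps by blast
  show ?case unfolding Ck_on.simps
    by (rule exI[of _ "\<lambda>x v. L (f' x v)"])
      (intro conjI ballI allI bounded_linear.has_derivative[OF assms(1)] f' Suc.IH)
qed

lemma Ck_on_add:
  assumes "Ck_on k U f" "Ck_on k U g" shows "Ck_on k U (\<lambda>x. f x + g x)"
  using assms
proof (induction k arbitrary: f g)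
  case 0
  then show ?case by (auto intro: continuous_intros)
next
  case (Suc k)
  obtain f' g' where f': "\<And>x. x \<in> U \<Longrightarrow> (f has_derivative f' x) (at x)"
    "\<And>v. Ck_on k U (\<lambda>x. f' x v)" and g': "\<And>x. x \<in> U \<Longrightarrow> (g has_derivative g' x) (at x)"
    "\<And>v. Ck_on k U (\<lambda>x. g' x v)"
    using Suc.prems unfolding Ck_on.simps by blast
  show ?case unfolding Ck_on.simps
    by (rule exI[of _ "\<lambda>x v. f' x v + g' x v"])
      (intro conjI ballI allI has_derivative_add f' g' Suc.IH)
qed

lemma Ck_on_mult:
  fixes f g :: "'a::real_normed_vector \<Rightarrow> 'b::real_normed_algebra"
  assumes "Ck_on k U f" "Ck_on k U g" shows "Ck_on k U (\<lambda>x. f x * g x)"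
  using assms
proof (induction k arbitrary: f g)
  case 0
  then show ?case by (auto intro: continuous_intros)
next
  case (Suc k)
  obtain f' g' where f': "\<And>x. x \<in> U \<Longrightarrow> (f has_derivative f' x) (at x)"
    "\<And>v. Ck_on k U (\<lambda>x. f' x v)" and g': "\<And>x. x \<in> U \<Longrightarrow> (g has_derivative g' x) (at x)"
    "\<And>v. Ck_on k U (\<lambda>x. g' x v)"
    using Suc.prems unfolding Ck_on.simps by blast
  show ?case unfolding Ck_on.simps
    by (rule exI[of _ "\<lambda>x v. f x * g' x v + f' x v * g x"])
      (intro conjI ballI allI has_derivative_mult f' g' Ck_on_add Suc.IH
        Suc.prems[THEN Ck_on_Suc_lower])
qed

lemma Ck_on_sum:
  assumes "\<And>i. i \<in> I \<Longrightarrow> Ck_on k U (f i)"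
  shows "Ck_on k U (\<lambda>x. \<Sum>i\<in>I. f i x)"
  using assms by (induction I rule: infinite_finite_induct) (auto intro: Ck_on_const Ck_on_add)

lemma Ck_on_prod:
  fixes f :: "'i \<Rightarrow> 'a::real_normed_vector \<Rightarrow> 'b::real_normed_field"
  assumes "\<And>i. i \<in> I \<Longrightarrow> Ck_on k U (f i)"
  shows "Ck_on k U (\<lambda>x. \<Prod>i\<in>I. f i x)"
  using assms by (induction I rule: infinite_finite_induct) (auto intro: Ck_on_const Ck_on_mult)

lemma Ck_on_vec:
  fixes f :: "'a::real_normed_vector \<Rightarrow> 'b::euclidean_space ^ 'n"
  assumes "\<And>i. Ck_on k U (\<lambda>x. f x $ i)"
  shows "Ck_on k U f"
proof -
  have eq: "f x = (\<Sum>i\<in>UNIV. axis i (f x $ i))" for x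
    by (simp add: vec_eq_iff axis_def if_distrib cong: if_cong)
  have lin: "bounded_linear (\<lambda>y::'b. axis i y :: 'b^'n)" for i
    by (rule linear_conv_bounded_linear[THEN iffD1])
      (auto simp: linear_iff vec_eq_iff axis_def)
  have "Ck_on k U (\<lambda>x. \<Sum>i\<in>UNIV. axis i (f x $ i))"
    by (intro Ck_on_sum Ck_on_compose_linear[OF lin] assms)
  then show ?thesis by (simp flip: eq)
qed

section \<open>Determinants, and smoothness of the inverse where the determinant is a sign\<close>

lemma Ck_on_det:
  fixes f :: "'a::real_normed_vector \<Rightarrow> complex^'n^'n"
  assumes "\<And>i j. Ck_on k U (\<lambda>x. f x $ i $ j)"
  shows "Ck_on k U (\<lambda>x. det (f x))"
  unfolding det_def by (intro Ck_on_sum Ck_on_mult Ck_on_const Ck_on_prod assms)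

lemma Ck_on_entry: "Ck_on k U (\<lambda>A::complex^'n^'m. A $ i $ j)"
  by (intro Ck_on_bounded_linear bounded_linear_compose[OF bounded_linear_vec_nth bounded_linear_vec_nth])

lemma det_differentiable: "det differentiable (at (A::complex^'n^'n))"
proof -
  have "Ck_on (Suc 0) UNIV (det :: complex^'n^'n \<Rightarrow> complex)"
    by (intro Ck_on_det Ck_on_entry)
  then show ?thesis unfolding Ck_on.simps differentiable_def by blast
qed

lemma det_mat: "det (mat c :: 'a::comm_ring_1^'n^'n) = c ^ CARD('n)"
  by (subst det_diagonal) (auto simp: mat_def)

text \<open>Cramer's rule expresses the inverse through quotients by \<open>det p\<close>. On
  \<open>S\<close> the factor \<open>1 / det p\<close> equals \<open>det p\<close>, so the entries
  are restrictions of polynomials on the whole matrix space.\<close>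

lemma smooth_on_matrix_inv:
  fixes S :: "(complex^'w^'w) set"
  assumes "\<And>p. p \<in> S \<Longrightarrow> (det p)\<^sup>2 = 1"
  shows "smooth_on S (\<lambda>p. matrix_inv p *v \<eta>)"
proof -
  define G where "G p = (\<chi> k. det (\<chi> i j. if j = k then \<eta> $ i else p $ i $ j) * det p)"
    for p :: "complex^'w^'w"
  have 1: "Ck_on k UNIV (\<lambda>p. if j = l then \<eta> $ i else p $ i $ j)" for i j k l
    by (cases "j = l") (auto intro: Ck_on_const Ck_on_entry)
  have smooth: "Ck_on k UNIV G" for k
    unfolding G_def
    by (rule Ck_on_vec, simp, intro Ck_on_mult Ck_on_det Ck_on_entry, simp add: 1)
  have "G p = matrix_inv p *v \<eta>" if "p \<in> S" for p
  proof -
    have sq: "det p * det p = 1" using assms[OF that] by (simp add: power2_eq_square)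
    then have nz: "det p \<noteq> 0" by auto
    with sq have d: "det p \<noteq> 0" "1 / det p = det p" by (auto simp: divide_eq_eq)
    have "invertible p" using d(1) by (simp add: invertible_det_nz)
    then have "p ** matrix_inv p = mat 1"
      unfolding invertible_def matrix_inv_def
      by (metis (mono_tags, lifting) tfl_some)
    then have "p *v (matrix_inv p *v \<eta>) = \<eta>" by (simp add: matrix_vector_mul_assoc)
    then have *: "matrix_inv p *v \<eta> = (\<chi> k. det (\<chi> i j. if j = k then \<eta> $ i else p $ i $ j) / det p)"
      using cramer[OF d(1)] by blast
    show ?thesis unfolding * G_def
      by (simp add: vec_eq_iff divide_inverse) (metis d(2) inverse_eq_divide)
  qed
  with smooth show ?thesis
    unfolding smooth_on_def by (auto intro!: exI[of _ UNIV] exI[of _ G])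
qed

lemma smooth_on_cong:
  assumes "\<And>x. x \<in> S \<Longrightarrow> f x = g x" "smooth_on S g"
  shows "smooth_on S f"
proof -
  have "(\<forall>y\<in>S \<inter> U. h y = f y) \<longleftrightarrow> (\<forall>y\<in>S \<inter> U. h y = g y)" for h U
    by (auto simp: assms(1))
  with assms(2) show ?thesis unfolding smooth_on_def by simp
qed

lemma smooth_on_compose_linear:
  assumes "bounded_linear L" "smooth_on S f"
  shows "smooth_on S (\<lambda>x. L (f x))"
  unfolding smooth_on_def
proof
  fix x assume "x \<in> S"
  with assms(2) obtain U g where "open U" "x \<in> U" "\<forall>k. Ck_on k U g" "\<forall>y\<in>S \<inter> U. g y = f y"
    unfolding smooth_on_def by blast
  then show "\<exists>U g. open U \<and> x \<in> U \<and> (\<forall>k. Ck_on k U g) \<and> (\<forall>y\<in>S \<inter> U. g y = L (f y))"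
    by (intro exI[of _ U] exI[of _ "\<lambda>x. L (g x)"]) (auto intro: Ck_on_compose_linear[OF assms(1)])
qed

text \<open>A smooth function on a subset has a derivative along any curve in the subset, which depends on
  the velocity only. The derivative need not be unique, as the subset has no interior.\<close>

lemma smooth_on_imp_curve_derivative:
  assumes "smooth_on S f" "p \<in> S"
  obtains D where "linear D"
    "\<And>q v. q 0 = p \<Longrightarrow> (\<forall>t. q t \<in> S) \<Longrightarrow> (q has_vector_derivative v) (at 0) \<Longrightarrow>
       ((\<lambda>t. f (q t)) has_vector_derivative D v) (at (0::real))"
proof -
  obtain U g where U: "open U" "p \<in> U" "\<forall>k. Ck_on k U g" "\<forall>y\<in>S \<inter> U. g y = f y"
    using assms unfolding smooth_on_def by blast
  have "Ck_on (Suc 0) U g" using U(3) by blast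
  then obtain g' where g': "(g has_derivative g') (at p)"
    using U(2) unfolding Ck_on.simps by blast
  have "((\<lambda>t. f (q t)) has_vector_derivative g' v) (at 0)"
    if q: "q 0 = p" "\<forall>t. q t \<in> S" "(q has_vector_derivative v) (at 0)" for q v
  proof -
    have "((\<lambda>t. g (q t)) has_derivative (\<lambda>t. g' (t *\<^sub>R v))) (at 0)"
      using has_derivative_compose[OF q(3)[unfolded has_vector_derivative_def], of g g'] g' q(1) by simp
    then have 1: "((\<lambda>t. g (q t)) has_vector_derivative g' v) (at 0)"
      unfolding has_vector_derivative_def
      by (simp add: linear_scale[OF has_derivative_linear[OF g']])
    have "isCont q 0" using q(3) by (rule has_vector_derivative_continuous)
    then have "\<forall>\<^sub>F t in at 0. q t \<in> U"
      using U(1,2) q(1) by (metis isCont_def topological_tendstoD)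
    then have ev: "\<forall>\<^sub>F t in at 0. f (q t) = g (q t)"
      by (rule eventually_mono) (use U(4) q(2) in auto)
    have "f (q 0) = g (q 0)" using U(2,4) q(1) assms(2) by auto
    then show ?thesis
      using 1 ev unfolding has_vector_derivative_def
      by (elim has_derivative_transform_eventually) (auto elim: eventually_mono)
  qed
  with has_derivative_linear[OF g'] show thesis by (rule that)
qed

section \<open>Clifford modules and spin groups\<close>

lemma scaleR_conv_smult: "r *\<^sub>R w = complex_of_real r *s (w::complex^'n)"
  by (simp add: vec_eq_iff scaleR_conv_of_real[where 'a = complex])

lemma scaleR_mv: "(r *\<^sub>R A) *v w = r *\<^sub>R (A *v w)" for A :: "complex^'n^'m"
  by (simp add: vec_eq_iff matrix_vector_mult_def scaleR_sum_right)

lemma mv_scaleR: "A *v (r *\<^sub>R w) = r *\<^sub>R (A *v w)" for A :: "complex^'n^'m"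
  using vector_scalar_commute[of A "complex_of_real r" w] by (simp add: scaleR_conv_smult)

lemma mv_minus: "A *v (- w) = - (A *v w)" for A :: "complex^'n^'m"
  using vector_scalar_commute[of A "-1" w] by simp

lemma minus_mv: "(- A) *v w = - (A *v w)" for A :: "complex^'n^'m"
  by (simp add: vec_eq_iff matrix_vector_mult_def sum_negf)

lemma mat_mv: "mat c *v w = c *s (w::complex^'n)"
  by (simp add: vec_eq_iff matrix_vector_mult_def mat_def if_distrib if_distribR cong: if_cong)

lemma mm_mv: "(A ** B) *v w = A *v (B *v w)"
  by (simp add: matrix_vector_mul_assoc)

lemmas mv_simps = matrix_vector_right_distrib matrix_vector_mult_diff_distrib
  matrix_vector_mult_add_rdistrib matrix_vector_mult_diff_rdistrib scaleR_mv mv_scaleR mv_minus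
  minus_mv mat_mv mm_mv vector_scalar_commute

lemma bounded_bilinear_mv: "bounded_bilinear (\<lambda>(A::complex^'n^'m) w. A *v w)"
  by (rule bilinear_conv_bounded_bilinear[THEN iffD1])
    (auto simp: bilinear_def linear_iff mv_simps)

lemma bounded_bilinear_mm: "bounded_bilinear (\<lambda>(A::complex^'n^'m) (B::complex^'k^'n). A ** B)"
  by (rule bilinear_conv_bounded_bilinear[THEN iffD1])
    (auto simp: bilinear_def linear_iff matrix_eq mv_simps)

lemmas has_vector_derivative_mv = bounded_bilinear.has_vector_derivative[OF bounded_bilinear_mv]
lemmas has_vector_derivative_mm = bounded_bilinear.has_vector_derivative[OF bounded_bilinear_mm]

locale clifford =
  fixes \<gamma> :: "'e::euclidean_space \<Rightarrow> complex^'w^'w"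
  assumes clifford_rep: "clifford_rep \<gamma>"
begin

lemma linear_gamma: "linear \<gamma>"
  using clifford_rep by (simp add: clifford_rep_def)

lemma gamma_add: "\<gamma> (u + v) *v w = \<gamma> u *v w + \<gamma> v *v w"
  and gamma_diff: "\<gamma> (u - v) *v w = \<gamma> u *v w - \<gamma> v *v w"
  and gamma_scale: "\<gamma> (r *\<^sub>R u) *v w = r *\<^sub>R (\<gamma> u *v w)"
  and gamma_minus: "\<gamma> (- u) *v w = - (\<gamma> u *v w)"
  and gamma_0: "\<gamma> 0 *v w = 0"
  using linear_gamma
  by (auto simp: linear_add linear_diff linear_cmul linear_neg linear_0 mv_simps)

lemmas gamma_simps = gamma_add gamma_diff gamma_scale gamma_minus gamma_0

lemma gamma_sq: "\<gamma> v *v (\<gamma> v *v w) = - ((norm v)\<^sup>2 *\<^sub>R w)"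
proof -
  have "\<gamma> v ** \<gamma> v = mat (- of_real ((norm v)\<^sup>2))"
    using clifford_rep by (simp add: clifford_rep_def)
  then have "(\<gamma> v ** \<gamma> v) *v w = - (complex_of_real ((norm v)\<^sup>2) *s w)"
    by (simp add: mat_mv)
  then show ?thesis by (simp add: mm_mv scaleR_conv_smult)
qed

text \<open>Polarization of \<open>gamma_sq\<close>.\<close>

lemma gamma_anti: "\<gamma> u *v (\<gamma> v *v w) = - (\<gamma> v *v (\<gamma> u *v w)) - (2 * (u \<bullet> v)) *\<^sub>R w"
proof -
  have "(norm (u + v))\<^sup>2 = (norm u)\<^sup>2 + (norm v)\<^sup>2 + 2 * (u \<bullet> v)"
    by (simp add: power2_norm_eq_inner inner_simps inner_commute)
  then have "\<gamma> (u + v) *v (\<gamma> (u + v) *v w) =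
      - ((norm u)\<^sup>2 *\<^sub>R w) - (norm v)\<^sup>2 *\<^sub>R w - (2 * (u \<bullet> v)) *\<^sub>R w"
    by (simp add: gamma_sq scaleR_left_distrib)
  then have "\<gamma> u *v (\<gamma> v *v w) + \<gamma> v *v (\<gamma> u *v w) + (2 * (u \<bullet> v)) *\<^sub>R w = 0"
    by (simp add: gamma_simps mv_simps gamma_sq algebra_simps)
  moreover have "a = (a + b + c) - b - c" for a b c :: "complex^'w" by simp
  ultimately show ?thesis by (metis diff_0)
qed

lemma gamma_anti0: "u \<bullet> v = 0 \<Longrightarrow> \<gamma> u *v (\<gamma> v *v w) = - (\<gamma> v *v (\<gamma> u *v w))"
  using gamma_anti[of u v w] by simp

lemma gamma_sq1: "norm v = 1 \<Longrightarrow> \<gamma> v *v (\<gamma> v *v w) = - w"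
  by (simp add: gamma_sq)

lemma gamma_eq_0: "\<gamma> v *v w = 0 \<longleftrightarrow> v = 0 \<or> w = 0"
proof
  assume "\<gamma> v *v w = 0"
  then have "(norm v)\<^sup>2 *\<^sub>R w = 0" using gamma_sq[of v w] by simp
  then show "v = 0 \<or> w = 0" by simp
qed (auto simp: gamma_0)

text \<open>A non-zero vector acts invertibly, so a vector is determined by its action on a single
  non-zero spinor. Rotations can therefore be identified by testing one spinor.\<close>

lemma gamma_inj: "w \<noteq> 0 \<Longrightarrow> \<gamma> u *v w = \<gamma> v *v w \<Longrightarrow> u = v"
  using gamma_eq_0[of "u - v" w] by (simp add: gamma_simps)

section \<open>The spin group and its rotations\<close>

lemma Spin_pair: "norm u = 1 \<Longrightarrow> norm v = 1 \<Longrightarrow> \<gamma> u ** \<gamma> v \<in> Spin \<gamma>"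
  using Spin.mult[OF Spin.one, of u v \<gamma>] by simp

lemma Spin_mult: "p \<in> Spin \<gamma> \<Longrightarrow> q \<in> Spin \<gamma> \<Longrightarrow> p ** q \<in> Spin \<gamma>"
  by (rotate_tac 1, induction q rule: Spin.induct)
    (auto simp: matrix_mul_assoc intro: Spin.intros)

text \<open>A pair \<open>u v\<close> of unit vectors is inverted by \<open>v u\<close>, since the
  two squares \<open>- 1\<close> cancel.\<close>

lemma Spin_inverse: "p \<in> Spin \<gamma> \<Longrightarrow> \<exists>q\<in>Spin \<gamma>. p ** q = mat 1 \<and> q ** p = mat 1"
proof (induction rule: Spin.induct)
  case one
  then show ?case by (auto intro: Spin.one)
next
  case (mult p u v)
  then obtain q where q: "q \<in> Spin \<gamma>" "p ** q = mat 1" "q ** p = mat 1" by blast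
  have qv: "p *v (q *v w) = w" "q *v (p *v w) = w" for w
    using q(2,3) by (metis mm_mv matrix_vector_mul_lid)+
  show ?case
    by (rule bexI[of _ "\<gamma> v ** \<gamma> u ** q"])
      (auto simp: matrix_eq mv_simps qv gamma_sq1 mult.hyps intro!: Spin_mult q Spin_pair)
qed

lemma matrix_inv_Spin:
  assumes "p \<in> Spin \<gamma>"
  shows "matrix_inv p \<in> Spin \<gamma>" "p ** matrix_inv p = mat 1" "matrix_inv p ** p = mat 1"
proof -
  obtain q where q: "q \<in> Spin \<gamma>" "p ** q = mat 1" "q ** p = mat 1"
    using Spin_inverse assms by blast
  then have *: "p ** matrix_inv p = mat 1 \<and> matrix_inv p ** p = mat 1"
    unfolding matrix_inv_def
    by (intro someI[of "\<lambda>A. p ** A = mat 1 \<and> A ** p = mat 1" q] conjI)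
  have "matrix_inv p = (q ** p) ** matrix_inv p" by (simp add: q(3))
  also have "\<dots> = q" by (simp only: * matrix_mul_rid flip: matrix_mul_assoc)
  finally have "matrix_inv p = q" .
  with q(1) * show "matrix_inv p \<in> Spin \<gamma>" "p ** matrix_inv p = mat 1" "matrix_inv p ** p = mat 1"
    by auto
qed

lemma Spin_inv_mv:
  assumes "p \<in> Spin \<gamma>"
  shows "p *v (matrix_inv p *v w) = w" "matrix_inv p *v (p *v w) = w"
  by (simp_all add: matrix_inv_Spin[OF assms] flip: mm_mv)

lemma Spin_mv_eq_0: "p \<in> Spin \<gamma> \<Longrightarrow> p *v w = 0 \<longleftrightarrow> w = 0"
  using Spin_inv_mv(2)[of p w] by (metis matrix_vector_mult_0_right)

definition reflect :: "'e \<Rightarrow> 'e \<Rightarrow> 'e" where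
  "reflect a v = v - (2 * (a \<bullet> v)) *\<^sub>R a"

lemma gamma_reflect:
  "norm a = 1 \<Longrightarrow> \<gamma> a *v (\<gamma> v *v w) = - (\<gamma> (reflect a v) *v (\<gamma> a *v w))"
  by (simp add: reflect_def gamma_simps gamma_sq1 gamma_anti[of a v])

text \<open>Conjugation by a unit vector is minus a reflection; in even products the signs
  cancel.\<close>

lemma ex_spin_rot: "p \<in> Spin \<gamma> \<Longrightarrow> \<exists>u. \<forall>w. p *v (\<gamma> v *v w) = \<gamma> u *v (p *v w)"
proof (induction arbitrary: v rule: Spin.induct)
  case (mult p a b)
  obtain u where u: "\<And>w. p *v (\<gamma> (reflect a (reflect b v)) *v w) = \<gamma> u *v (p *v w)"
    using mult.IH by blast
  show ?case
    by (rule exI[of _ u]) (simp add: mm_mv gamma_reflect mult.hyps mv_simps u)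
qed auto

text \<open>By \<open>gamma_inj\<close> the matrix identity in the definition of
  \<open>spin_rot\<close> may be checked on one spinor.\<close>

lemma spin_rot_unique:
  assumes "p \<in> Spin \<gamma>" "w \<noteq> 0" "p *v (\<gamma> v *v w) = \<gamma> u *v (p *v w)"
  shows "spin_rot \<gamma> p v = u"
proof -
  obtain u' where u': "\<And>w. p *v (\<gamma> v *v w) = \<gamma> u' *v (p *v w)"
    using ex_spin_rot[OF assms(1)] by blast
  have nz: "p *v w \<noteq> 0" using assms(1,2) by (simp add: Spin_mv_eq_0)
  have "u' = u" by (rule gamma_inj[OF nz]) (metis u' assms(3))
  with u' have u: "p ** \<gamma> v = \<gamma> u ** p" by (simp add: matrix_eq mm_mv)
  have "a = u" if "p ** \<gamma> v = \<gamma> a ** p" for a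
    by (rule gamma_inj[OF nz]) (metis that u mm_mv)
  with u show ?thesis unfolding spin_rot_def by blast
qed

lemma spin_rot:
  assumes "p \<in> Spin \<gamma>" shows "p *v (\<gamma> v *v w) = \<gamma> (spin_rot \<gamma> p v) *v (p *v w)"
proof (cases "w = 0")
  case False
  obtain u where u: "\<And>w. p *v (\<gamma> v *v w) = \<gamma> u *v (p *v w)"
    using ex_spin_rot[OF assms] by blast
  with spin_rot_unique[OF assms False] show ?thesis by metis
qed simp

lemma spin_rot_eqI:
  "p \<in> Spin \<gamma> \<Longrightarrow> (\<And>w. p *v (\<gamma> v *v w) = \<gamma> u *v (p *v w)) \<Longrightarrow> spin_rot \<gamma> p v = u"
  using spin_rot_unique[of p "1" v u] by (metis zero_neq_one)

lemma spin_rot_inv: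
  "p \<in> Spin \<gamma> \<Longrightarrow> matrix_inv p *v (\<gamma> (spin_rot \<gamma> p v) *v w) = \<gamma> v *v (matrix_inv p *v w)"
  using spin_rot[of p v "matrix_inv p *v w"] by (metis Spin_inv_mv)

lemma spin_rot_one: "spin_rot \<gamma> (mat 1) v = v"
  by (rule spin_rot_eqI) (auto simp: Spin.one)

lemma spin_rot_mult:
  "p \<in> Spin \<gamma> \<Longrightarrow> q \<in> Spin \<gamma> \<Longrightarrow> spin_rot \<gamma> (p ** q) v = spin_rot \<gamma> p (spin_rot \<gamma> q v)"
  by (rule spin_rot_eqI) (auto simp: Spin_mult mm_mv spin_rot)

lemma spin_rot_matrix_inv:
  "p \<in> Spin \<gamma> \<Longrightarrow> spin_rot \<gamma> (matrix_inv p) (spin_rot \<gamma> p v) = v"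
  "p \<in> Spin \<gamma> \<Longrightarrow> spin_rot \<gamma> p (spin_rot \<gamma> (matrix_inv p) v) = v"
  by (metis matrix_inv_Spin spin_rot_mult spin_rot_one)+

lemma bij_spin_rot: "p \<in> Spin \<gamma> \<Longrightarrow> bij (spin_rot \<gamma> p)"
  by (rule o_bij[of "spin_rot \<gamma> (matrix_inv p)"]) (auto simp: spin_rot_matrix_inv)

lemma spin_rot_inv_right: "p \<in> Spin \<gamma> \<Longrightarrow> spin_rot \<gamma> p (inv (spin_rot \<gamma> p) v) = v"
  using bij_spin_rot[of p] by (auto simp: bij_def surj_f_inv_f)

lemma linear_spin_rot: "p \<in> Spin \<gamma> \<Longrightarrow> linear (spin_rot \<gamma> p)"
  by (intro linearI spin_rot_eqI) (auto simp: gamma_simps mv_simps spin_rot)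

lemma norm_spin_rot: assumes "p \<in> Spin \<gamma>" shows "norm (spin_rot \<gamma> p v) = norm v"
proof -
  have "p *v (\<gamma> v *v (\<gamma> v *v 1)) = \<gamma> (spin_rot \<gamma> p v) *v (\<gamma> (spin_rot \<gamma> p v) *v (p *v 1))"
    by (simp add: spin_rot assms)
  then have "((norm v)\<^sup>2 - (norm (spin_rot \<gamma> p v))\<^sup>2) *\<^sub>R (p *v 1) = 0"
    by (simp add: gamma_sq mv_simps algebra_simps)
  then have "(norm v)\<^sup>2 = (norm (spin_rot \<gamma> p v))\<^sup>2"
    using Spin_mv_eq_0[OF assms, of 1] by (metis eq_iff_diff_eq_0 scaleR_eq_0_iff zero_neq_one)
  then show ?thesis by simp
qed

lemma inner_spin_rot:
  assumes "p \<in> Spin \<gamma>" shows "spin_rot \<gamma> p u \<bullet> spin_rot \<gamma> p v = u \<bullet> v"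
  using norm_spin_rot[OF assms] linear_spin_rot[OF assms]
  by (simp add: dot_norm linear_add[symmetric])

text \<open>The rotation by the angle \<open>t\<close> from \<open>u\<close> towards \<open>v\<close>, for orthonormal \<open>u\<close>, \<open>v\<close>, and its lift
  to the spin group.\<close>

definition plane_rot :: "'e \<Rightarrow> 'e \<Rightarrow> real \<Rightarrow> 'e \<Rightarrow> 'e" where
  "plane_rot u v t y = y + ((cos t - 1) * (y \<bullet> u) - sin t * (y \<bullet> v)) *\<^sub>R u
                         + (sin t * (y \<bullet> u) + (cos t - 1) * (y \<bullet> v)) *\<^sub>R v"

definition spin_exp :: "'e \<Rightarrow> 'e \<Rightarrow> real \<Rightarrow> complex^'w^'w" where
  "spin_exp u v t = cos (t/2) *\<^sub>R mat 1 + sin (t/2) *\<^sub>R (\<gamma> u ** \<gamma> v)"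

lemma spin_exp_mv: "spin_exp u v t *v w = cos (t/2) *\<^sub>R w + sin (t/2) *\<^sub>R (\<gamma> u *v (\<gamma> v *v w))"
  by (simp add: spin_exp_def mv_simps)

lemma spin_exp_0: "spin_exp u v 0 = mat 1"
  by (simp add: spin_exp_def)

definition orthonormal2 :: "'e \<Rightarrow> 'e \<Rightarrow> bool" where
  "orthonormal2 u v \<longleftrightarrow> norm u = 1 \<and> norm v = 1 \<and> u \<bullet> v = 0"

lemma spin_exp_Spin:
  assumes "orthonormal2 u v" shows "spin_exp u v t \<in> Spin \<gamma>"
proof -
  \<comment> \<open>The rotation is the product of the reflections in \<open>u\<close> and in this
    unit vector; \<open>u\<close> squares to \<open>- 1\<close>, which turns the coefficient
    \<open>- cos (t/2)\<close> into the scalar part of the exponential.\<close>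
  let ?v = "sin (t/2) *\<^sub>R v - cos (t/2) *\<^sub>R u"
  have o: "u \<bullet> u = 1" "v \<bullet> v = 1" "u \<bullet> v = 0" "v \<bullet> u = 0"
    using assms by (auto simp: orthonormal2_def inner_commute norm_eq_1)
  have "?v \<bullet> ?v = (sin (t/2))\<^sup>2 + (cos (t/2))\<^sup>2"
    by (simp add: inner_simps o power2_eq_square)
  then have "norm ?v = 1" by (simp add: norm_eq_1)
  moreover have "spin_exp u v t = \<gamma> u ** \<gamma> ?v"
    using assms by (simp add: matrix_eq spin_exp_mv mm_mv gamma_simps mv_simps gamma_sq1 orthonormal2_def)
  ultimately show ?thesis using assms Spin_pair by (metis orthonormal2_def)
qed

lemma spin_exp_gamma:
  assumes "orthonormal2 u v"
  shows "spin_exp u v t *v (\<gamma> y *v w) = \<gamma> (plane_rot u v t y) *v (spin_exp u v t *v w)"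
proof -
  define z where "z = y - (y \<bullet> u) *\<^sub>R u - (y \<bullet> v) *\<^sub>R v"
  have o: "norm u = 1" "norm v = 1" "u \<bullet> v = 0" "v \<bullet> u = 0" "u \<bullet> u = 1" "v \<bullet> v = 1"
    using assms by (auto simp: orthonormal2_def inner_commute norm_eq_1)
  then have z: "u \<bullet> z = 0" "v \<bullet> z = 0"
    by (auto simp: z_def inner_simps inner_commute)
  obtain a b where y: "y = a *\<^sub>R u + b *\<^sub>R v + z" and ab: "y \<bullet> u = a" "y \<bullet> v = b"
    by (auto simp: z_def)
  have pl: "plane_rot u v t y = (cos t * a - sin t * b) *\<^sub>R u + (sin t * a + cos t * b) *\<^sub>R v + z"
    unfolding plane_rot_def ab by (simp add: y algebra_simps)
  have t: "cos t = (cos (t/2))\<^sup>2 - (sin (t/2))\<^sup>2" "sin t = 2 * sin (t/2) * cos (t/2)"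
    using cos_double[of "t/2"] sin_double[of "t/2"] by auto
  \<comment> \<open>With the half-angle functions as complex unknowns the claim is, entry by entry,
    a polynomial identity modulo \<open>c * c + s * s = 1\<close>.\<close>
  define c s where "c = complex_of_real (cos (t/2))" and "s = complex_of_real (sin (t/2))"
  have cs: "c * c + s * s = 1"
    unfolding c_def s_def of_real_mult[symmetric] of_real_add[symmetric]
    using sin_cos_squared_add[of "t/2"] by (simp add: power2_eq_square add.commute)
  define a' b' where "a' = complex_of_real a" and "b' = complex_of_real b"
  show ?thesis
    unfolding pl unfolding y t spin_exp_mv
    by (simp add: gamma_simps mv_simps gamma_sq1 o gamma_anti0[of z u]
        gamma_anti0[of z v] gamma_anti0[of v u] z inner_commute[of z] power2_eq_square,
      simp add: vec_eq_iff scaleR_conv_of_real[where 'a = complex] flip: c_def s_def a'_def b'_def,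
      use cs in algebra)
qed

lemma spin_rot_spin_exp:
  "orthonormal2 u v \<Longrightarrow> spin_rot \<gamma> (spin_exp u v t) y = plane_rot u v t y"
  by (intro spin_rot_eqI spin_exp_Spin spin_exp_gamma)

lemma plane_rot_simps:
  assumes "orthonormal2 u v"
  shows "plane_rot u v t u = cos t *\<^sub>R u + sin t *\<^sub>R v"
    and "plane_rot u v t v = cos t *\<^sub>R v - sin t *\<^sub>R u"
    and "y \<bullet> u = 0 \<Longrightarrow> y \<bullet> v = 0 \<Longrightarrow> plane_rot u v t y = y"
  using assms by (auto simp: plane_rot_def orthonormal2_def inner_commute norm_eq_1 algebra_simps)

text \<open>The bivector \<open>u v\<close> squares to \<open>- 1\<close>, so the exponentials
  multiply like complex phases.\<close>

lemma spin_exp_add: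
  assumes "orthonormal2 u v"
  shows "spin_exp u v s ** spin_exp u v t = spin_exp u v (s + t)"
proof -
  have o: "norm u = 1" "norm v = 1" "v \<bullet> u = 0"
    using assms by (auto simp: orthonormal2_def inner_commute)
  show ?thesis
    by (simp add: matrix_eq mm_mv spin_exp_mv mv_simps gamma_anti0[OF o(3)] gamma_sq1 o
        add_divide_distrib cos_add sin_add algebra_simps)
qed

end

section \<open>Covariant derivatives of spinor fields\<close>

text \<open>What the covariant derivative depends on: a unit tangent vector exists in every point,
  elements of the spin group have determinant \<open>1\<close> or \<open>- 1\<close>, and Schur's
  lemma holds. The complex Euclidean spaces and the Pauli matrices are both instances.\<close>

locale irreducible_clifford = clifford \<gamma>
  for \<gamma> :: "'e::euclidean_space \<Rightarrow> complex^'w^'w" +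
  assumes dim: "DIM('e) \<ge> 2"
    and even_card: "even CARD('w)"
    and commutant: "\<And>A. (\<And>v. A ** \<gamma> v = \<gamma> v ** A) \<Longrightarrow> \<exists>c. A = mat c"
begin

lemma det_gamma:
  assumes "norm u = 1" shows "det (\<gamma> u) * det (\<gamma> u) = 1"
proof -
  have "\<gamma> u ** \<gamma> u = mat (- 1)"
    by (simp add: matrix_eq mm_mv gamma_sq1 assms mat_mv)
  then have "det (\<gamma> u) * det (\<gamma> u) = (- 1) ^ CARD('w)"
    by (metis det_mul det_mat)
  with even_card show ?thesis by simp
qed

lemma det_Spin: "p \<in> Spin \<gamma> \<Longrightarrow> (det p)\<^sup>2 = 1"
proof (induction rule: Spin.induct)
  case (mult p u v)
  have "(det (p ** \<gamma> u ** \<gamma> v))\<^sup>2 =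
      (det p)\<^sup>2 * (det (\<gamma> u) * det (\<gamma> u)) * (det (\<gamma> v) * det (\<gamma> v))"
    by (simp add: det_mul power2_eq_square)
  with mult show ?case by (simp add: det_gamma)
qed simp

lemma tangent_decomposition:
  assumes "norm x = 1" "X \<bullet> x = 0"
  obtains r u where "X = r *\<^sub>R u" "orthonormal2 x u"
proof (cases "X = 0")
  case True
  obtain y where "y \<noteq> 0" "orthogonal x y"
    using orthogonal_to_vector_exists[OF dim] by blast
  then have "orthonormal2 x (sgn y)"
    using assms by (simp add: orthonormal2_def norm_sgn orthogonal_def sgn_div_norm)
  with True show thesis by (intro that[of 0]) auto
next
  case False
  then show thesis
    using assms by (intro that[of "norm X" "sgn X"])
      (auto simp: orthonormal2_def norm_sgn sgn_div_norm inner_commute)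
qed

lemma spin_exp_chain:
  "((\<lambda>t. spin_exp u v (k * t)) has_vector_derivative
     (k/2) *\<^sub>R (cos (k * t/2) *\<^sub>R (\<gamma> u ** \<gamma> v) - sin (k * t/2) *\<^sub>R mat 1)) (at t)"
  unfolding spin_exp_def
  by (auto intro!: derivative_eq_intros simp: algebra_simps)

lemma plane_rot_derivative:
  "((\<lambda>t. plane_rot u v (k * t) y) has_vector_derivative
     (k * (- sin (k * t) * (y \<bullet> u) - cos (k * t) * (y \<bullet> v))) *\<^sub>R u +
     (k * (cos (k * t) * (y \<bullet> u) - sin (k * t) * (y \<bullet> v))) *\<^sub>R v) (at t)"
  unfolding plane_rot_def
  by (auto intro!: derivative_eq_intros simp: algebra_simps)

lemma spin_rot_spin_exp_mult:
  "orthonormal2 u v \<Longrightarrow> p \<in> Spin \<gamma> \<Longrightarrow>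
    spin_rot \<gamma> (spin_exp u v t ** p) y = plane_rot u v t (spin_rot \<gamma> p y)"
  by (simp add: spin_rot_mult spin_exp_Spin spin_rot_spin_exp)

text \<open>Under the rotation in the plane of \<open>x\<close> and \<open>u\<close> a frame vector
  orthogonal to the base point has a derivative proportional to the moving base point, so the frames
  are parallel along the great circle. The angular speed is \<open>r / R\<close> because the base
  point lies on a sphere of radius \<open>R\<close>. This also shows that the description in
  \<open>spin_cov\<close> is not vacuous.\<close>

lemma horizontal_curve_spin_exp:
  assumes p: "p \<in> Spin \<gamma>" and e: "norm e = 1" and R: "R \<noteq> 0"
    and x: "x = spin_rot \<gamma> p e" and o: "orthonormal2 x u"
  shows "horizontal_curve \<gamma> e R p (r *\<^sub>R u) (\<lambda>t. spin_exp x u (r / R * t) ** p)"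
  unfolding horizontal_curve_def
proof (intro conjI allI impI)
  let ?q = "\<lambda>t. spin_exp x u (r / R * t) ** p"
  have o': "x \<bullet> x = 1" "u \<bullet> x = 0" "x \<bullet> u = 0"
    using o by (auto simp: orthonormal2_def inner_commute norm_eq_1)
  show "?q 0 = p" by (simp add: spin_exp_0)
  show "?q t \<in> Spin \<gamma>" for t by (intro Spin_mult spin_exp_Spin o p)
  show "?q differentiable at t" for t
    using has_vector_derivative_mm[OF spin_exp_chain has_vector_derivative_const]
    by (blast intro: differentiableI_vector)
  show "((\<lambda>t. R *\<^sub>R spin_rot \<gamma> (?q t) e) has_vector_derivative r *\<^sub>R u) (at 0)"
    unfolding spin_rot_spin_exp_mult[OF o p] x[symmetric]
    by (rule has_vector_derivative_eq_rhs,
        rule bounded_linear.has_vector_derivative[OF bounded_linear_scaleR_right], rule plane_rot_derivative)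
       (simp add: o' R)
  fix t and v :: 'e assume "v \<bullet> e = 0"
  then have v: "spin_rot \<gamma> p v \<bullet> x = 0" using inner_spin_rot[OF p] by (simp add: x)
  show "\<exists>a. ((\<lambda>s. spin_rot \<gamma> (?q s) v) has_vector_derivative a *\<^sub>R spin_rot \<gamma> (?q t) e) (at t)"
    unfolding spin_rot_spin_exp_mult[OF o p] x[symmetric] plane_rot_simps(1)[OF o]
    by (rule exI[of _ "- (r / R * (spin_rot \<gamma> p v \<bullet> u))"],
        rule has_vector_derivative_eq_rhs, rule plane_rot_derivative)
       (simp add: v algebra_simps)
qed

text \<open>Horizontality determines the commutators of \<open>q' p\<^sup>-\<^sup>1\<close> with all vectors, hence \<open>q'\<close> up to a
  scalar multiple of \<open>p\<close>; and the determinant is \<open>\<plusminus>1\<close> along \<open>q\<close>.\<close>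

lemma horizontal_curve_velocity:
  assumes p: "p \<in> Spin \<gamma>" and e: "norm e = 1" and R: "R \<noteq> 0"
    and x: "x = spin_rot \<gamma> p e" and X: "X \<bullet> x = 0"
    and hor: "horizontal_curve \<gamma> e R p X q"
  shows "(q has_vector_derivative (1 / (2 * R)) *\<^sub>R (\<gamma> x ** \<gamma> X ** p)) (at 0)"
proof -
  have nx: "norm x = 1" using norm_spin_rot[OF p] e by (simp add: x)
  obtain r u where Xr: "X = r *\<^sub>R u" and o: "orthonormal2 x u"
    using tangent_decomposition[OF nx X] by blast
  have q0: "q 0 = p" and qS: "\<And>t. q t \<in> Spin \<gamma>" and "q differentiable (at 0)"
    using hor by (auto simp: horizontal_curve_def)
  then obtain Q where Q: "(q has_vector_derivative Q) (at 0)"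
    by (meson vector_derivative_works)
  let ?Q0 = "(1 / (2 * R)) *\<^sub>R (\<gamma> x ** \<gamma> X ** p)"
  define dr where "dr v = vector_derivative (\<lambda>t. spin_rot \<gamma> (q t) v) (at 0)" for v
  have de: "((\<lambda>t. spin_rot \<gamma> (q t) e) has_vector_derivative (1/R) *\<^sub>R X) (at 0)"
  proof -
    have "((\<lambda>t. R *\<^sub>R spin_rot \<gamma> (q t) e) has_vector_derivative X) (at 0)"
      using hor by (simp add: horizontal_curve_def)
    from bounded_linear.has_vector_derivative[OF bounded_linear_scaleR_right[of "1/R"] this]
    show ?thesis using R by simp
  qed
  have dv: "((\<lambda>t. spin_rot \<gamma> (q t) v) has_vector_derivative (- (1/R) * (X \<bullet> spin_rot \<gamma> p v)) *\<^sub>R x) (at 0)"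
    if v: "v \<bullet> e = 0" for v
  proof -
    obtain a where a: "((\<lambda>t. spin_rot \<gamma> (q t) v) has_vector_derivative a *\<^sub>R x) (at 0)"
      using hor v q0 unfolding horizontal_curve_def x by metis
    \<comment> \<open>The inner product of two vectors of the moving frame is constant; its
      derivative determines the coefficient \<open>a\<close> left open by horizontality.\<close>
    have "((\<lambda>t. spin_rot \<gamma> (q t) v \<bullet> spin_rot \<gamma> (q t) e) has_vector_derivative
        spin_rot \<gamma> (q 0) v \<bullet> (1/R) *\<^sub>R X + a *\<^sub>R x \<bullet> spin_rot \<gamma> (q 0) e) (at 0)"
      by (rule bounded_bilinear.has_vector_derivative[OF bounded_bilinear_inner a de])
    then have "((\<lambda>t::real. 0::real) has_vector_derivative
        spin_rot \<gamma> p v \<bullet> (1/R) *\<^sub>R X + a *\<^sub>R x \<bullet> x) (at 0)"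
      by (simp add: inner_spin_rot[OF qS] v q0 x)
    then have "spin_rot \<gamma> p v \<bullet> (1/R) *\<^sub>R X + a *\<^sub>R x \<bullet> x = 0"
      using vector_derivative_unique_at has_vector_derivative_const by blast
    then have "a = - (1/R) * (X \<bullet> spin_rot \<gamma> p v)"
      using nx by (simp add: norm_eq_1 inner_commute eq_neg_iff_add_eq_0 add.commute)
    with a show ?thesis by simp
  qed
  have main: "(Q - ?Q0) ** \<gamma> v = \<gamma> (spin_rot \<gamma> p v) ** (Q - ?Q0)" for v
  proof -
    define d where "d = (if v \<bullet> e = 0 then (- (1/R) * (X \<bullet> spin_rot \<gamma> p v)) *\<^sub>R x else 0)"
    have *: "(Q - ?Q0) *v (\<gamma> v *v w) = \<gamma> (spin_rot \<gamma> p v) *v ((Q - ?Q0) *v w)"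
      if D: "((\<lambda>t. spin_rot \<gamma> (q t) v) has_vector_derivative D) (at 0)"
        and DX: "D = (1 / R) *\<^sub>R ((spin_rot \<gamma> p v \<bullet> x) *\<^sub>R X - (X \<bullet> spin_rot \<gamma> p v) *\<^sub>R x)" for v D w
    proof -
      have "((\<lambda>t. q t *v (\<gamma> v *v w)) has_vector_derivative Q *v (\<gamma> v *v w)) (at 0)"
        using has_vector_derivative_mv[OF Q has_vector_derivative_const] by simp
      moreover have "((\<lambda>t. \<gamma> (spin_rot \<gamma> (q t) v) *v (q t *v w)) has_vector_derivative
          \<gamma> (spin_rot \<gamma> p v) *v (Q *v w) + \<gamma> D *v (p *v w)) (at 0)"
      proof -
        have "((\<lambda>t. \<gamma> (spin_rot \<gamma> (q t) v)) has_vector_derivative \<gamma> D) (at 0)"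
          by (rule bounded_linear.has_vector_derivative[OF _ D])
            (use linear_gamma in \<open>simp add: linear_conv_bounded_linear\<close>)
        moreover have "((\<lambda>t. q t *v w) has_vector_derivative Q *v w) (at 0)"
          using has_vector_derivative_mv[OF Q has_vector_derivative_const] by simp
        ultimately show ?thesis
          using has_vector_derivative_mv q0 by fastforce
      qed
      ultimately have "Q *v (\<gamma> v *v w) = \<gamma> (spin_rot \<gamma> p v) *v (Q *v w) + \<gamma> D *v (p *v w)"
        using vector_derivative_unique_at by (auto simp: spin_rot qS)
      moreover have "?Q0 *v (\<gamma> v *v w) = \<gamma> (spin_rot \<gamma> p v) *v (?Q0 *v w) + \<gamma> D *v (p *v w)"
      proof -
        let ?y = "spin_rot \<gamma> p v" and ?w = "p *v w"
        have "\<gamma> x *v (\<gamma> X *v (\<gamma> ?y *v ?w)) = \<gamma> ?y *v (\<gamma> x *v (\<gamma> X *v ?w))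
            + 2 *\<^sub>R ((?y \<bullet> x) *\<^sub>R (\<gamma> X *v ?w) - (X \<bullet> ?y) *\<^sub>R (\<gamma> x *v ?w))"
          unfolding gamma_anti[of X ?y] gamma_anti[of x ?y "\<gamma> X *v ?w", THEN arg_cong, of uminus] mv_simps
          by (simp add: gamma_anti[of x ?y] inner_commute algebra_simps)
        then show ?thesis
          by (simp add: DX mv_simps gamma_simps spin_rot[OF p] scaleR_diff_right scaleR_add_right)
      qed
      ultimately show ?thesis by (simp add: mv_simps)
    qed
    \<comment> \<open>The derivative of the frame is known separately on the complement of
      \<open>e\<close> and on \<open>e\<close>.\<close>
    define v1 where "v1 = v - (v \<bullet> e) *\<^sub>R e"
    have v: "v = v1 + (v \<bullet> e) *\<^sub>R e" and v1: "v1 \<bullet> e = 0"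
      using e by (simp_all add: v1_def inner_simps norm_eq_1)
    have *: "(Q - ?Q0) *v (\<gamma> v1 *v w) = \<gamma> (spin_rot \<gamma> p v1) *v ((Q - ?Q0) *v w)"
       "(Q - ?Q0) *v (\<gamma> e *v w) = \<gamma> (spin_rot \<gamma> p e) *v ((Q - ?Q0) *v w)" for w
      by (rule *, rule dv[OF v1], use inner_spin_rot[OF p, of v1 e] v1 in \<open>simp add: x\<close>)
        (rule *, rule de, use X nx in \<open>simp add: x[symmetric] norm_eq_1\<close>)
    have rv: "spin_rot \<gamma> p v = spin_rot \<gamma> p v1 + (v \<bullet> e) *\<^sub>R spin_rot \<gamma> p e"
      using linear_spin_rot[OF p] v by (metis linear_add linear_cmul)
    show ?thesis
      unfolding matrix_eq rv
      by (subst v) (simp only: mm_mv gamma_simps vec.add * mv_scaleR simp_thms)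
  qed
  have "\<exists>c. matrix_inv p ** (Q - ?Q0) = mat c"
  proof (rule commutant)
    fix v
    have "matrix_inv p ** (Q - ?Q0) ** \<gamma> v = matrix_inv p ** (\<gamma> (spin_rot \<gamma> p v) ** (Q - ?Q0))"
      by (subst matrix_mul_assoc[symmetric]) (simp only: main)
    then show "matrix_inv p ** (Q - ?Q0) ** \<gamma> v = \<gamma> v ** (matrix_inv p ** (Q - ?Q0))"
      by (simp add: matrix_eq mm_mv spin_rot_inv[OF p])
  qed
  then obtain c where c: "matrix_inv p ** (Q - ?Q0) = mat c" by blast
  have "p ** (matrix_inv p ** (Q - ?Q0)) = p ** mat c" by (simp only: c)
  then have Qc: "Q = ?Q0 + mat c ** p"
    by (simp add: matrix_mul_assoc matrix_inv_Spin[OF p])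
      (simp add: matrix_eq mv_simps algebra_simps)
  obtain d' where d': "(det has_derivative d') (at p)"
    using det_differentiable[of p] by (auto simp: differentiable_def)
  have lin: "linear d'" using d' by (rule has_derivative_linear)
  have curve: "((\<lambda>t. det (f t)) has_vector_derivative d' v) (at 0)"
    if "f 0 = p" "(f has_vector_derivative v) (at 0)" for f :: "real \<Rightarrow> complex^'w^'w" and v
    using has_derivative_compose[OF that(2)[unfolded has_vector_derivative_def], of det d'] d' that(1)
    by (simp add: has_vector_derivative_def linear_scale[OF lin])
  have zero: "d' v = 0"
    if f: "f 0 = p" "\<And>t. f t \<in> Spin \<gamma>" "(f has_vector_derivative v) (at 0)"
    for f :: "real \<Rightarrow> complex^'w^'w" and v
  proof -
    have "((\<lambda>t. det (f t) * det (f t)) has_vector_derivative det p * d' v + d' v * det p) (at 0)"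
      using has_vector_derivative_mult[OF curve[OF f(1,3)] curve[OF f(1,3)]] f(1) by simp
    moreover have "det (f t) * det (f t) = 1" for t
      using det_Spin[OF f(2)] by (simp add: power2_eq_square)
    ultimately have "((\<lambda>t::real. 1::complex) has_vector_derivative 2 * (det p * d' v)) (at 0)"
      by simp
    then have "2 * (det p * d' v) = 0"
      using vector_derivative_unique_at has_vector_derivative_const by blast
    moreover have "det p \<noteq> 0" using det_Spin[OF p] by auto
    ultimately show ?thesis by simp
  qed
  have "d' Q = 0" using zero q0 qS Q by blast
  moreover have "d' ?Q0 = 0"
  proof (rule zero)
    let ?q = "\<lambda>t. spin_exp x u (r / R * t) ** p"
    show "?q 0 = p" by (simp add: spin_exp_0)
    show "?q t \<in> Spin \<gamma>" for t by (intro Spin_mult spin_exp_Spin o p)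
    show "(?q has_vector_derivative ?Q0) (at 0)"
      by (rule has_vector_derivative_eq_rhs,
          rule has_vector_derivative_mm[OF spin_exp_chain has_vector_derivative_const])
        (simp add: matrix_eq Xr mv_simps gamma_simps)
  qed
  \<comment> \<open>The remaining scalar \<open>c\<close> is detected by the derivative of the
    determinant in the direction \<open>c p\<close>, whereas that derivative vanishes on velocities
    of curves in the spin group.\<close>
  moreover have "d' (mat c ** p) = of_nat CARD('w) * c * det p"
  proof -
    have "((\<lambda>t. p + t *\<^sub>R (mat c ** p)) has_vector_derivative mat c ** p) (at 0)"
      by (auto intro!: derivative_eq_intros)
    then have "((\<lambda>t. det (p + t *\<^sub>R (mat c ** p))) has_vector_derivative d' (mat c ** p)) (at 0)"
      by (intro curve) auto
    moreover have "p + t *\<^sub>R (mat c ** p) = mat (1 + of_real t * c) ** p" for t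
      by (simp add: matrix_eq mv_simps scaleR_conv_smult vec.scale_left_distrib)
    ultimately have "((\<lambda>t. (1 + of_real t * c) ^ CARD('w) * det p) has_vector_derivative d' (mat c ** p)) (at (0::real))"
      by (simp add: det_mul det_mat)
    moreover have "((\<lambda>t. (1 + of_real t * c) ^ CARD('w) * det p) has_vector_derivative
       of_nat CARD('w) * c * det p) (at (0::real))"
      by (rule has_vector_derivative_real_field[THEN has_vector_derivative_eq_rhs],
          auto intro!: derivative_eq_intros)
    ultimately show ?thesis using vector_derivative_unique_at by blast
  qed
  ultimately have "of_nat CARD('w) * c * det p = 0"
    using linear_add[OF lin] Qc by (metis add.left_neutral)
  moreover have "det p \<noteq> 0" using det_Spin[OF p] by auto
  ultimately have "c = 0" by simp
  then have "mat c ** p = 0" by (simp add: matrix_eq mv_simps)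
  with Qc have "Q = ?Q0" by simp
  with Q show ?thesis by simp
qed

text \<open>All horizontal curves have the same velocity, and the derivative of a smooth section
  along a curve depends on the velocity only; so any of them, here the rotation along a great
  circle, computes \<open>spin_cov\<close>.\<close>

lemma spin_cov_eqI:
  assumes p: "p \<in> Spin \<gamma>" and e: "norm e = 1" and R: "R \<noteq> 0"
    and x: "x = spin_rot \<gamma> p e" and o: "orthonormal2 x u"
    and smooth: "smooth_on (Spin \<gamma>) \<psi>"
  shows "((\<lambda>t. \<psi> (spin_exp x u (r / R * t) ** p)) has_vector_derivative
           spin_cov \<gamma> e R \<psi> p (r *\<^sub>R u)) (at 0)"
proof -
  let ?X = "r *\<^sub>R u" and ?q = "\<lambda>t. spin_exp x u (r / R * t) ** p"
  obtain D where D: "\<And>q v. q 0 = p \<Longrightarrow> (\<forall>t. q t \<in> Spin \<gamma>) \<Longrightarrow> (q has_vector_derivative v) (at 0) \<Longrightarrow>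
       ((\<lambda>t. \<psi> (q t)) has_vector_derivative D v) (at (0::real))"
    using smooth_on_imp_curve_derivative[OF smooth p] by metis
  have X: "?X \<bullet> x = 0" using o by (simp add: orthonormal2_def inner_commute)
  define w where "w = D ((1 / (2 * R)) *\<^sub>R (\<gamma> x ** \<gamma> ?X ** p))"
  have w: "((\<lambda>t. \<psi> (q t)) has_vector_derivative w) (at 0)" if "horizontal_curve \<gamma> e R p ?X q" for q
    unfolding w_def
    by (rule D) (use that horizontal_curve_velocity[OF p e R x X that] in \<open>auto simp: horizontal_curve_def\<close>)
  have q: "horizontal_curve \<gamma> e R p ?X ?q" by (rule horizontal_curve_spin_exp[OF p e R x o])
  have "spin_cov \<gamma> e R \<psi> p ?X = w"
    unfolding spin_cov_def
    by (rule the_equality) (use w q vector_derivative_unique_at in blast)+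
  with w[OF q] show ?thesis by simp
qed

text \<open>\<open>p\<inverse> \<eta>\<close> is a constant ambient spinor seen in the spin frame
  \<open>p\<close>. The factor \<open>A\<close> will be \<open>mat 1\<close> or
  \<open>\<gamma> e\<close>: both commute with the stabilizer of \<open>e\<close>, which
  equivariance requires.\<close>

definition const_spinor :: "complex^'w^'w \<Rightarrow> complex^'w \<Rightarrow> complex^'w^'w \<Rightarrow> complex^'w" where
  "const_spinor A \<eta> p = (if p \<in> Spin \<gamma> then A *v (matrix_inv p *v \<eta>) else 0)"

lemma smooth_const_spinor: "smooth_on (Spin \<gamma>) (const_spinor A \<eta>)"
proof -
  have "smooth_on (Spin \<gamma>) (\<lambda>p. A *v (matrix_inv p *v \<eta>))"
    by (rule smooth_on_compose_linear[OF matrix_vector_mul_bounded_linear smooth_on_matrix_inv[OF det_Spin]])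
  then show ?thesis
    by (rule smooth_on_cong[rotated]) (simp add: const_spinor_def)
qed

lemma spin_cov_const_spinor:
  assumes p: "p \<in> Spin \<gamma>" and e: "norm e = 1" and R: "R \<noteq> 0"
    and x: "x = spin_rot \<gamma> p e" and X: "X \<bullet> x = 0"
  shows "spin_cov \<gamma> e R (const_spinor A \<eta>) p X =
           (- 1 / (2 * R)) *\<^sub>R (A *v (matrix_inv p *v (\<gamma> x *v (\<gamma> X *v \<eta>))))"
proof -
  have nx: "norm x = 1" using norm_spin_rot[OF p] e by (simp add: x)
  obtain r u where Xr: "X = r *\<^sub>R u" and o: "orthonormal2 x u"
    using tangent_decomposition[OF nx X] by blast
  let ?q = "\<lambda>t. spin_exp x u (r / R * t) ** p"
  have inv: "matrix_inv (?q t) *v \<eta> = matrix_inv p *v (spin_exp x u (- (r / R) * t) *v \<eta>)" for t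
  proof -
    have "?q t *v (matrix_inv p *v (spin_exp x u (- (r / R) * t) *v \<eta>)) = \<eta>"
      by (simp add: mm_mv Spin_inv_mv[OF p]) (simp add: spin_exp_add[OF o] spin_exp_0 flip: mm_mv)
    then show ?thesis
      using Spin_inv_mv(2)[of "?q t"] Spin_mult[OF spin_exp_Spin[OF o] p] by metis
  qed
  have "((\<lambda>t. A *v (matrix_inv p *v (spin_exp x u (- (r / R) * t) *v \<eta>))) has_vector_derivative
      (- 1 / (2 * R)) *\<^sub>R (A *v (matrix_inv p *v (\<gamma> x *v (\<gamma> X *v \<eta>))))) (at 0)"
    by (intro bounded_linear.has_vector_derivative[OF matrix_vector_mul_bounded_linear]
        has_vector_derivative_eq_rhs[OF bounded_linear.has_vector_derivative[OF matrix_vector_mul_bounded_linear,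
          OF bounded_linear.has_vector_derivative[OF matrix_vector_mul_bounded_linear,
          OF has_vector_derivative_mv[OF spin_exp_chain has_vector_derivative_const]]]])
      (simp add: Xr mv_simps gamma_simps)
  moreover have "const_spinor A \<eta> (?q t) = A *v (matrix_inv p *v (spin_exp x u (- (r / R) * t) *v \<eta>))" for t
    using Spin_mult[OF spin_exp_Spin[OF o] p] by (simp only: const_spinor_def if_True inv)
  ultimately have "((\<lambda>t. const_spinor A \<eta> (?q t)) has_vector_derivative
      (- 1 / (2 * R)) *\<^sub>R (A *v (matrix_inv p *v (\<gamma> x *v (\<gamma> X *v \<eta>))))) (at 0)"
    by simp
  moreover note spin_cov_eqI[OF p e R x o smooth_const_spinor, where r = r]
  ultimately show ?thesis unfolding Xr by (rule vector_derivative_unique_at[rotated])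
qed

lemma mv_cmult:
  "p \<in> Spin \<gamma> \<Longrightarrow> p *v cmult \<gamma> e p X w = \<gamma> (spin_rot \<gamma> p e) *v (\<gamma> X *v (p *v w))"
  by (simp add: cmult_def mm_mv spin_rot spin_rot_inv_right)

lemma gamma_xXx:
  assumes "norm x = 1" "X \<bullet> x = 0"
  shows "\<gamma> x *v (\<gamma> X *v (\<gamma> x *v w)) = \<gamma> X *v w"
  using assms by (simp add: gamma_anti0[of X x] gamma_sq1 mv_minus)

lemma spinor_field_const_spinor:
  assumes "\<And>p. p \<in> Spin \<gamma> \<Longrightarrow> A *v (matrix_inv p *v \<eta>) \<in> \<Sigma>'"
    and A: "A = mat 1 \<or> A = \<gamma> e"
  shows "spinor_field \<gamma> e \<Sigma>' (const_spinor A \<eta>)"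
  unfolding spinor_field_def
proof (intro conjI ballI allI impI smooth_const_spinor)
  fix p s assume p: "p \<in> Spin \<gamma>" and s: "s \<in> Spin \<gamma>" and se: "spin_rot \<gamma> s e = e"
  have comm: "s *v (A *v w) = A *v (s *v w)" for w
    using A spin_rot[OF s, of e] se by auto
  have "s *v (matrix_inv (p ** s) *v \<eta>) = matrix_inv p *v \<eta>"
  proof -
    have "(p ** s) *v (matrix_inv (p ** s) *v \<eta>) = \<eta>"
      by (rule Spin_inv_mv[OF Spin_mult[OF p s]])
    then show ?thesis by (metis mm_mv Spin_inv_mv(2)[OF p])
  qed
  then show "s *v const_spinor A \<eta> (p ** s) = const_spinor A \<eta> p"
    using p Spin_mult[OF p s] by (simp add: const_spinor_def comm)
qed (use assms in \<open>auto simp: const_spinor_def\<close>)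

text \<open>The parallel spinors \<open>p \<mapsto> p\<^sup>-\<^sup>1 \<eta>\<close> of the flat ambient space restrict to Killing spinors of both
  signs, depending on the half-spinor space containing \<open>\<eta>\<close>; the factor \<open>\<gamma> e\<close> exchanges these spaces.\<close>

lemma killing_spinor_const_spinor:
  assumes e: "norm e = 1" and R: "R \<noteq> 0"
    and A: "A = mat 1 \<and> \<beta> = - (1 / (2 * R)) \<or> A = \<gamma> e \<and> \<beta> = 1 / (2 * R)"
  shows "killing_spinor \<gamma> e R UNIV (of_real \<beta>) (const_spinor A \<eta>)"
  unfolding killing_spinor_def
proof (intro conjI ballI allI impI)
  show "spinor_field \<gamma> e UNIV (const_spinor A \<eta>)"
    by (rule spinor_field_const_spinor) (use A in auto)
  fix p X assume p: "p \<in> Spin \<gamma>" and X: "X \<bullet> spin_rot \<gamma> p e = 0"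
  let ?x = "spin_rot \<gamma> p e"
  have nx: "norm ?x = 1" using norm_spin_rot[OF p] e by simp
  have "p *v spin_cov \<gamma> e R (const_spinor A \<eta>) p X =
      (- 1 / (2 * R)) *\<^sub>R (p *v (A *v (matrix_inv p *v (\<gamma> ?x *v (\<gamma> X *v \<eta>)))))"
    by (simp add: spin_cov_const_spinor[OF p e R refl X] mv_simps)
  also have "\<dots> = \<beta> *\<^sub>R (\<gamma> ?x *v (\<gamma> X *v (p *v (A *v (matrix_inv p *v \<eta>)))))"
    using A
  proof (elim disjE conjE)
    assume "A = \<gamma> e" "\<beta> = 1 / (2 * R)"
    then show ?thesis
      by (simp add: spin_rot[OF p] Spin_inv_mv[OF p] gamma_xXx[OF nx X] gamma_sq1 nx)
  qed (simp add: Spin_inv_mv[OF p])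
  also have "\<dots> = p *v (of_real \<beta> *s cmult \<gamma> e p X (const_spinor A \<eta> p))"
    using p by (simp add: const_spinor_def mv_cmult mv_simps scaleR_conv_smult)
  finally show "spin_cov \<gamma> e R (const_spinor A \<eta>) p X = of_real \<beta> *s cmult \<gamma> e p X (const_spinor A \<eta> p)"
    by (metis Spin_inv_mv(2)[OF p])
qed

end

section \<open>Clifford modules of complex Euclidean spaces\<close>

lemma xi_simps:
  "xi (u + v) = xi u + xi v" "xi (u - v) = xi u - xi v" "xi (r *\<^sub>R u) = r *\<^sub>R xi u"
  "xi (- u) = - xi u" "xi (xi u) = - u" "xi 0 = 0"
  by (simp_all add: xi_def vec_eq_iff algebra_simps flip: mult.assoc)

lemma linear_xi: "linear xi"
  by (auto simp: linear_iff xi_simps)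

lemma inner_xi_xi: "xi u \<bullet> xi v = u \<bullet> v"
  by (simp add: xi_def inner_vec_def inner_complex_def add.commute)

lemma inner_xi_left: "xi u \<bullet> v = - (u \<bullet> xi v)"
  using inner_xi_xi[of u "xi v"] by (simp add: xi_simps)

lemma inner_xi_self: "u \<bullet> xi u = 0" "xi u \<bullet> u = 0"
  using inner_xi_left[of u u] by (simp_all add: inner_commute)

lemma norm_xi: "norm (xi u) = norm u"
  by (simp add: norm_eq_sqrt_inner inner_xi_xi)

lemma smult_scaleR: "c *s (r *\<^sub>R w) = r *\<^sub>R (c *s (w :: complex^'n))"
  by (simp add: vec_eq_iff)

text \<open>\<open>A\<close> is invertible and anticommutes with \<open>J\<close>, so it exchanges
  the two eigenspaces of \<open>J\<close>, and \<open>U\<close> is their direct sum.\<close>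

lemma dim_eigenspace_half:
  fixes A J :: "complex^'w^'w"
  assumes U: "vec.subspace U"
    and A: "\<And>w. w \<in> U \<Longrightarrow> A *v w \<in> U" and J: "\<And>w. w \<in> U \<Longrightarrow> J *v w \<in> U"
    and AA: "\<And>w. A *v (A *v w) = - w" and JJ: "\<And>w. J *v (J *v w) = - w"
    and AJ: "\<And>w. A *v (J *v w) = - (J *v (A *v w))"
    and s: "s * s = 1"
  shows "vec.dim U = 2 * vec.dim {w \<in> U. J *v w = (s * \<i>) *s w}"
proof -
  define E where "E s = {w \<in> U. J *v w = (s * \<i>) *s w}" for s
  have sub: "vec.subspace (E s)" for s
    using U unfolding E_def vec.subspace_def
    by (auto simp: mv_simps vec.scale_right_distrib mult_ac)
  have inj: "inj_on ((*v) A) T" for T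
    by (rule inj_onI) (metis AA minus_minus)
  have AE: "A *v w \<in> E (- s)" if "w \<in> E s" for w s
    using that AJ[of w] A by (auto simp: E_def mv_simps)
  have img: "E (- s) = (*v) A ` E s"
  proof (intro equalityI subsetI)
    fix w assume w: "w \<in> E (- s)"
    have "w = A *v (- (A *v w))" by (simp add: mv_minus AA)
    moreover have "- (A *v w) \<in> E s" using AE[OF w] vec.subspace_neg[OF sub] by simp
    ultimately show "w \<in> (*v) A ` E s" by blast
  qed (use AE in auto)
  have dim: "vec.dim (E (- s)) = vec.dim (E s)"
    unfolding img by (rule vec.dim_image_eq) (auto intro: inj)
  have "U = {x + y |x y. x \<in> E s \<and> y \<in> E (- s)}"
  proof (intro equalityI subsetI)
    fix w assume w: "w \<in> U"
    define x where "x = (1/2) *s (w - (s * \<i>) *s (J *v w))"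
    define y where "y = (1/2) *s (w + (s * \<i>) *s (J *v w))"
    have "x \<in> U" "y \<in> U"
      unfolding x_def y_def using w J U
      by (auto intro!: vec.subspace_scale vec.subspace_add vec.subspace_diff)
    moreover have "s * (s * a) = a" for a using s by (simp flip: mult.assoc)
    ultimately have "x \<in> E s" "y \<in> E (- s)"
      by (auto simp: E_def x_def y_def mv_simps JJ vec_eq_iff algebra_simps)
    moreover have "w = x + y" by (simp add: x_def y_def vec_eq_iff field_simps)
    ultimately show "w \<in> {x + y |x y. x \<in> E s \<and> y \<in> E (- s)}" by blast
  next
    fix w assume "w \<in> {x + y |x y. x \<in> E s \<and> y \<in> E (- s)}"
    then show "w \<in> U" using U by (auto simp: E_def intro: vec.subspace_add)
  qed
  moreover have "E s \<inter> E (- s) = {0}"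
  proof -
    have "w = 0" if "w \<in> E s" "w \<in> E (- s)" for w
    proof -
      have "(s * \<i>) *s w = - ((s * \<i>) *s w)" using that by (simp add: E_def)
      then have "s * \<i> * (w $ k) = 0" for k
        by (simp add: vec_eq_iff) (metis mult.commute mult_minus_left neg_equal_zero)
      moreover have "s \<noteq> 0" using s by auto
      ultimately show ?thesis by (simp add: vec_eq_iff)
    qed
    then show ?thesis using sub by (auto simp: vec.subspace_0)
  qed
  ultimately show ?thesis
    using vec.dim_sums_Int[OF sub[of s] sub[of "- s"]] dim by (simp add: E_def)
qed

lemma subspace_dim_1:
  assumes "vec.subspace S" "vec.dim S = 1"
  obtains w0 where "w0 \<noteq> 0" "S = range (\<lambda>a. a *s w0)"
proof -
  obtain B where B: "B \<subseteq> S" "vec.independent B" "S \<subseteq> vec.span B" "card B = vec.dim S"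
    using vec.basis_exists by blast
  then obtain w0 where w0: "B = {w0}" using assms(2) by (auto simp: card_1_singleton_iff)
  have "w0 \<noteq> 0" using B(2) w0 vec.dependent_zero by blast
  moreover have "S = vec.span B" using B assms(1) by (metis vec.span_minimal equalityI)
  ultimately show thesis by (intro that) (auto simp: w0 vec.span_singleton)
qed

locale complex_clifford = clifford \<gamma>
  for \<gamma> :: "complex^'n \<Rightarrow> complex^'w^'w" +
  assumes card_w: "CARD('w) = 2 ^ CARD('n)"
begin

text \<open>The bivector of the \<open>k\<close>-th complex coordinate line. These operators
  commute, and their sum is the Clifford action of the Kaehler form.\<close>

definition Jk :: "'n \<Rightarrow> complex^'w^'w" where
  "Jk k = \<gamma> (axis k 1) ** \<gamma> (axis k \<i>)"

lemma axis_orthonormal: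
  "norm (axis k 1 :: complex^'n) = 1" "norm (axis k \<i> :: complex^'n) = 1"
  "axis k 1 \<bullet> (axis k \<i> :: complex^'n) = 0" "axis k \<i> \<bullet> (axis k 1 :: complex^'n) = 0"
  "k \<noteq> l \<Longrightarrow> axis k a \<bullet> (axis l b :: complex^'n) = 0"
  by (simp_all add: norm_axis_1 inner_axis_axis)

lemma Jk_sq: "Jk k *v (Jk k *v w) = - w"
  by (simp add: Jk_def mm_mv gamma_sq1 gamma_anti0[of "axis k \<i>" "axis k 1"] axis_orthonormal mv_simps)

lemma Jk_anti: "\<gamma> (axis k 1) *v (Jk k *v w) = - (Jk k *v (\<gamma> (axis k 1) *v w))"
  by (simp add: Jk_def mm_mv gamma_sq1 gamma_anti0[of "axis k \<i>" "axis k 1"] axis_orthonormal mv_simps)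

lemma Jk_comm: "k \<noteq> l \<Longrightarrow> \<gamma> (axis k a) *v (Jk l *v w) = Jk l *v (\<gamma> (axis k a) *v w)"
  by (simp add: Jk_def mm_mv gamma_anti0[of "axis k a" "axis l _"] axis_orthonormal mv_simps)

lemma Jk_Jk_comm: "Jk k *v (Jk l *v w) = Jk l *v (Jk k *v w)"
proof (cases "k = l")
  case False
  then show ?thesis by (subst (1 2) Jk_def) (simp add: mm_mv Jk_comm)
qed simp

text \<open>\<open>A k\<close> flips the sign of \<open>Jk k\<close> and no other, so each condition
  halves the dimension. The operators \<open>A k\<close> are a parameter because on a half-spinor
  space they must be even, where a single vector cannot be used.\<close>

lemma dim_joint_eigenspace:
  fixes A :: "'n \<Rightarrow> complex^'w^'w"
  assumes U: "vec.subspace U"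
    and A: "\<And>k w. k \<in> K \<Longrightarrow> w \<in> U \<Longrightarrow> A k *v w \<in> U"
    and J: "\<And>k w. w \<in> U \<Longrightarrow> Jk k *v w \<in> U"
    and AA: "\<And>k w. k \<in> K \<Longrightarrow> A k *v (A k *v w) = - w"
    and AJ: "\<And>k w. k \<in> K \<Longrightarrow> A k *v (Jk k *v w) = - (Jk k *v (A k *v w))"
    and comm: "\<And>k l w. k \<in> K \<Longrightarrow> l \<in> K \<Longrightarrow> k \<noteq> l \<Longrightarrow> A k *v (Jk l *v w) = Jk l *v (A k *v w)"
    and s: "s * s = 1"
  shows "vec.dim U = 2 ^ card K * vec.dim {w \<in> U. \<forall>k\<in>K. Jk k *v w = (s * \<i>) *s w}"
proof -
  have "finite K" by simp
  then show ?thesis using A AA AJ comm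
  proof (induction K rule: finite_induct)
    case (insert l K)
    define E where "E = {w \<in> U. \<forall>k\<in>K. Jk k *v w = (s * \<i>) *s w}"
    have sub: "vec.subspace E"
      using U unfolding E_def vec.subspace_def
      by (auto simp: mv_simps vec.scale_right_distrib mult_ac)
    have "vec.dim U = 2 ^ card K * vec.dim E"
      unfolding E_def using insert.prems by (intro insert.IH) auto
    also have "vec.dim E = 2 * vec.dim {w \<in> E. Jk l *v w = (s * \<i>) *s w}"
    proof (rule dim_eigenspace_half[where A = "A l"])
      show "vec.subspace E" by (rule sub)
      have "Jk k *v (A l *v w) = A l *v (Jk k *v w)" if "k \<in> K" for k w
        using insert.prems(4)[of l k w] insert.hyps(2) that by (metis insertCI)
      then show "A l *v w \<in> E" if "w \<in> E" for w
        using that insert.prems(1)[of l w] by (auto simp: E_def mv_simps)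
      show "Jk l *v w \<in> E" if "w \<in> E" for w
        using that J by (auto simp: E_def mv_simps Jk_Jk_comm[of _ l])
    qed (use insert.prems Jk_sq s in auto)
    also have "{w \<in> E. Jk l *v w = (s * \<i>) *s w} =
        {w \<in> U. \<forall>k\<in>insert l K. Jk k *v w = (s * \<i>) *s w}" by (auto simp: E_def)
    finally show ?case using insert.hyps by simp
  qed simp
qed

text \<open>\<open>vacua (-1)\<close> and \<open>vacua 1\<close> are the lowest and the highest eigenspace of the Kaehler form
  of the complex Euclidean space: \<open>\<Lambda>\<^sup>0\<close> and the top exterior power in the model of
  spinors as exterior forms.\<close>

definition vacua :: "complex \<Rightarrow> (complex^'w) set" where
  "vacua s = {w. \<forall>v. \<gamma> (xi v) *v w = (- s * \<i>) *s (\<gamma> v *v w)}"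

lemma vacuaD: "w \<in> vacua s \<Longrightarrow> \<gamma> (xi v) *v w = (- s * \<i>) *s (\<gamma> v *v w)"
  by (simp add: vacua_def)

lemma xi_axis: "xi (axis k a) = axis k (\<i> * a)"
  by (simp add: xi_def vec_eq_iff axis_def)

lemma subspace_vacua: "vec.subspace (vacua s)"
  unfolding vec.subspace_def vacua_def by (auto simp: mv_simps vec.scale_right_distrib mult_ac)

text \<open>Multiplying the eigenvalue equation of \<open>Jk k\<close> by the first vector of the
  bivector gives the claim on a real basis. With all of \<open>UNIV\<close> for \<open>K\<close> it
  characterizes vacua; omitting one coordinate it yields pure spinors in the point
  \<open>e\<close>.\<close>

lemma gamma_xi_of_Jk:
  assumes s: "s * s = 1" and J: "\<And>k. k \<in> K \<Longrightarrow> Jk k *v w = (s * \<i>) *s w"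
    and Z: "\<And>k. k \<notin> K \<Longrightarrow> Z $ k = 0"
  shows "\<gamma> (xi Z) *v w = (- s * \<i>) *s (\<gamma> Z *v w)"
proof -
  have i: "\<gamma> (axis k \<i>) *v w = (- s * \<i>) *s (\<gamma> (axis k 1) *v w)" if "k \<in> K" for k
  proof -
    have "\<gamma> (axis k 1) *v (Jk k *v w) = (s * \<i>) *s (\<gamma> (axis k 1) *v w)"
      by (simp add: J that mv_simps)
    then have "- (\<gamma> (axis k \<i>) *v w) = (s * \<i>) *s (\<gamma> (axis k 1) *v w)"
      by (simp add: Jk_def mm_mv gamma_sq1 axis_orthonormal)
    then have "- (- (\<gamma> (axis k \<i>) *v w)) = - ((s * \<i>) *s (\<gamma> (axis k 1) *v w))" by (rule arg_cong)
    then show ?thesis by simp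
  qed
  define f where "f v = \<gamma> (xi v) *v w - (- s * \<i>) *s (\<gamma> v *v w)" for v
  have f: "linear f"
    by (auto simp: f_def linear_iff gamma_simps xi_simps vec.scale_right_distrib smult_scaleR
        scaleR_diff_right scaleR_add_right)
  have "f b = 0 \<or> Z \<bullet> b = 0" if b: "b \<in> Basis" for b
  proof -
    obtain k where k: "b = axis k 1 \<or> b = axis k \<i>"
      using b by (auto simp: Basis_vec_def Basis_complex_def)
    have "axis k (- 1) = - (axis k 1 :: complex^'n)" by (simp add: vec_eq_iff axis_def)
    then have "\<gamma> (axis k (- 1)) *v w = - (\<gamma> (axis k 1) *v w)" by (simp add: gamma_minus)
    then have "f b = 0" if "k \<in> K"
      using k i[OF that] s by (auto simp: f_def xi_axis mult_ac)
    moreover have "Z \<bullet> b = 0" if "k \<notin> K"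
      using k Z[OF that] by (auto simp: inner_axis)
    ultimately show ?thesis by blast
  qed
  then have "(\<Sum>b\<in>Basis. (Z \<bullet> b) *\<^sub>R f b) = 0"
    by (intro sum.neutral) auto
  then have "f (\<Sum>b\<in>Basis. (Z \<bullet> b) *\<^sub>R b) = 0"
    by (simp add: linear_sum[OF f] linear_cmul[OF f])
  then have "f Z = 0" by (simp add: euclidean_representation)
  then show ?thesis unfolding f_def by (rule eq_iff_diff_eq_0[THEN iffD2])
qed

lemma vacua_conv_Jk:
  assumes s: "s * s = 1"
  shows "w \<in> vacua s \<longleftrightarrow> (\<forall>k. Jk k *v w = (s * \<i>) *s w)"
proof
  assume "w \<in> vacua s"
  then show "\<forall>k. Jk k *v w = (s * \<i>) *s w"
    using vacuaD[of w s "axis _ 1"]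
    by (simp add: xi_axis Jk_def mm_mv mv_simps gamma_sq1 axis_orthonormal)
qed (auto simp: vacua_def intro: gamma_xi_of_Jk[OF s, of UNIV, simplified])

text \<open>Vectors flip every sign independently, so all joint eigenspaces of the \<open>Jk\<close>
  in \<open>U\<close> have the same dimension. Both the one-dimensionality of the vacua and
  irreducibility follow.\<close>

lemma dim_invariant:
  assumes U: "vec.subspace U" and inv: "\<And>v w. w \<in> U \<Longrightarrow> \<gamma> v *v w \<in> U" and s: "s * s = 1"
  shows "vec.dim U = 2 ^ CARD('n) * vec.dim (U \<inter> vacua s)"
proof -
  have "vec.dim U = 2 ^ CARD('n) * vec.dim {w \<in> U. \<forall>k\<in>UNIV. Jk k *v w = (s * \<i>) *s w}"
    by (rule dim_joint_eigenspace[where A = "\<lambda>k. \<gamma> (axis k 1)"])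
      (auto simp: U inv Jk_def mm_mv s gamma_sq1 axis_orthonormal Jk_comm[unfolded Jk_def mm_mv]
        Jk_anti[unfolded Jk_def mm_mv])
  also have "{w \<in> U. \<forall>k\<in>UNIV. Jk k *v w = (s * \<i>) *s w} = U \<inter> vacua s"
    by (auto simp: vacua_conv_Jk[OF s])
  finally show ?thesis .
qed

lemma dim_vacua: "s * s = 1 \<Longrightarrow> vec.dim (vacua s) = 1"
  using dim_invariant[of UNIV s] by (simp add: vec.dim_UNIV card_cart_basis card_w)

lemma vacua_line:
  assumes "s * s = 1"
  obtains w0 where "w0 \<noteq> 0" "vacua s = range (\<lambda>a. a *s w0)"
  using subspace_dim_1[OF subspace_vacua dim_vacua[OF assms]] .

text \<open>The dimension of \<open>U\<close> is a non-zero multiple of \<open>2 ^ CARD('n)\<close>,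
  which is the dimension of the whole module.\<close>

lemma invariant_UNIV:
  assumes U: "vec.subspace U" and inv: "\<And>v w. w \<in> U \<Longrightarrow> \<gamma> v *v w \<in> U" and "w \<in> U" "w \<noteq> 0"
  shows "U = UNIV"
proof -
  have "vec.dim U \<noteq> 0"
    using assms(3,4) by (auto simp: vec.dim_eq_0)
  with dim_invariant[OF U inv, of 1] have "vec.dim U \<ge> 2 ^ CARD('n)"
    by (metis dvd_imp_le dvd_triv_left mult_1 neq0_conv)
  then have "vec.dim U = vec.dim (UNIV :: (complex^'w) set)"
    using vec.dim_subset_UNIV[of U] by (simp add: vec.dim_UNIV card_cart_basis card_w vec.dimension_def)
  then show ?thesis
    using vec.subspace_dim_equal[OF U vec.subspace_UNIV subset_UNIV] by simp
qed

text \<open>Schur's lemma: \<open>A\<close> preserves the line \<open>vacua 1\<close>, hence has an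
  eigenvector there, and the eigenspace is invariant under Clifford multiplication.\<close>

lemma commutant_scalar:
  assumes "\<And>v. A ** \<gamma> v = \<gamma> v ** A"
  shows "\<exists>c. A = mat c"
proof -
  have A: "A *v (\<gamma> v *v w) = \<gamma> v *v (A *v w)" for v w
    using assms[of v] by (metis mm_mv)
  obtain w0 where w0: "w0 \<noteq> 0" "vacua 1 = range (\<lambda>a. a *s w0)"
    by (rule vacua_line[of 1]) auto
  then have w0v: "w0 \<in> vacua 1" by (metis rangeI vec.scale_one)
  have "A *v w0 \<in> vacua 1"
    using vacuaD[OF w0v] by (simp add: vacua_def mv_simps flip: A)
  then obtain c where c: "A *v w0 = c *s w0" using w0(2) by auto
  have "{w. A *v w = c *s w} = UNIV"
    by (rule invariant_UNIV[where w = w0])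
      (auto simp: vec.subspace_def mv_simps vec.scale_right_distrib mult_ac c w0 A)
  then have "A = mat c" by (auto simp: matrix_eq mat_mv)
  then show ?thesis ..
qed

sublocale irreducible_clifford \<gamma>
proof unfold_locales
  show "2 \<le> DIM(complex^'n)"
    using zero_less_card_finite[where 'a = 'n] by simp
  show "even CARD('w)" by (simp add: card_w)
qed (rule commutant_scalar)

end

section \<open>Spinors on the Sasakian sphere\<close>

lemma h_op_horQ:
  fixes x :: "complex^'n"
  assumes "Z \<in> horQ x" shows "h_op x Z = xi Z"
proof -
  from assms have "xi Z \<bullet> x = 0" by (simp add: horQ_def inner_xi_left)
  moreover have "frechet_derivative xi (at x) = (xi :: complex^'n \<Rightarrow> _)"
    using linear_xi by (intro frechet_derivative_at[symmetric] linear_imp_has_derivative)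
  ultimately show ?thesis by (simp add: h_op_def levi_civita_def)
qed

lemma horQ_xi: "Z \<in> horQ x \<Longrightarrow> xi Z \<in> horQ x"
  by (simp add: horQ_def inner_xi_left xi_simps)

lemma projQ_horQ: "norm x = 1 \<Longrightarrow> projQ x X \<in> horQ x"
  by (simp add: projQ_def horQ_def inner_simps inner_xi_self norm_eq_1 inner_xi_xi)

lemma inner_projQ: "Z \<in> horQ x \<Longrightarrow> Z \<bullet> projQ x Y = Z \<bullet> Y"
  by (simp add: projQ_def horQ_def inner_simps inner_commute)

locale sasaki =
  fixes \<gamma> :: "complex^'n \<Rightarrow> complex^'w^'w"
    and e :: "complex^'n" and m :: nat and \<Sigma> :: "(complex^'w) set"
  assumes m1: "m \<ge> 1" and card_n: "CARD('n) = m + 1" and e: "e \<in> Basis"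
    and mod: "sasaki_spinor_module \<gamma> e m \<Sigma>"

sublocale sasaki \<subseteq> complex_clifford \<gamma>
  using mod card_n by unfold_locales (auto simp: sasaki_spinor_module_def)

context sasaki
begin

lemma norm_e: "norm e = 1"
  using e by simp

lemma subspace_Sigma: "vec.subspace \<Sigma>" and dim_Sigma: "vec.dim \<Sigma> = 2 ^ m"
  and Sigma_even: "w \<in> \<Sigma> \<Longrightarrow> \<gamma> u *v (\<gamma> v *v w) \<in> \<Sigma>"
  using mod by (auto simp: sasaki_spinor_module_def mm_mv)

lemmas Sigma_closed = vec.subspace_add[OF subspace_Sigma] vec.subspace_diff[OF subspace_Sigma]
  vec.subspace_scale[OF subspace_Sigma] vec.subspace_neg[OF subspace_Sigma] vec.subspace_0[OF subspace_Sigma]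

lemma Sigma_scaleR: "w \<in> \<Sigma> \<Longrightarrow> r *\<^sub>R w \<in> \<Sigma>"
  by (simp add: scaleR_conv_smult Sigma_closed)

lemma Spin_Sigma: "p \<in> Spin \<gamma> \<Longrightarrow> w \<in> \<Sigma> \<Longrightarrow> p *v w \<in> \<Sigma>"
  by (induction arbitrary: w rule: Spin.induct) (auto simp: mm_mv Sigma_even)

lemma norm_point: "p \<in> Spin \<gamma> \<Longrightarrow> norm (spin_rot \<gamma> p e) = 1"
  by (simp add: norm_spin_rot norm_e)

lemma Spin_transitive:
  assumes "norm x = 1" obtains p where "p \<in> Spin \<gamma>" "spin_rot \<gamma> p e = x"
proof -
  define X where "X = x - (x \<bullet> e) *\<^sub>R e"
  have "X \<bullet> e = 0" using norm_e by (simp add: X_def inner_simps norm_eq_1)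
  then obtain r u where r: "X = r *\<^sub>R u" and o: "orthonormal2 e u"
    using tangent_decomposition[OF norm_e] by blast
  then have x: "x = (x \<bullet> e) *\<^sub>R e + r *\<^sub>R u" by (simp add: X_def algebra_simps)
  have "x \<bullet> x = (x \<bullet> e)\<^sup>2 + r\<^sup>2"
    by (subst (1 2) x) (use o in \<open>simp add: inner_simps orthonormal2_def norm_eq_1 inner_commute power2_eq_square\<close>)
  then have "(x \<bullet> e)\<^sup>2 + r\<^sup>2 = 1" using assms by (simp add: norm_eq_1)
  then obtain t where "x \<bullet> e = cos t" "r = sin t" using sincos_total_2pi by metis
  then have "spin_rot \<gamma> (spin_exp e u t) e = x"
    using x plane_rot_simps(1)[OF o] by (simp add: spin_rot_spin_exp[OF o])
  with spin_exp_Spin[OF o] that show thesis by blast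
qed

text \<open>Clifford multiplication on the sphere carries a factor \<open>x\<close> for each tangent
  vector; in a product of two these factors cancel.\<close>

lemma mv_cmult2:
  "p \<in> Spin \<gamma> \<Longrightarrow> X \<bullet> spin_rot \<gamma> p e = 0 \<Longrightarrow>
    p *v cmult \<gamma> e p X (cmult \<gamma> e p Y w) = \<gamma> X *v (\<gamma> Y *v (p *v w))"
  by (simp add: mv_cmult gamma_xXx norm_point)

lemma frame_expansion:
  assumes p: "p \<in> Spin \<gamma>" and Y: "Y \<bullet> spin_rot \<gamma> p e = 0"
  shows "(\<Sum>b\<in>Basis - {e}. (Y \<bullet> spin_rot \<gamma> p b) *\<^sub>R spin_rot \<gamma> p b) = Y"
proof -
  define y where "y = spin_rot \<gamma> (matrix_inv p) Y"
  have Yy: "Y = spin_rot \<gamma> p y" by (simp add: y_def spin_rot_matrix_inv p)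
  have "(\<Sum>b\<in>Basis. (Y \<bullet> spin_rot \<gamma> p b) *\<^sub>R spin_rot \<gamma> p b) =
      spin_rot \<gamma> p (\<Sum>b\<in>Basis. (y \<bullet> b) *\<^sub>R b)"
    by (simp add: Yy inner_spin_rot p linear_sum[OF linear_spin_rot] linear_cmul[OF linear_spin_rot])
  also have "\<dots> = Y" by (simp add: euclidean_representation Yy)
  finally show ?thesis using e Y by (simp add: sum_diff1)
qed

text \<open>\<open>pure s x w\<close>: in the point \<open>x\<close>, Clifford multiplication by \<open>Z\<close> with
  \<open>J Z = - s i Z\<close> annihilates \<open>w\<close>.\<close>

definition pure :: "complex \<Rightarrow> complex^'n \<Rightarrow> complex^'w \<Rightarrow> bool" where
  "pure s x w \<longleftrightarrow> (\<forall>Z\<in>horQ x. \<gamma> (xi Z) *v w = (- s * \<i>) *s (\<gamma> Z *v w))"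

lemma pureD: "pure s x w \<Longrightarrow> Z \<in> horQ x \<Longrightarrow> \<gamma> (xi Z) *v w = (- s * \<i>) *s (\<gamma> Z *v w)"
  by (simp add: pure_def)

lemma vacua_pure: "w \<in> vacua s \<Longrightarrow> pure s x w"
  by (simp add: pure_def vacua_def)

text \<open>On a pure spinor \<open>xi Z\<close> acts as \<open>- s i Z\<close>, which reduces the
  contraction of \<Omega> with the frame to a sum of squares. The frame has \<open>2 m + 1\<close>
  vectors; the \<xi>-components removed by \<open>projQ\<close> account for one square, and half of
  the remaining \<open>2 m\<close> is the factor \<open>m\<close>.\<close>

lemma Omega_cmult_pure:
  assumes p: "p \<in> Spin \<gamma>" and pure: "pure s (spin_rot \<gamma> p e) (p *v w)"
  shows "Omega_cmult \<gamma> e p w = (s * \<i> * of_nat m) *s w"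
proof -
  define x where "x = spin_rot \<gamma> p e"
  define r where "r = spin_rot \<gamma> p"
  define w' where "w' = p *v w"
  have nx: "norm x = 1" using norm_point[OF p] by (simp add: x_def)
  have rx: "r a \<bullet> x = 0" if "a \<in> Basis - {e}" for a
    using that e by (simp add: r_def x_def inner_spin_rot p inner_Basis)
  have Om: "Omega x (r a) (r b) = xi (projQ x (r a)) \<bullet> r b" for a b
    by (simp add: Omega_def h_op_horQ projQ_horQ nx inner_projQ horQ_xi)
  have "p *v (\<Sum>a\<in>Basis - {e}. \<Sum>b\<in>Basis - {e}. Omega x (r a) (r b) *\<^sub>R cmult \<gamma> e p (r a) (cmult \<gamma> e p (r b) w)) =
     (\<Sum>a\<in>Basis - {e}. \<Sum>b\<in>Basis - {e}. Omega x (r a) (r b) *\<^sub>R (\<gamma> (r a) *v (\<gamma> (r b) *v w')))"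
    using rx by (simp add: vec.sum mv_scaleR mv_cmult2[OF p] w'_def x_def)
  also have "\<dots> = (\<Sum>a\<in>Basis - {e}. \<gamma> (r a) *v (\<gamma> (xi (projQ x (r a))) *v w'))"
  proof (rule sum.cong[OF refl])
    fix a assume a: "a \<in> Basis - {e}"
    have "xi (projQ x (r a)) \<bullet> x = 0"
      using horQ_xi[OF projQ_horQ[OF nx]] by (simp add: horQ_def)
    then have "(\<Sum>b\<in>Basis - {e}. (xi (projQ x (r a)) \<bullet> r b) *\<^sub>R r b) = xi (projQ x (r a))"
      using frame_expansion[OF p] by (simp add: r_def x_def)
    moreover have "\<gamma> (\<Sum>b\<in>Basis - {e}. (xi (projQ x (r a)) \<bullet> r b) *\<^sub>R r b) =
        (\<Sum>b\<in>Basis - {e}. (xi (projQ x (r a)) \<bullet> r b) *\<^sub>R \<gamma> (r b))"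
      by (simp add: linear_sum[OF linear_gamma] linear_cmul[OF linear_gamma])
    ultimately have "\<gamma> (xi (projQ x (r a))) = (\<Sum>b\<in>Basis - {e}. (xi (projQ x (r a)) \<bullet> r b) *\<^sub>R \<gamma> (r b))"
      by simp
    then have "\<gamma> (xi (projQ x (r a))) *v w' = (\<Sum>b\<in>Basis - {e}. (xi (projQ x (r a)) \<bullet> r b) *\<^sub>R (\<gamma> (r b) *v w'))"
      by (simp add: linear_sum[of "\<lambda>A. A *v w'"] linear_iff mv_simps)
    then show "(\<Sum>b\<in>Basis - {e}. Omega x (r a) (r b) *\<^sub>R (\<gamma> (r a) *v (\<gamma> (r b) *v w'))) =
        \<gamma> (r a) *v (\<gamma> (xi (projQ x (r a))) *v w')"
      by (simp add: Om vec.sum mv_scaleR)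
  qed
  also have "\<dots> = (\<Sum>a\<in>Basis - {e}. (- s * \<i>) *s (- w' - (r a \<bullet> xi x) *\<^sub>R (\<gamma> (r a) *v (\<gamma> (xi x) *v w'))))"
  proof (rule sum.cong[OF refl])
    fix a assume a: "a \<in> Basis - {e}"
    have na: "norm (r a) = 1" using a by (simp add: r_def norm_spin_rot p)
    have "\<gamma> (r a) *v (\<gamma> (xi (projQ x (r a))) *v w') = (- s * \<i>) *s (\<gamma> (r a) *v (\<gamma> (projQ x (r a)) *v w'))"
      using pureD[OF pure projQ_horQ[of _ "r a"]] nx
      by (simp add: w'_def x_def[symmetric] mv_simps)
    also have "\<gamma> (r a) *v (\<gamma> (projQ x (r a)) *v w') = - w' - (r a \<bullet> xi x) *\<^sub>R (\<gamma> (r a) *v (\<gamma> (xi x) *v w'))"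
      by (simp add: projQ_def rx[OF a] gamma_simps mv_simps gamma_sq1 na)
    finally show "\<gamma> (r a) *v (\<gamma> (xi (projQ x (r a))) *v w') =
        (- s * \<i>) *s (- w' - (r a \<bullet> xi x) *\<^sub>R (\<gamma> (r a) *v (\<gamma> (xi x) *v w')))" .
  qed
  also have "\<dots> = (- s * \<i>) *s ((\<Sum>a\<in>Basis - {e}. - w') -
      (\<Sum>a\<in>Basis - {e}. (r a \<bullet> xi x) *\<^sub>R (\<gamma> (r a) *v (\<gamma> (xi x) *v w'))))"
    by (simp only: sum_subtractf flip: vec.scale_sum_right)
  also have "(\<Sum>a\<in>Basis - {e}. (r a \<bullet> xi x) *\<^sub>R (\<gamma> (r a) *v (\<gamma> (xi x) *v w'))) = - w'"
  proof -
    have "\<gamma> (\<Sum>a\<in>Basis - {e}. (r a \<bullet> xi x) *\<^sub>R r a) = (\<Sum>a\<in>Basis - {e}. (r a \<bullet> xi x) *\<^sub>R \<gamma> (r a))"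
      by (simp add: linear_sum[OF linear_gamma] linear_cmul[OF linear_gamma])
    moreover have "(\<Sum>a\<in>Basis - {e}. (r a \<bullet> xi x) *\<^sub>R r a) = xi x"
      using frame_expansion[OF p, of "xi x"] by (simp add: r_def x_def inner_xi_self inner_commute)
    ultimately have "\<gamma> (xi x) = (\<Sum>a\<in>Basis - {e}. (r a \<bullet> xi x) *\<^sub>R \<gamma> (r a))" by simp
    then have "\<gamma> (xi x) *v (\<gamma> (xi x) *v w') = (\<Sum>a\<in>Basis - {e}. (r a \<bullet> xi x) *\<^sub>R \<gamma> (r a)) *v (\<gamma> (xi x) *v w')"
      by simp
    then show ?thesis
      by (simp add: gamma_sq1 norm_xi nx linear_sum[of "\<lambda>A. A *v _"] linear_iff mv_simps)
  qed
  also have "(\<Sum>a\<in>Basis - {e}. - w') = - (complex_of_real (2 * m + 1) *s w')"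
  proof -
    have "card (Basis - {e}) = 2 * m + 1"
      using e card_n by (simp add: card_Diff_singleton)
    then show ?thesis unfolding vec_eq_iff sum_component by (simp add: algebra_simps)
  qed
  finally have "p *v ((1/2) *\<^sub>R (\<Sum>a\<in>Basis - {e}. \<Sum>b\<in>Basis - {e}. Omega x (r a) (r b) *\<^sub>R cmult \<gamma> e p (r a) (cmult \<gamma> e p (r b) w)))
     = (1/2) *\<^sub>R ((- s * \<i>) *s (- (complex_of_real (2 * m + 1) *s w') - - w'))"
    by (simp only: mv_scaleR)
  also have "\<dots> = (s * \<i> * of_nat m) *s w'"
    by (simp add: vec_eq_iff scaleR_conv_of_real[where 'a = complex] algebra_simps)
  finally have "p *v Omega_cmult \<gamma> e p w = (s * \<i> * of_nat m) *s (p *v w)"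
    unfolding Omega_cmult_def x_def r_def w'_def .
  then have "matrix_inv p *v (p *v Omega_cmult \<gamma> e p w) = matrix_inv p *v ((s * \<i> * of_nat m) *s (p *v w))"
    by simp
  then show ?thesis by (simp add: Spin_inv_mv[OF p] mv_simps)
qed

lemma pure_imp_Sigma_r:
  assumes p: "p \<in> Spin \<gamma>" and w: "w \<in> \<Sigma>" and pure: "pure s (spin_rot \<gamma> p e) (p *v w)"
  shows "s = - 1 \<Longrightarrow> w \<in> Sigma_r \<gamma> e m \<Sigma> 0 p" and "s = 1 \<Longrightarrow> w \<in> Sigma_r \<gamma> e m \<Sigma> m p"
  using w Omega_cmult_pure[OF p pure] by (auto simp: Sigma_r_def)

text \<open>This is the normalization of the module for \<open>r = 0\<close> and
  \<open>r = m\<close>, read in the trivialization, where multiplication by \<xi> is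
  \<open>x \<xi>\<close>.\<close>

lemma gamma_x_xi:
  assumes x: "norm x = 1" and w: "w \<in> \<Sigma>" and pure: "pure s x w"
  shows "s = - 1 \<Longrightarrow> \<gamma> x *v (\<gamma> (xi x) *v w) = - \<i> *s w"
    and "s = 1 \<Longrightarrow> \<gamma> x *v (\<gamma> (xi x) *v w) = (- ((- 1) ^ m * \<i>)) *s w"
proof -
  obtain p where p: "p \<in> Spin \<gamma>" and px: "spin_rot \<gamma> p e = x"
    using Spin_transitive[OF x] by blast
  define w0 where "w0 = matrix_inv p *v w"
  have pw: "p *v w0 = w" by (simp add: w0_def Spin_inv_mv p)
  have w0: "w0 \<in> \<Sigma>" unfolding w0_def by (intro Spin_Sigma matrix_inv_Spin p w)
  have *: "\<gamma> x *v (\<gamma> (xi x) *v w) = (- \<i> * (- 1) ^ r) *s w"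
    if "w0 \<in> Sigma_r \<gamma> e m \<Sigma> r p" "r \<le> m" for r
  proof -
    have "\<i> *s cmult \<gamma> e p (xi x) w0 = (- 1) ^ r *s w0"
      using mod p that unfolding sasaki_spinor_module_def px[symmetric] by blast
    then have "p *v ((- \<i>) *s (\<i> *s cmult \<gamma> e p (xi x) w0)) = p *v ((- \<i>) *s ((- 1) ^ r *s w0))"
      by simp
    then show ?thesis by (simp add: mv_simps mv_cmult p px pw)
  qed
  show "s = - 1 \<Longrightarrow> \<gamma> x *v (\<gamma> (xi x) *v w) = - \<i> *s w"
    using *[of 0] pure_imp_Sigma_r(1)[OF p w0, of s] pure by (simp add: px pw)
  show "s = 1 \<Longrightarrow> \<gamma> x *v (\<gamma> (xi x) *v w) = (- ((- 1) ^ m * \<i>)) *s w"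
    using *[of m] pure_imp_Sigma_r(2)[OF p w0, of s] pure by (simp add: px pw mult.commute)
qed

text \<open>Purity controls the horizontal directions and \<open>xx\<close> the complex line of
  \<open>x\<close>; together they span the space.\<close>

lemma vacuaI:
  assumes x: "norm x = 1" and pure: "pure s x w" and s: "s * s = 1"
    and xx: "\<gamma> x *v (\<gamma> (xi x) *v w) = (s * \<i>) *s w"
  shows "w \<in> vacua s"
  unfolding vacua_def
proof (intro CollectI allI)
  fix v
  have 1: "\<gamma> (xi x) *v w = (- s * \<i>) *s (\<gamma> x *v w)"
  proof -
    have "\<gamma> x *v (\<gamma> x *v (\<gamma> (xi x) *v w)) = (s * \<i>) *s (\<gamma> x *v w)" by (simp add: xx mv_simps)
    then have "- (- (\<gamma> (xi x) *v w)) = - ((s * \<i>) *s (\<gamma> x *v w))"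
      by (simp add: gamma_sq1 x)
    then show ?thesis by simp
  qed
  have ss: "s * \<i> * (s * \<i>) = - 1" using s by (simp add: algebra_simps)
  have v: "v = (v \<bullet> x) *\<^sub>R x + (v \<bullet> xi x) *\<^sub>R xi x + projQ x v" by (simp add: projQ_def)
  show "\<gamma> (xi v) *v w = (- s * \<i>) *s (\<gamma> v *v w)"
    by (subst (1 2) v)
      (simp add: xi_simps gamma_simps pureD[OF pure projQ_horQ[OF x]] 1 vec.scale_right_distrib
        vec.scale_right_diff_distrib smult_scaleR ss)
qed

lemma pure_gamma_x:
  assumes "norm x = 1" "pure s x w"
  shows "pure s x (\<gamma> x *v w)"
  unfolding pure_def
proof
  fix Z assume Z: "Z \<in> horQ x"
  have o: "Z \<bullet> x = 0" "xi Z \<bullet> x = 0" using Z horQ_xi[OF Z] by (auto simp: horQ_def)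
  show "\<gamma> (xi Z) *v (\<gamma> x *v w) = (- s * \<i>) *s (\<gamma> Z *v (\<gamma> x *v w))"
    by (simp add: gamma_anti0[of _ x] o pureD[OF assms(2) Z] mv_simps)
qed

text \<open>If the complex line of \<open>x\<close> acts with the wrong sign, multiplication by
  \<open>x\<close> corrects it without affecting the horizontal directions.\<close>

lemma vacuaI_gamma_x:
  assumes x: "norm x = 1" and pure: "pure s x w" and s: "s * s = 1"
    and xx: "\<gamma> x *v (\<gamma> (xi x) *v w) = (- s * \<i>) *s w"
  shows "\<gamma> x *v w \<in> vacua s"
proof (rule vacuaI[OF x pure_gamma_x[OF x pure] s])
  have "\<gamma> x *v (\<gamma> (xi x) *v (\<gamma> x *v w)) = - (\<gamma> x *v (\<gamma> x *v (\<gamma> (xi x) *v w)))"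
    by (simp add: gamma_anti0[of "xi x" x] inner_xi_self mv_simps)
  also have "\<dots> = (s * \<i>) *s (\<gamma> x *v w)" unfolding xx by (simp add: mv_simps)
  finally show "\<gamma> x *v (\<gamma> (xi x) *v (\<gamma> x *v w)) = (s * \<i>) *s (\<gamma> x *v w)" .
qed

text \<open>With \<open>l\<close> the coordinate of \<open>e\<close>, the even operators
  \<open>e_k e_l\<close> flip the signs of the other \<open>m\<close> coordinate lines, which leaves
  dimension \<open>2 ^ m / 2 ^ m = 1\<close>.\<close>

lemma ex_pure_in_Sigma:
  assumes s: "s * s = 1"
  shows "\<exists>w\<in>\<Sigma>. w \<noteq> 0 \<and> pure s e w"
proof -
  obtain l where l: "e = axis l 1 \<or> e = axis l \<i>"
    using e by (auto simp: Basis_vec_def Basis_complex_def)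
  let ?K = "UNIV - {l}"
  have "vec.dim \<Sigma> = 2 ^ card ?K * vec.dim {w \<in> \<Sigma>. \<forall>k\<in>?K. Jk k *v w = (s * \<i>) *s w}"
  proof (rule dim_joint_eigenspace[where A = "\<lambda>k. \<gamma> (axis k 1) ** \<gamma> (axis l 1)"])
    show "(\<gamma> (axis k 1) ** \<gamma> (axis l 1)) *v ((\<gamma> (axis k 1) ** \<gamma> (axis l 1)) *v w) = - w"
      if "k \<in> ?K" for k w
      using that by (simp add: mm_mv gamma_anti0[of "axis l 1" "axis k 1"] axis_orthonormal mv_simps gamma_sq1)
    show "Jk k *v w \<in> \<Sigma>" if "w \<in> \<Sigma>" for k w
      using that by (simp add: Jk_def mm_mv Sigma_even)
  qed (auto simp: subspace_Sigma mm_mv Sigma_even Jk_anti Jk_comm s mv_simps)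
  moreover have "card ?K = m" using card_n by (simp add: card_Diff_singleton)
  ultimately have "vec.dim {w \<in> \<Sigma>. \<forall>k\<in>?K. Jk k *v w = (s * \<i>) *s w} = 1"
    using dim_Sigma by simp
  then have "vec.dim {w \<in> \<Sigma>. \<forall>k\<in>?K. Jk k *v w = (s * \<i>) *s w} \<noteq> 0" by simp
  then have "\<not> {w \<in> \<Sigma>. \<forall>k\<in>?K. Jk k *v w = (s * \<i>) *s w} \<subseteq> {0}"
    by (simp only: vec.dim_eq_0 not_False_eq_True)
  then obtain w where w: "w \<in> \<Sigma>" "w \<noteq> 0" "\<And>k. k \<in> ?K \<Longrightarrow> Jk k *v w = (s * \<i>) *s w"
    by auto
  have "pure s e w"
    unfolding pure_def
  proof
    fix Z assume "Z \<in> horQ e"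
    then have "Z $ l = 0"
      using l by (auto simp: horQ_def xi_axis inner_axis complex_eq_iff)
    then show "\<gamma> (xi Z) *v w = (- s * \<i>) *s (\<gamma> Z *v w)"
      by (intro gamma_xi_of_Jk[of s ?K] s w(3)) auto
  qed
  with w(1,2) show ?thesis by blast
qed

lemma vacua_subset:
  assumes s: "s * s = 1" and "w \<in> \<Sigma>" "w \<noteq> 0" "w \<in> vacua s"
  shows "vacua s \<subseteq> \<Sigma>"
proof -
  obtain w0 where w0: "w0 \<noteq> 0" "vacua s = range (\<lambda>a. a *s w0)"
    using vacua_line[OF s] by blast
  then obtain a where a: "w = a *s w0" using assms by auto
  then have "w0 = inverse a *s w" using assms(3) by auto
  then have "w0 \<in> \<Sigma>" using assms(2) by (simp add: Sigma_closed)
  then show ?thesis by (auto simp: w0(2) Sigma_closed)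
qed

text \<open>The normalization makes a pure spinor of \<Sigma> a vacuum; as the vacua form a line,
  one common non-zero element suffices.\<close>

lemma vacua_minus_subset: "vacua (- 1) \<subseteq> \<Sigma>"
proof -
  obtain w where w: "w \<in> \<Sigma>" "w \<noteq> 0" "pure (- 1) e w"
    using ex_pure_in_Sigma[of "- 1"] by auto
  then have "w \<in> vacua (- 1)"
    by (intro vacuaI[OF norm_e]) (auto simp: gamma_x_xi(1)[OF norm_e])
  with w show ?thesis by (intro vacua_subset) auto
qed

lemma vacua_plus_subset:
  assumes "odd m" shows "vacua 1 \<subseteq> \<Sigma>"
proof -
  obtain w where w: "w \<in> \<Sigma>" "w \<noteq> 0" "pure 1 e w"
    using ex_pure_in_Sigma[of 1] by auto
  then have "w \<in> vacua 1"
    using assms by (intro vacuaI[OF norm_e]) (auto simp: gamma_x_xi(2)[OF norm_e])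
  with w show ?thesis by (intro vacua_subset) auto
qed

text \<open>For even \<open>m\<close> the normalization gives the complex line of \<open>e\<close>
  the wrong sign on the pure spinor \<open>w\<close>, so the highest vacua are the multiples of
  \<open>e w\<close> and a further vector leads back into \<Sigma>.\<close>

lemma gamma_vacua_plus:
  assumes "even m" "\<eta> \<in> vacua 1" shows "\<gamma> x *v \<eta> \<in> \<Sigma>"
proof -
  obtain w where w: "w \<in> \<Sigma>" "w \<noteq> 0" "pure 1 e w"
    using ex_pure_in_Sigma[of 1] by auto
  then have v: "\<gamma> e *v w \<in> vacua 1"
    using assms by (intro vacuaI_gamma_x[OF norm_e]) (auto simp: gamma_x_xi(2)[OF norm_e])
  have nz: "\<gamma> e *v w \<noteq> 0" using w norm_e by (auto simp: gamma_eq_0)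
  obtain w0 where w0: "w0 \<noteq> 0" "vacua 1 = range (\<lambda>a. a *s w0)"
    using vacua_line[of 1] by auto
  obtain a b where ab: "\<eta> = a *s w0" "\<gamma> e *v w = b *s w0" using w0 v assms by auto
  with nz have "b \<noteq> 0" by auto
  then have "\<eta> = (a / b) *s (\<gamma> e *v w)" using ab by simp
  then show ?thesis using w(1) by (simp add: mv_simps Sigma_closed Sigma_even)
qed

text \<open>Multiplication by the invertible \<open>p\<close> turns components in a spin frame into
  ambient spinors, so that only vectors in the base point \<open>x\<close> remain.\<close>

lemma trans_killing_spinor_iff:
  "trans_killing_spinor \<gamma> e \<Sigma> \<alpha> \<beta> \<psi> \<longleftrightarrow> spinor_field \<gamma> e \<Sigma> \<psi> \<and>
    (\<forall>p\<in>Spin \<gamma>. \<forall>x. x = spin_rot \<gamma> p e \<longrightarrow>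
      p *v spin_cov \<gamma> e 1 \<psi> p (xi x) =
        (1/2) *\<^sub>R (p *v Omega_cmult \<gamma> e p (\<psi> p)) + \<alpha> *s (\<gamma> x *v (\<gamma> (xi x) *v (p *v \<psi> p))) \<and>
      (\<forall>Z\<in>horQ x. p *v spin_cov \<gamma> e 1 \<psi> p Z =
        (1/2) *\<^sub>R (\<gamma> (xi x) *v (\<gamma> (xi Z) *v (p *v \<psi> p))) +
        \<beta> *s (\<gamma> (xi x) *v (\<gamma> Z *v (p *v \<psi> p)))))"
proof -
  have eq_iff: "p *v a = p *v b \<longleftrightarrow> a = b" if "p \<in> Spin \<gamma>" for p a b
    by (metis Spin_inv_mv(2)[OF that])
  have *: "a - c = b \<longleftrightarrow> p *v a = p *v c + p *v b" if "p \<in> Spin \<gamma>" for p and a b c :: "complex^'w"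
    unfolding eq_iff[OF that] vec.add[symmetric] by (auto simp: algebra_simps)
  have xi: "xi (spin_rot \<gamma> p e) \<bullet> spin_rot \<gamma> p e = 0" for p
    by (rule inner_xi_self)
  show ?thesis
    unfolding trans_killing_spinor_def trans_cov_xi_def trans_cov_Q_def
    by (simp add: * mv_simps mv_cmult gamma_xXx norm_point xi h_op_horQ cong: conj_cong ball_cong)
qed

text \<open>On a vacuum \<open>x \<xi>\<close> acts as \<open>s i\<close>, the Levi-Civita
  derivative along \<xi> as \<open>- s i / 2\<close>, and half of \<Omega> as
  \<open>s i m / 2\<close>; this determines \<alpha>. Horizontally, the derivative and the
  \<Omega>-correction of the connection are equal, hence \<beta> is zero.\<close>

lemma const_spinor_TKS:
  assumes s: "s * s = 1" and \<eta>: "\<eta> \<in> vacua s" "\<eta> \<in> \<Sigma>"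
  shows "trans_killing_spinor \<gamma> e \<Sigma> (- ((of_nat m + 1) / 2)) 0 (const_spinor (mat 1) \<eta>)"
    and "p \<in> Spin \<gamma> \<Longrightarrow> pure s (spin_rot \<gamma> p e) (p *v const_spinor (mat 1) \<eta> p)"
proof -
  let ?\<psi> = "const_spinor (mat 1) \<eta>"
  have F: "p *v ?\<psi> p = \<eta>" if "p \<in> Spin \<gamma>" for p
    using that by (simp add: const_spinor_def Spin_inv_mv)
  show pure: "pure s (spin_rot \<gamma> p e) (p *v ?\<psi> p)" if "p \<in> Spin \<gamma>" for p
    using F[OF that] vacua_pure[OF \<eta>(1)] by simp
  have field: "spinor_field \<gamma> e \<Sigma> ?\<psi>"
    by (rule spinor_field_const_spinor) (auto intro: Spin_Sigma matrix_inv_Spin \<eta>)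
  note va = vacuaD[OF \<eta>(1)]
  show "trans_killing_spinor \<gamma> e \<Sigma> (- ((of_nat m + 1) / 2)) 0 ?\<psi>"
    unfolding trans_killing_spinor_iff
  proof (intro conjI field ballI allI impI)
    fix p x assume p: "p \<in> Spin \<gamma>" and x: "x = spin_rot \<gamma> p e"
    have nx: "norm x = 1" using norm_point p x by simp
    have cov: "p *v spin_cov \<gamma> e 1 ?\<psi> p X = (- 1/2) *\<^sub>R (\<gamma> x *v (\<gamma> X *v \<eta>))" if "X \<bullet> x = 0" for X
      using spin_cov_const_spinor[OF p norm_e _ x that, of 1 "mat 1" \<eta>]
      by (simp add: mv_simps Spin_inv_mv[OF p])
    have Om: "p *v Omega_cmult \<gamma> e p (?\<psi> p) = (s * \<i> * of_nat m) *s \<eta>"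
      by (simp add: Omega_cmult_pure[OF p pure[OF p]] F[OF p] mv_simps)
    show "p *v spin_cov \<gamma> e 1 ?\<psi> p (xi x) =
        (1/2) *\<^sub>R (p *v Omega_cmult \<gamma> e p (?\<psi> p)) +
        (- ((of_nat m + 1) / 2)) *s (\<gamma> x *v (\<gamma> (xi x) *v (p *v ?\<psi> p)))"
      by (simp add: cov inner_xi_self Om F[OF p] va mv_simps gamma_sq1 nx)
        (simp add: vec_eq_iff scaleR_conv_of_real[where 'a = complex] field_simps)
    fix Z assume Z: "Z \<in> horQ x"
    have o: "Z \<bullet> x = 0" "x \<bullet> Z = 0" "xi x \<bullet> Z = 0" using Z by (auto simp: horQ_def inner_commute)
    have "\<gamma> (xi x) *v (\<gamma> Z *v \<eta>) = - (\<gamma> Z *v (\<gamma> (xi x) *v \<eta>))"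
      by (rule gamma_anti0[OF o(3)])
    moreover have "s * \<i> * (s * \<i>) = - 1" using s by (simp add: algebra_simps)
    ultimately show "p *v spin_cov \<gamma> e 1 ?\<psi> p Z =
        (1/2) *\<^sub>R (\<gamma> (xi x) *v (\<gamma> (xi Z) *v (p *v ?\<psi> p))) +
        0 *s (\<gamma> (xi x) *v (\<gamma> Z *v (p *v ?\<psi> p)))"
      by (simp add: cov o F[OF p] va mv_simps gamma_anti0[of x Z])
  qed
qed

text \<open>In the trivialization this spinor is \<open>x \<eta>\<close>. Compared with the action
  of \<open>x \<xi>\<close>, now \<open>- i\<close>, both the derivative and the \<Omega>-term
  change sign, hence so does \<alpha>.\<close>

lemma gamma_spinor_TKS:
  assumes m: "even m" and \<eta>: "\<eta> \<in> vacua 1"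
  shows "trans_killing_spinor \<gamma> e \<Sigma> ((of_nat m + 1) / 2) 0 (const_spinor (\<gamma> e) \<eta>)"
    and "p \<in> Spin \<gamma> \<Longrightarrow> pure 1 (spin_rot \<gamma> p e) (p *v const_spinor (\<gamma> e) \<eta> p)"
proof -
  let ?\<psi> = "const_spinor (\<gamma> e) \<eta>"
  have F: "p *v ?\<psi> p = \<gamma> (spin_rot \<gamma> p e) *v \<eta>" if "p \<in> Spin \<gamma>" for p
    using that by (simp add: const_spinor_def Spin_inv_mv spin_rot)
  show pure: "pure 1 (spin_rot \<gamma> p e) (p *v ?\<psi> p)" if "p \<in> Spin \<gamma>" for p
    using F[OF that] pure_gamma_x[OF norm_point[OF that] vacua_pure[OF \<eta>(1)]] by simp
  have field: "spinor_field \<gamma> e \<Sigma> ?\<psi>"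
  proof (rule spinor_field_const_spinor)
    fix p assume p: "p \<in> Spin \<gamma>"
    have "\<gamma> e *v (matrix_inv p *v \<eta>) = matrix_inv p *v (\<gamma> (spin_rot \<gamma> p e) *v \<eta>)"
      by (rule spin_rot_inv[OF p, symmetric])
    then show "\<gamma> e *v (matrix_inv p *v \<eta>) \<in> \<Sigma>"
      using gamma_vacua_plus[OF m \<eta>] Spin_Sigma matrix_inv_Spin(1)[OF p] by simp
  qed simp
  note va = vacuaD[OF \<eta>(1)]
  show "trans_killing_spinor \<gamma> e \<Sigma> ((of_nat m + 1) / 2) 0 ?\<psi>"
    unfolding trans_killing_spinor_iff
  proof (intro conjI field ballI allI impI)
    fix p x assume p: "p \<in> Spin \<gamma>" and x: "x = spin_rot \<gamma> p e"
    have nx: "norm x = 1" using norm_point p x by simp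
    have cov: "p *v spin_cov \<gamma> e 1 ?\<psi> p X = (1/2) *\<^sub>R (\<gamma> X *v \<eta>)" if "X \<bullet> x = 0" for X
      using spin_cov_const_spinor[OF p norm_e _ x that, of 1 "\<gamma> e" \<eta>]
      by (simp add: mv_simps Spin_inv_mv[OF p] spin_rot[OF p] gamma_sq1 nx flip: x)
    have Om: "p *v Omega_cmult \<gamma> e p (?\<psi> p) = (\<i> * of_nat m) *s (\<gamma> x *v \<eta>)"
      using Omega_cmult_pure[OF p pure[OF p]] F[OF p] by (simp add: mv_simps x)
    show "p *v spin_cov \<gamma> e 1 ?\<psi> p (xi x) =
        (1/2) *\<^sub>R (p *v Omega_cmult \<gamma> e p (?\<psi> p)) +
        ((of_nat m + 1) / 2) *s (\<gamma> x *v (\<gamma> (xi x) *v (p *v ?\<psi> p)))"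
      by (simp add: cov inner_xi_self Om F[OF p] flip: x)
        (simp add: va mv_simps gamma_sq1 nx gamma_anti0[of "xi x" x] inner_xi_self,
         simp add: vec_eq_iff scaleR_conv_of_real[where 'a = complex] field_simps)
    fix Z assume Z: "Z \<in> horQ x"
    have o: "Z \<bullet> x = 0" "xi x \<bullet> Z = 0" "xi Z \<bullet> x = 0" "x \<bullet> Z = 0"
      using Z horQ_xi[OF Z] by (auto simp: horQ_def inner_commute)
    have 1: "\<gamma> (xi Z) *v (\<gamma> x *v \<eta>) = (- \<i>) *s (\<gamma> Z *v (\<gamma> x *v \<eta>))"
      using pureD[OF pure_gamma_x[OF nx vacua_pure[OF \<eta>]] Z] by simp
    have "\<gamma> (xi x) *v (\<gamma> Z *v (\<gamma> x *v \<eta>)) = \<gamma> Z *v (\<gamma> x *v (\<gamma> (xi x) *v \<eta>))"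
      by (simp only: gamma_anti0[OF o(2)] gamma_anti0[OF inner_xi_self(2)] mv_minus minus_minus)
    also have "\<dots> = \<i> *s (\<gamma> Z *v \<eta>)"
      by (simp add: va mv_simps gamma_sq1 nx)
    finally show "p *v spin_cov \<gamma> e 1 ?\<psi> p Z =
        (1/2) *\<^sub>R (\<gamma> (xi x) *v (\<gamma> (xi Z) *v (p *v ?\<psi> p))) +
        0 *s (\<gamma> (xi x) *v (\<gamma> Z *v (p *v ?\<psi> p)))"
      by (simp add: cov o F[OF p] 1 mv_simps flip: x)
  qed
qed

end

section \<open>Tools for the equations along great circles\<close>

lemma constant_if_derivative_0:
  fixes f :: "real \<Rightarrow> 'a::real_normed_vector"
  assumes "\<And>t. (f has_vector_derivative 0) (at t)"
  shows "f t = f 0"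
proof -
  have "(f has_derivative (\<lambda>_. 0)) (at t within UNIV)" for t
    using assms by (simp add: has_vector_derivative_def)
  then show ?thesis
    using has_derivative_zero_unique[of UNIV f 0 t] by auto
qed

lemma has_vector_derivative_shift_0:
  assumes "(h has_vector_derivative v) (at 0)"
  shows "((\<lambda>s. h (s - t)) has_vector_derivative v) (at (t::real))"
proof -
  have "((\<lambda>s. s - t) has_vector_derivative 1 - 0) (at t)"
    by (rule has_vector_derivative_diff[OF has_vector_derivative_id has_vector_derivative_const])
  then show ?thesis
    using vector_diff_chain_at[of "\<lambda>s. s - t" 1 t h v] assms by (simp add: o_def)
qed

text \<open>Since \<open>K\<close> squares to \<open>- 1\<close>, the curve \<open>v\<close> below
  is \<open>exp(- b t K) G\<close>, which has derivative zero. The functions are the complex sine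
  and cosine, as \<open>b\<close> is complex.\<close>

lemma rotation_ODE:
  fixes K :: "complex^'w^'w"
  assumes G: "\<And>t. (G has_vector_derivative b *s (K *v G t)) (at t)"
    and K: "\<And>w. K *v (K *v w) = - w"
  shows "G t = cos (b * of_real t) *s G 0 + sin (b * of_real t) *s (K *v G 0)"
proof -
  define v where "v t = cos (b * of_real t) *s G t - sin (b * of_real t) *s (K *v G t)" for t :: real
  have bil: "bounded_bilinear (\<lambda>(c::complex) (w::complex^'w). c *s w)"
    by (rule bilinear_conv_bounded_bilinear[THEN iffD1])
      (auto simp: bilinear_def linear_iff vec.scale_left_distrib vec.scale_right_distrib smult_scaleR
        scaleR_conv_of_real[where 'a = complex] scaleR_conv_smult)
  have c: "((\<lambda>t. cos (b * of_real t)) has_vector_derivative - b * sin (b * of_real t)) (at (t::real))"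
    and s: "((\<lambda>t. sin (b * of_real t)) has_vector_derivative b * cos (b * of_real t)) (at (t::real))" for t
    by (rule has_vector_derivative_real_field[THEN has_vector_derivative_eq_rhs],
        auto intro!: derivative_eq_intros)+
  have KG: "((\<lambda>t. K *v G t) has_vector_derivative K *v (b *s (K *v G t))) (at t)" for t
    by (rule bounded_linear.has_vector_derivative[OF matrix_vector_mul_bounded_linear G])
  have "(v has_vector_derivative 0) (at t)" for t
    unfolding v_def
    by (rule has_vector_derivative_eq_rhs,
        rule has_vector_derivative_diff[OF bounded_bilinear.has_vector_derivative[OF bil c G]
          bounded_bilinear.has_vector_derivative[OF bil s KG]])
      (simp add: mv_simps K vec_eq_iff algebra_simps)
  then have "v t = v 0" by (rule constant_if_derivative_0)
  then have v: "v t = G 0" by (simp add: v_def)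
  define c s where "c = cos (b * of_real t)" and "s = sin (b * of_real t)"
  have "c * c + s * s = 1"
    unfolding c_def s_def using sin_cos_squared_add[of "b * of_real t"]
    by (simp add: power2_eq_square add.commute)
  then have "c * c * a + s * s * a = a" for a
    by (metis distrib_right mult_1)
  moreover have "c *s v t + s *s (K *v v t) = c *s (c *s G t) + s *s (s *s G t)"
    by (simp add: v_def mv_simps K vec_eq_iff algebra_simps flip: c_def s_def)
  ultimately have "c *s v t + s *s (K *v v t) = G t"
    by (simp add: vec_eq_iff)
  then show ?thesis by (simp add: v flip: c_def s_def)
qed

context clifford
begin

lemma spin_exp_has_derivative:
  assumes "orthonormal2 u v"
  shows "((\<lambda>t. spin_exp u v (k * t)) has_vector_derivative
     (k/2) *\<^sub>R (\<gamma> u ** \<gamma> v ** spin_exp u v (k * t))) (at t)"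
proof (rule has_vector_derivative_eq_rhs)
  show "((\<lambda>t. spin_exp u v (k * t)) has_vector_derivative
     (k/2) *\<^sub>R (cos (k * t/2) *\<^sub>R (\<gamma> u ** \<gamma> v) - sin (k * t/2) *\<^sub>R mat 1)) (at t)"
    unfolding spin_exp_def by (auto intro!: derivative_eq_intros simp: algebra_simps)
  have "v \<bullet> u = 0" "norm u = 1" "norm v = 1"
    using assms by (auto simp: orthonormal2_def inner_commute)
  then show "(k/2) *\<^sub>R (cos (k * t/2) *\<^sub>R (\<gamma> u ** \<gamma> v) - sin (k * t/2) *\<^sub>R mat 1) =
     (k/2) *\<^sub>R (\<gamma> u ** \<gamma> v ** spin_exp u v (k * t))"
    by (simp add: matrix_eq spin_exp_mv mv_simps gamma_anti0[of v u] gamma_sq1)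
qed

text \<open>The bivector of an orthonormal pair depends only on the oriented plane, so it is
  constant along a great circle.\<close>

lemma spin_exp_plane:
  assumes "orthonormal2 u v" and "u' = cos s *\<^sub>R u + sin s *\<^sub>R v" "v' = cos s *\<^sub>R v - sin s *\<^sub>R u"
  shows "\<gamma> u' *v (\<gamma> v' *v w) = \<gamma> u *v (\<gamma> v *v w)" and "spin_exp u' v' = spin_exp u v"
    and "orthonormal2 u' v'"
proof -
  have o: "v \<bullet> u = 0" "norm u = 1" "norm v = 1" "u \<bullet> u = 1" "v \<bullet> v = 1" "u \<bullet> v = 0"
    using assms by (auto simp: orthonormal2_def inner_commute norm_eq_1)
  have sc: "cos s * cos s + sin s * sin s = 1"
    using sin_cos_squared_add[of s] by (simp add: power2_eq_square)
  then have sc2: "complex_of_real (cos s) * complex_of_real (cos s) +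
      complex_of_real (sin s) * complex_of_real (sin s) = 1"
    unfolding of_real_mult[symmetric] of_real_add[symmetric] by simp
  show *: "\<gamma> u' *v (\<gamma> v' *v w) = \<gamma> u *v (\<gamma> v *v w)" for w
    using sc2 unfolding assms(2,3)
    by (simp add: gamma_simps mv_simps gamma_sq1 o gamma_anti0[of v u] vec_eq_iff
        scaleR_conv_of_real[where 'a = complex]) algebra
  show "spin_exp u' v' = spin_exp u v"
    by (rule ext) (simp add: matrix_eq spin_exp_mv *)
  show "orthonormal2 u' v'"
    using sc unfolding assms(2,3) by (simp add: orthonormal2_def norm_eq_1 inner_simps o algebra_simps)
qed

lemma gamma_gamma_square:
  "orthonormal2 u v \<Longrightarrow> \<gamma> u *v (\<gamma> v *v (\<gamma> u *v (\<gamma> v *v w))) = - w"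
  by (simp add: orthonormal2_def gamma_anti0[of v u] inner_commute mv_simps gamma_sq1)

end

context sasaki
begin

section \<open>The equations in the trivialization of the spinor bundle\<close>

text \<open>By equivariance \<open>p \<psi>(p)\<close> depends only on the base point of the spin frame \<open>p\<close>:
  this is the trivialization of the spinor bundle by Killing spinors.\<close>

definition sphere_map :: "(complex^'w^'w \<Rightarrow> complex^'w) \<Rightarrow> complex^'n \<Rightarrow> complex^'w" where
  "sphere_map \<psi> x = (let p = SOME p. p \<in> Spin \<gamma> \<and> spin_rot \<gamma> p e = x in p *v \<psi> p)"

lemma sphere_map:
  assumes \<psi>: "spinor_field \<gamma> e \<Sigma> \<psi>" and p: "p \<in> Spin \<gamma>"
  shows "sphere_map \<psi> (spin_rot \<gamma> p e) = p *v \<psi> p"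
proof -
  define p' where "p' = (SOME p'. p' \<in> Spin \<gamma> \<and> spin_rot \<gamma> p' e = spin_rot \<gamma> p e)"
  have p': "p' \<in> Spin \<gamma>" "spin_rot \<gamma> p' e = spin_rot \<gamma> p e"
    unfolding p'_def using someI[of "\<lambda>p'. p' \<in> Spin \<gamma> \<and> spin_rot \<gamma> p' e = spin_rot \<gamma> p e" p] p by auto
  define s where "s = matrix_inv p' ** p"
  have s: "s \<in> Spin \<gamma>" unfolding s_def by (intro Spin_mult matrix_inv_Spin p' p)
  have "spin_rot \<gamma> s e = e"
    unfolding s_def
    by (simp add: spin_rot_mult matrix_inv_Spin p' p spin_rot_matrix_inv flip: p'(2))
  then have "s *v \<psi> (p' ** s) = \<psi> p'"
    using \<psi> p'(1) s unfolding spinor_field_def by blast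
  moreover have "p' ** s = p"
    unfolding s_def by (simp add: matrix_mul_assoc matrix_inv_Spin p')
  ultimately have "p' *v \<psi> p' = p *v \<psi> p" by (metis mm_mv)
  then show ?thesis unfolding sphere_map_def p'_def[symmetric] Let_def .
qed

lemma spinor_from_sphere_map:
  "spinor_field \<gamma> e \<Sigma> \<psi> \<Longrightarrow> p \<in> Spin \<gamma> \<Longrightarrow> \<psi> p = matrix_inv p *v sphere_map \<psi> (spin_rot \<gamma> p e)"
  by (simp add: sphere_map Spin_inv_mv)

lemma sphere_map_Sigma:
  assumes "spinor_field \<gamma> e \<Sigma> \<psi>" "norm x = 1" shows "sphere_map \<psi> x \<in> \<Sigma>"
proof -
  obtain p where p: "p \<in> Spin \<gamma>" "spin_rot \<gamma> p e = x"
    using Spin_transitive[OF assms(2)] by blast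
  with assms(1) have "\<psi> p \<in> \<Sigma>" by (simp add: spinor_field_def)
  then have "p *v \<psi> p \<in> \<Sigma>" by (rule Spin_Sigma[OF p(1)])
  then show ?thesis using sphere_map[OF assms(1) p(1)] p(2) by simp
qed

lemma sphere_map_nonzero:
  assumes "spinor_field \<gamma> e \<Sigma> \<psi>" "\<psi> \<noteq> (\<lambda>_. 0)"
  obtains x where "norm x = 1" "sphere_map \<psi> x \<noteq> 0"
proof -
  obtain p where "\<psi> p \<noteq> 0" using assms(2) by auto
  moreover from this have p: "p \<in> Spin \<gamma>" using assms(1) by (auto simp: spinor_field_def)
  ultimately show thesis
    using that[OF norm_point[OF p]] sphere_map[OF assms(1) p] Spin_mv_eq_0[OF p] by metis
qed

text \<open>Product rule for \<open>q \<psi>(q)\<close> along parallel spin frames: the frames move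
  by \<open>(1/2) x u\<close>, and the derivative of \<psi> along them is covariant.\<close>

lemma great_circle_derivative:
  assumes \<psi>: "spinor_field \<gamma> e \<Sigma> \<psi>" and o: "orthonormal2 x u"
    and q: "q \<in> Spin \<gamma>" "spin_rot \<gamma> q e = cos t *\<^sub>R x + sin t *\<^sub>R u"
  shows "((\<lambda>t. sphere_map \<psi> (cos t *\<^sub>R x + sin t *\<^sub>R u)) has_vector_derivative
    (1/2) *\<^sub>R (\<gamma> x *v (\<gamma> u *v sphere_map \<psi> (cos t *\<^sub>R x + sin t *\<^sub>R u))) +
    q *v spin_cov \<gamma> e 1 \<psi> q (cos t *\<^sub>R u - sin t *\<^sub>R x)) (at t)"
proof -
  define x' u' where "x' = cos t *\<^sub>R x + sin t *\<^sub>R u" and "u' = cos t *\<^sub>R u - sin t *\<^sub>R x"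
  note pl = spin_exp_plane[OF o x'_def u'_def]
  let ?Q = "\<lambda>s. spin_exp x u s ** q"
  have smooth: "smooth_on (Spin \<gamma>) \<psi>" using \<psi> by (simp add: spinor_field_def)
  have 1: "((\<lambda>s. \<psi> (?Q s)) has_vector_derivative spin_cov \<gamma> e 1 \<psi> q u') (at 0)"
    using spin_cov_eqI[OF q(1) norm_e _ q(2)[symmetric, folded x'_def] pl(3) smooth, of 1 1]
    by (simp add: pl(2))
  have "((\<lambda>s. spin_exp x u (1 * s)) has_vector_derivative (1/2) *\<^sub>R (\<gamma> x ** \<gamma> u ** spin_exp x u (1 * 0))) (at 0)"
    by (rule spin_exp_has_derivative[OF o])
  then have "((\<lambda>s. spin_exp x u s) has_vector_derivative (1/2) *\<^sub>R (\<gamma> x ** \<gamma> u)) (at 0)"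
    by (simp add: spin_exp_0)
  from has_vector_derivative_mm[OF this has_vector_derivative_const]
  have 2: "(?Q has_vector_derivative (1/2) *\<^sub>R (\<gamma> x ** \<gamma> u) ** q) (at 0)" by simp
  have F: "sphere_map \<psi> (cos (t + s) *\<^sub>R x + sin (t + s) *\<^sub>R u) = ?Q s *v \<psi> (?Q s)" for s
  proof -
    have "spin_rot \<gamma> (?Q s) e = plane_rot x u s x'"
      by (simp add: spin_rot_spin_exp_mult[OF o q(1)] q(2) x'_def)
    also have "\<dots> = cos (t + s) *\<^sub>R x + sin (t + s) *\<^sub>R u"
      using o by (simp add: plane_rot_def x'_def orthonormal2_def inner_simps norm_eq_1 inner_commute
          cos_add sin_add algebra_simps)
    finally show ?thesis
      using sphere_map[OF \<psi> Spin_mult[OF spin_exp_Spin[OF o] q(1)]] by metis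
  qed
  have "((\<lambda>s. sphere_map \<psi> (cos (t + s) *\<^sub>R x + sin (t + s) *\<^sub>R u)) has_vector_derivative
      (1/2) *\<^sub>R (\<gamma> x *v (\<gamma> u *v (q *v \<psi> q))) + q *v spin_cov \<gamma> e 1 \<psi> q u') (at 0)"
    unfolding F by (rule has_vector_derivative_eq_rhs[OF has_vector_derivative_mv[OF 2 1]])
      (simp add: spin_exp_0 mv_simps add.commute)
  from has_vector_derivative_shift_0[OF this, of t] show ?thesis
    using F[of 0] by (simp add: spin_exp_0 u'_def)
qed

section \<open>Transport along horizontal great circles\<close>

lemma horQ_orthogonal:
  assumes "Z \<in> horQ x"
  shows "x \<bullet> Z = 0" "Z \<bullet> x = 0" "xi x \<bullet> Z = 0" "Z \<bullet> xi x = 0" "x \<bullet> xi Z = 0" "xi Z \<bullet> x = 0"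
    "xi x \<bullet> xi Z = 0" "xi Z \<bullet> xi x = 0"
  using assms horQ_xi[OF assms] by (auto simp: horQ_def inner_commute)

lemma horQ_orthonormal2:
  assumes "Z \<in> horQ x" "norm x = 1" "norm Z = 1"
  shows "orthonormal2 x Z" "orthonormal2 (xi x) (xi Z)"
  using assms by (auto simp: orthonormal2_def norm_xi horQ_orthogonal)

lemma horQ_rotate:
  fixes x :: "complex^'n"
  assumes "Z \<in> horQ x" "norm x = 1" "norm Z = 1"
  shows "cos t *\<^sub>R Z - sin t *\<^sub>R x \<in> horQ (cos t *\<^sub>R x + sin t *\<^sub>R Z)"
    and "norm (cos t *\<^sub>R x + sin t *\<^sub>R Z) = 1" "norm (cos t *\<^sub>R Z - sin t *\<^sub>R x) = 1"
proof -
  note o = spin_exp_plane(3)[OF horQ_orthonormal2(1)[OF assms] refl refl]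
  then show "norm (cos t *\<^sub>R x + sin t *\<^sub>R Z) = 1" "norm (cos t *\<^sub>R Z - sin t *\<^sub>R x) = 1"
    by (auto simp: orthonormal2_def)
  show "cos t *\<^sub>R Z - sin t *\<^sub>R x \<in> horQ (cos t *\<^sub>R x + sin t *\<^sub>R Z)"
    using o assms(2,3) horQ_orthogonal[OF assms(1)]
    by (auto simp: horQ_def orthonormal2_def inner_simps xi_simps inner_xi_self norm_eq_1 inner_commute)
qed

text \<open>The bivectors \<open>x Z\<close> and \<open>\<xi> xi Z\<close> are constant along the
  circle. The \<beta>-term mixes the two planes and varies, which is why a rotating frame is
  needed.\<close>

lemma horizontal_derivative:
  assumes \<psi>: "trans_killing_spinor \<gamma> e \<Sigma> \<alpha> \<beta> \<psi>" and Z: "Z \<in> horQ x" "norm x = 1" "norm Z = 1"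
  shows "((\<lambda>t. sphere_map \<psi> (cos t *\<^sub>R x + sin t *\<^sub>R Z)) has_vector_derivative
    (1/2) *\<^sub>R (\<gamma> x *v (\<gamma> Z *v sphere_map \<psi> (cos t *\<^sub>R x + sin t *\<^sub>R Z))) +
    (1/2) *\<^sub>R (\<gamma> (xi x) *v (\<gamma> (xi Z) *v sphere_map \<psi> (cos t *\<^sub>R x + sin t *\<^sub>R Z))) +
    \<beta> *s (\<gamma> (xi (cos t *\<^sub>R x + sin t *\<^sub>R Z)) *v (\<gamma> (cos t *\<^sub>R Z - sin t *\<^sub>R x) *v
      sphere_map \<psi> (cos t *\<^sub>R x + sin t *\<^sub>R Z)))) (at t)"
proof -
  note o = horQ_orthonormal2[OF Z]
  define x' Z' where x': "x' = cos t *\<^sub>R x + sin t *\<^sub>R Z" and Z': "Z' = cos t *\<^sub>R Z - sin t *\<^sub>R x"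
  have field: "spinor_field \<gamma> e \<Sigma> \<psi>" using \<psi> by (simp add: trans_killing_spinor_def)
  have hor: "Z' \<in> horQ x'" and nx: "norm x' = 1" using horQ_rotate[OF Z] by (auto simp: x' Z')
  obtain q where q: "q \<in> Spin \<gamma>" "spin_rot \<gamma> q e = x'"
    using Spin_transitive[OF nx] by blast
  have "xi x' = cos t *\<^sub>R xi x + sin t *\<^sub>R xi Z" "xi Z' = cos t *\<^sub>R xi Z - sin t *\<^sub>R xi x"
    by (simp_all add: x' Z' xi_simps)
  then have *: "\<gamma> (xi x') *v (\<gamma> (xi Z') *v w) = \<gamma> (xi x) *v (\<gamma> (xi Z) *v w)" for w
    by (rule spin_exp_plane(1)[OF o(2)])
  have "q *v spin_cov \<gamma> e 1 \<psi> q Z' =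
      (1/2) *\<^sub>R (\<gamma> (xi x) *v (\<gamma> (xi Z) *v sphere_map \<psi> x')) +
      \<beta> *s (\<gamma> (xi x') *v (\<gamma> Z' *v sphere_map \<psi> x'))"
  proof -
    have "q *v spin_cov \<gamma> e 1 \<psi> q Z' =
        (1/2) *\<^sub>R (\<gamma> (xi x') *v (\<gamma> (xi Z') *v (q *v \<psi> q))) +
        \<beta> *s (\<gamma> (xi x') *v (\<gamma> Z' *v (q *v \<psi> q)))"
      using \<psi> q(1) hor unfolding trans_killing_spinor_iff q(2)[symmetric] by blast
    then show ?thesis using sphere_map[OF field q(1)] by (simp add: * q(2))
  qed
  with great_circle_derivative[OF field o(1) q(1) q(2)[unfolded x']]
  show ?thesis unfolding x'[symmetric] Z'[symmetric] by (simp add: add.assoc)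
qed

lemma spin_exp_gamma_orthogonal:
  "orthonormal2 u v \<Longrightarrow> y \<bullet> u = 0 \<Longrightarrow> y \<bullet> v = 0 \<Longrightarrow>
    spin_exp u v t *v (\<gamma> y *v w) = \<gamma> y *v (spin_exp u v t *v w)"
  by (simp add: spin_exp_gamma plane_rot_simps(3))

lemma spin_exp_gamma_back:
  assumes "orthonormal2 u v"
  shows "spin_exp u v (- t) *v (\<gamma> (cos t *\<^sub>R u + sin t *\<^sub>R v) *v w) = \<gamma> u *v (spin_exp u v (- t) *v w)"
    and "spin_exp u v (- t) *v (\<gamma> (cos t *\<^sub>R v - sin t *\<^sub>R u) *v w) = \<gamma> v *v (spin_exp u v (- t) *v w)"
proof -
  have o: "v \<bullet> u = 0" "u \<bullet> u = 1" "v \<bullet> v = 1" "u \<bullet> v = 0"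
    using assms by (auto simp: orthonormal2_def inner_commute norm_eq_1)
  have sc: "cos t * cos t + sin t * sin t = 1"
    using sin_cos_squared_add[of t] by (simp add: power2_eq_square)
  have "plane_rot u v (- t) (cos t *\<^sub>R u + sin t *\<^sub>R v) = (cos t * cos t + sin t * sin t) *\<^sub>R u"
    "plane_rot u v (- t) (cos t *\<^sub>R v - sin t *\<^sub>R u) = (cos t * cos t + sin t * sin t) *\<^sub>R v"
    by (simp_all add: plane_rot_def inner_simps o algebra_simps)
  then show "spin_exp u v (- t) *v (\<gamma> (cos t *\<^sub>R u + sin t *\<^sub>R v) *v w) = \<gamma> u *v (spin_exp u v (- t) *v w)"
    and "spin_exp u v (- t) *v (\<gamma> (cos t *\<^sub>R v - sin t *\<^sub>R u) *v w) = \<gamma> v *v (spin_exp u v (- t) *v w)"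
    by (simp_all add: spin_exp_gamma[OF assms] sc)
qed

text \<open>The lift of the unitary rotation taking \<open>x\<close> to \<open>cos t x + sin t Z\<close>, inverted. In the moving frame
  it defines, the equation along a horizontal great circle has constant coefficients.\<close>

definition unitary_back :: "complex^'n \<Rightarrow> complex^'n \<Rightarrow> real \<Rightarrow> complex^'w \<Rightarrow> complex^'w" where
  "unitary_back x Z t w = spin_exp (xi x) (xi Z) (- t) *v (spin_exp x Z (- t) *v w)"

lemma unitary_back_gamma:
  assumes Z: "Z \<in> horQ x" "norm x = 1" "norm Z = 1"
    and x': "x' = cos t *\<^sub>R x + sin t *\<^sub>R Z" and Z': "Z' = cos t *\<^sub>R Z - sin t *\<^sub>R x"
  shows "unitary_back x Z t (\<gamma> x' *v w) = \<gamma> x *v unitary_back x Z t w"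
    "unitary_back x Z t (\<gamma> Z' *v w) = \<gamma> Z *v unitary_back x Z t w"
    "unitary_back x Z t (\<gamma> (xi x') *v w) = \<gamma> (xi x) *v unitary_back x Z t w"
    "unitary_back x Z t (\<gamma> (xi Z') *v w) = \<gamma> (xi Z) *v unitary_back x Z t w"
    "W \<bullet> x = 0 \<Longrightarrow> W \<bullet> Z = 0 \<Longrightarrow> W \<bullet> xi x = 0 \<Longrightarrow> W \<bullet> xi Z = 0 \<Longrightarrow>
      unitary_back x Z t (\<gamma> W *v w) = \<gamma> W *v unitary_back x Z t w"
proof -
  note o = horQ_orthonormal2[OF Z] and h = horQ_orthogonal[OF Z(1)] and i = inner_xi_self
  have xi': "xi x' = cos t *\<^sub>R xi x + sin t *\<^sub>R xi Z" "xi Z' = cos t *\<^sub>R xi Z - sin t *\<^sub>R xi x"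
    by (simp_all add: x' Z' xi_simps)
  have o': "xi x' \<bullet> x = 0" "xi x' \<bullet> Z = 0" "xi Z' \<bullet> x = 0" "xi Z' \<bullet> Z = 0"
    by (simp_all add: xi' inner_simps h i)
  show "unitary_back x Z t (\<gamma> x' *v w) = \<gamma> x *v unitary_back x Z t w"
    "unitary_back x Z t (\<gamma> Z' *v w) = \<gamma> Z *v unitary_back x Z t w"
    by (simp_all add: unitary_back_def x' Z' spin_exp_gamma_back[OF o(1)]
        spin_exp_gamma_orthogonal[OF o(2)] h i)
  show "unitary_back x Z t (\<gamma> (xi x') *v w) = \<gamma> (xi x) *v unitary_back x Z t w"
    "unitary_back x Z t (\<gamma> (xi Z') *v w) = \<gamma> (xi Z) *v unitary_back x Z t w"
    by (simp_all only: unitary_back_def spin_exp_gamma_orthogonal[OF o(1)] o')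
      (simp_all only: xi' spin_exp_gamma_back[OF o(2)])
  show "W \<bullet> x = 0 \<Longrightarrow> W \<bullet> Z = 0 \<Longrightarrow> W \<bullet> xi x = 0 \<Longrightarrow> W \<bullet> xi Z = 0 \<Longrightarrow>
      unitary_back x Z t (\<gamma> W *v w) = \<gamma> W *v unitary_back x Z t w"
    by (simp add: unitary_back_def spin_exp_gamma_orthogonal o)
qed

lemma unitary_back_linear:
  "unitary_back x Z t (v + w) = unitary_back x Z t v + unitary_back x Z t w"
  "unitary_back x Z t (c *s w) = c *s unitary_back x Z t w"
  "unitary_back x Z t (r *\<^sub>R w) = r *\<^sub>R unitary_back x Z t w"
  by (simp_all add: unitary_back_def mv_simps)

text \<open>The derivatives of the two rotations cancel the first two terms of
  \<open>horizontal_derivative\<close>, and the \<beta>-term becomes the fixed operator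
  \<open>\<xi> Z\<close>, which squares to \<open>- 1\<close>.\<close>

lemma horizontal_transport:
  assumes \<psi>: "trans_killing_spinor \<gamma> e \<Sigma> \<alpha> \<beta> \<psi>" and Z: "Z \<in> horQ x" "norm x = 1" "norm Z = 1"
  shows "unitary_back x Z t (sphere_map \<psi> (cos t *\<^sub>R x + sin t *\<^sub>R Z)) =
    cos (\<beta> * of_real t) *s sphere_map \<psi> x + sin (\<beta> * of_real t) *s (\<gamma> (xi x) *v (\<gamma> Z *v sphere_map \<psi> x))"
proof -
  note o = horQ_orthonormal2[OF Z] and h = horQ_orthogonal[OF Z(1)] and i = inner_xi_self
  define G where "G t = sphere_map \<psi> (cos t *\<^sub>R x + sin t *\<^sub>R Z)" for t
  define U where "U t = unitary_back x Z t (G t)" for t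
  let ?K = "\<gamma> (xi x) ** \<gamma> Z"
  have "(U has_vector_derivative \<beta> *s (?K *v U t)) (at t)" for t
  proof -
    let ?x' = "cos t *\<^sub>R x + sin t *\<^sub>R Z" and ?Z' = "cos t *\<^sub>R Z - sin t *\<^sub>R x"
    let ?D = "(1/2) *\<^sub>R (\<gamma> x *v (\<gamma> Z *v G t)) + (1/2) *\<^sub>R (\<gamma> (xi x) *v (\<gamma> (xi Z) *v G t)) +
      \<beta> *s (\<gamma> (xi ?x') *v (\<gamma> ?Z' *v G t))"
    let ?E = "\<lambda>t. spin_exp x Z (- 1 * t)" and ?E' = "\<lambda>t. spin_exp (xi x) (xi Z) (- 1 * t)"
    have G: "(G has_vector_derivative ?D) (at t)"
      unfolding G_def by (rule horizontal_derivative[OF \<psi> Z])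
    have "((\<lambda>t. ?E' t *v (?E t *v G t)) has_vector_derivative
        ?E' t *v (?E t *v ?D + ((- 1/2) *\<^sub>R (\<gamma> x ** \<gamma> Z ** ?E t)) *v G t) +
        ((- 1/2) *\<^sub>R (\<gamma> (xi x) ** \<gamma> (xi Z) ** ?E' t)) *v (?E t *v G t)) (at t)"
      by (intro has_vector_derivative_mv spin_exp_has_derivative o G)
    moreover have "?E' t *v (?E t *v ?D + ((- 1/2) *\<^sub>R (\<gamma> x ** \<gamma> Z ** ?E t)) *v G t) +
        ((- 1/2) *\<^sub>R (\<gamma> (xi x) ** \<gamma> (xi Z) ** ?E' t)) *v (?E t *v G t) = \<beta> *s (?K *v U t)"
    proof -
      have EP: "?E t *v (\<gamma> x *v (\<gamma> Z *v w)) = \<gamma> x *v (\<gamma> Z *v (?E t *v w))" for w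
        by (simp add: spin_exp_mv mv_simps)
      have EQ: "?E' t *v (\<gamma> (xi x) *v (\<gamma> (xi Z) *v w)) = \<gamma> (xi x) *v (\<gamma> (xi Z) *v (?E' t *v w))" for w
        by (simp add: spin_exp_mv mv_simps)
      have "unitary_back x Z t (\<gamma> (xi ?x') *v (\<gamma> ?Z' *v G t)) = ?K *v U t"
        by (simp only: unitary_back_gamma[OF Z refl refl] U_def mm_mv)
      then have "?E' t *v (?E t *v (\<gamma> (xi ?x') *v (\<gamma> ?Z' *v G t))) = ?K *v U t"
        by (simp add: unitary_back_def)
      then show ?thesis
        by (simp only: vec.add mv_scaleR scaleR_mv vector_scalar_commute mm_mv EP EQ
            spin_exp_gamma_orthogonal[OF o(1)] spin_exp_gamma_orthogonal[OF o(2)] h i)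
          (simp add: spin_exp_gamma_orthogonal[OF o(2)] h i)
    qed
    ultimately show ?thesis by (simp add: U_def[abs_def] unitary_back_def)
  qed
  moreover have "?K *v (?K *v w) = - w" for w
    using gamma_gamma_square[of "xi x" Z] Z h by (simp add: mm_mv orthonormal2_def norm_xi)
  ultimately have "U t = cos (\<beta> * of_real t) *s U 0 + sin (\<beta> * of_real t) *s (?K *v U 0)"
    by (rule rotation_ODE)
  then show ?thesis by (simp add: U_def G_def unitary_back_def spin_exp_0 mm_mv)
qed

section \<open>Comparison of the great circles to the antipode\<close>

lemma ex_orthogonal_unit:
  fixes S :: "(complex^'n) set"
  assumes "finite S" "card S \<le> k" "k < 2 * (m + 1)"
  obtains Z where "norm Z = 1" "\<And>y. y \<in> S \<Longrightarrow> Z \<bullet> y = 0"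
proof -
  have "dim S < DIM(complex^'n)"
    using dim_le_card'[OF assms(1)] assms(2,3) card_n by simp
  then obtain y where "y \<noteq> 0" "\<And>z. z \<in> span S \<Longrightarrow> orthogonal y z"
    using orthogonal_to_subspace_exists by blast
  then show thesis
    by (intro that[of "sgn y"]) (auto simp: norm_sgn sgn_div_norm orthogonal_def span_base)
qed

lemma ex_horQ:
  obtains Z where "Z \<in> horQ (x :: complex^'n)" "norm Z = 1"
proof -
  have "card {x, xi x} \<le> 2" by (simp add: card_insert_if)
  then obtain Z where "norm Z = 1" "\<And>y. y \<in> {x, xi x} \<Longrightarrow> Z \<bullet> y = 0"
    using m1 by (elim ex_orthogonal_unit[rotated]) auto
  then show thesis by (intro that[of Z]) (auto simp: horQ_def)
qed

text \<open>At \<open>t = pi\<close> the half angles are right angles, so both inverse rotations are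
  minus their bivectors and the signs cancel.\<close>

lemma antipode:
  assumes \<psi>: "trans_killing_spinor \<gamma> e \<Sigma> \<alpha> \<beta> \<psi>" and Z: "Z \<in> horQ x" "norm x = 1" "norm Z = 1"
  shows "\<gamma> (xi x) *v (\<gamma> (xi Z) *v (\<gamma> x *v (\<gamma> Z *v sphere_map \<psi> (- x)))) =
    cos (\<beta> * of_real pi) *s sphere_map \<psi> x +
    sin (\<beta> * of_real pi) *s (\<gamma> (xi x) *v (\<gamma> Z *v sphere_map \<psi> x))"
  using horizontal_transport[OF \<psi> Z, of pi]
  by (simp add: unitary_back_def spin_exp_mv mv_simps)

text \<open>Replacing \<open>Z\<close> by \<open>- Z\<close> changes the sign of the sine term in
  \<open>antipode\<close> and of nothing else.\<close>

lemma sin_beta_pi: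
  assumes \<psi>: "trans_killing_spinor \<gamma> e \<Sigma> \<alpha> \<beta> \<psi>" and nz: "\<psi> \<noteq> (\<lambda>_. 0)"
  shows "sin (\<beta> * of_real pi) = 0"
proof -
  have "spinor_field \<gamma> e \<Sigma> \<psi>" using \<psi> by (simp add: trans_killing_spinor_def)
  then obtain x where x: "norm x = 1" "sphere_map \<psi> x \<noteq> 0"
    using sphere_map_nonzero nz by blast
  obtain Z where Z: "Z \<in> horQ x" "norm Z = 1" using ex_horQ by blast
  have Z': "- Z \<in> horQ x" "norm (- Z) = 1" using Z by (auto simp: horQ_def)
  let ?K = "\<gamma> (xi x) *v (\<gamma> Z *v sphere_map \<psi> x)"
  have "sin (\<beta> * of_real pi) *s ?K = - (sin (\<beta> * of_real pi) *s ?K)"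
    using antipode[OF \<psi> Z(1) x(1) Z(2)] antipode[OF \<psi> Z'(1) x(1) Z'(2)]
    by (simp add: gamma_simps xi_simps mv_simps)
  then have "sin (\<beta> * of_real pi) *s ?K = 0" by (simp add: vec_eq_iff)
  moreover have "?K \<noteq> 0" using x Z by (auto simp: gamma_eq_0 norm_xi simp flip: norm_eq_zero[of "xi x"])
  ultimately show ?thesis by simp
qed

text \<open>All horizontal complex lines act on \<open>w\<close> by the same bivector operator; this
  is how a spinor with components in the two extreme eigenbundles only is expressed.\<close>

definition balanced :: "complex^'n \<Rightarrow> complex^'w \<Rightarrow> bool" where
  "balanced x w \<longleftrightarrow> (\<forall>Z\<in>horQ x. \<forall>Z'\<in>horQ x. norm Z = 1 \<longrightarrow> norm Z' = 1 \<longrightarrow>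
     \<gamma> Z *v (\<gamma> (xi Z) *v w) = \<gamma> Z' *v (\<gamma> (xi Z') *v w))"

text \<open>The antipode can be reached by a great circle in every horizontal direction \<open>Z\<close>.\<close>

lemma sphere_map_balanced:
  assumes \<psi>: "trans_killing_spinor \<gamma> e \<Sigma> \<alpha> \<beta> \<psi>" and sin: "sin (\<beta> * of_real pi) = 0"
    and x: "norm x = 1"
  shows "balanced x (sphere_map \<psi> x)"
proof -
  have c: "cos (\<beta> * of_real pi) \<noteq> 0" (is "?c \<noteq> 0")
    using sin_cos_squared_add[of "\<beta> * of_real pi"] sin by auto
  have *: "?c *s (\<gamma> Z *v (\<gamma> (xi Z) *v sphere_map \<psi> x)) = \<gamma> x *v (\<gamma> (xi x) *v sphere_map \<psi> (- x))"
    if Z: "Z \<in> horQ x" "norm Z = 1" for Z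
  proof -
    note h = horQ_orthogonal[OF Z(1)]
    have "?c *s (\<gamma> Z *v (\<gamma> (xi Z) *v sphere_map \<psi> x)) =
      \<gamma> Z *v (\<gamma> (xi Z) *v (\<gamma> (xi x) *v (\<gamma> (xi Z) *v (\<gamma> x *v (\<gamma> Z *v sphere_map \<psi> (- x))))))"
      by (simp add: antipode[OF \<psi> Z(1) x Z(2)] sin mv_simps)
    also have "\<dots> = \<gamma> x *v (\<gamma> (xi x) *v sphere_map \<psi> (- x))"
      using Z x by (simp add: gamma_anti0[of "xi Z" "xi x"] gamma_anti0[of Z "xi x"] gamma_anti0[of Z x]
          gamma_anti0[of "xi x" x] inner_xi_self h mv_simps gamma_sq1 norm_xi)
    finally show ?thesis .
  qed
  show ?thesis
    unfolding balanced_def using *[symmetric] c by (metis vec.scale_cancel_left)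
qed

text \<open>The projection to the eigenvalue \<open>s i\<close> of the bivector of one chosen
  horizontal complex line. On balanced spinors every choice gives the same result.\<close>

definition part :: "complex \<Rightarrow> complex^'n \<Rightarrow> complex^'w \<Rightarrow> complex^'w" where
  "part s x w = (let Z = SOME Z. Z \<in> horQ x \<and> norm Z = 1
    in (1/2) *s (w - (s * \<i>) *s (\<gamma> Z *v (\<gamma> (xi Z) *v w))))"

lemma part_def':
  obtains Z where "Z \<in> horQ x" "norm Z = 1"
    "\<And>s w. part s x w = (1/2) *s (w - (s * \<i>) *s (\<gamma> Z *v (\<gamma> (xi Z) *v w)))"
proof -
  let ?Z = "SOME Z. Z \<in> horQ x \<and> norm Z = 1"
  obtain Z where "Z \<in> horQ x" "norm Z = 1" using ex_horQ by blast
  then have "?Z \<in> horQ x \<and> norm ?Z = 1" by (intro someI[of "\<lambda>Z. Z \<in> horQ x \<and> norm Z = 1"]) auto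
  then show thesis by (intro that[of ?Z]) (auto simp: part_def Let_def)
qed

lemma pure_gamma_gamma:
  "pure s x w \<Longrightarrow> Z \<in> horQ x \<Longrightarrow> norm Z = 1 \<Longrightarrow> \<gamma> Z *v (\<gamma> (xi Z) *v w) = (s * \<i>) *s w"
  by (simp add: pureD mv_simps gamma_sq1)

lemma pureI:
  assumes "\<And>Z. Z \<in> horQ x \<Longrightarrow> norm Z = 1 \<Longrightarrow> \<gamma> Z *v (\<gamma> (xi Z) *v w) = (s * \<i>) *s w"
  shows "pure s x w"
  unfolding pure_def
proof
  fix Z assume Z: "Z \<in> horQ x"
  show "\<gamma> (xi Z) *v w = (- s * \<i>) *s (\<gamma> Z *v w)"
  proof (cases "Z = 0")
    case False
    define Y where "Y = sgn Z"
    have Y: "Y \<in> horQ x" "norm Y = 1" and ZY: "Z = norm Z *\<^sub>R Y"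
      using Z False by (auto simp: Y_def horQ_def norm_sgn sgn_div_norm)
    have "\<gamma> Y *v (\<gamma> Y *v (\<gamma> (xi Y) *v w)) = (s * \<i>) *s (\<gamma> Y *v w)"
      by (simp add: assms Y mv_simps)
    then have "- (- (\<gamma> (xi Y) *v w)) = - ((s * \<i>) *s (\<gamma> Y *v w))" by (simp add: gamma_sq1 Y)
    then have "\<gamma> (xi Y) *v w = (- s * \<i>) *s (\<gamma> Y *v w)" by simp
    then show ?thesis
      by (subst (1 2) ZY) (simp add: xi_simps gamma_simps smult_scaleR)
  qed (simp add: gamma_simps xi_simps)
qed

lemma part_pure:
  assumes "balanced x w" "s * s = 1" shows "pure s x (part s x w)"
proof (rule pureI)
  fix Z' assume Z': "Z' \<in> horQ x" "norm Z' = 1"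
  obtain Z where Z: "Z \<in> horQ x" "norm Z = 1"
    "part s x w = (1/2) *s (w - (s * \<i>) *s (\<gamma> Z *v (\<gamma> (xi Z) *v w)))"
    using part_def' by metis
  have o: "orthonormal2 Z' (xi Z')" using Z' by (simp add: orthonormal2_def norm_xi inner_xi_self)
  have *: "\<gamma> Z *v (\<gamma> (xi Z) *v w) = \<gamma> Z' *v (\<gamma> (xi Z') *v w)"
    using assms(1) Z(1,2) Z' unfolding balanced_def by blast
  have "s * \<i> * (s * \<i>) = - 1" using assms(2) by (simp add: algebra_simps)
  then show "\<gamma> Z' *v (\<gamma> (xi Z') *v part s x w) = (s * \<i>) *s part s x w"
    unfolding Z(3) * by (simp add: mv_simps gamma_gamma_square[OF o] vec.scale_right_diff_distrib)
qed

lemma part_add: "part s x (v + w) = part s x v + part s x w"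
  by (simp add: part_def Let_def mv_simps vec.scale_right_distrib vec.scale_right_diff_distrib)

lemma part_sum: "part (- 1) x w + part 1 x w = w"
  by (simp add: part_def Let_def vec_eq_iff)

lemma part_Sigma: "w \<in> \<Sigma> \<Longrightarrow> part s x w \<in> \<Sigma>"
  by (simp add: part_def Let_def Sigma_closed Sigma_even)

lemma part_of_pure:
  assumes "pure s x w" "s * s = 1"
  shows "part s x w = w" "part (- s) x w = 0"
proof -
  obtain Z where Z: "Z \<in> horQ x" "norm Z = 1"
    "\<And>s w. part s x w = (1/2) *s (w - (s * \<i>) *s (\<gamma> Z *v (\<gamma> (xi Z) *v w)))"
    using part_def' by metis
  have "s * \<i> * (s * \<i>) = - 1" using assms(2) by (simp add: algebra_simps)
  then show "part s x w = w" "part (- s) x w = 0"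
    by (simp_all add: Z(3) pure_gamma_gamma[OF assms(1) Z(1,2)] vec_eq_iff flip: mult.assoc)
qed

lemma pure_sum_unique:
  assumes "pure (- 1) x a" "pure 1 x b" "pure (- 1) x a'" "pure 1 x b'" "a + b = a' + b'"
  shows "a = a'" "b = b'"
proof -
  have "part (- 1) x (a + b) = part (- 1) x (a' + b')" "part 1 x (a + b) = part 1 x (a' + b')"
    using assms(5) by simp_all
  then show "a = a'" "b = b'"
    using part_of_pure[OF assms(1)] part_of_pure[OF assms(2)] part_of_pure[OF assms(3)]
      part_of_pure[OF assms(4)] by (auto simp: part_add)
qed

lemma pure_smult: "pure s x w \<Longrightarrow> pure s x (c *s w)"
  by (simp add: pure_def mv_simps mult_ac)

lemma Omega_cmult_add: "Omega_cmult \<gamma> e p (v + w) = Omega_cmult \<gamma> e p v + Omega_cmult \<gamma> e p w"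
  by (simp add: Omega_cmult_def cmult_def mv_simps scaleR_add_right sum.distrib)

text \<open>The bivector \<open>x \<xi>\<close> is constant along the Hopf circle. Its coefficient
  \<open>1/2\<close> is due to the trivialization, and \<Omega> acts by \<open>- i m\<close> and
  \<open>i m\<close> on the two pure components.\<close>

lemma hopf_derivative:
  assumes \<psi>: "trans_killing_spinor \<gamma> e \<Sigma> \<alpha> \<beta> \<psi>" and x: "norm x = 1"
    and x': "x' = cos t *\<^sub>R x + sin t *\<^sub>R xi x"
    and F: "sphere_map \<psi> x' = a + b" and pure: "pure (- 1) x' a" "pure 1 x' b"
  shows "((\<lambda>t. sphere_map \<psi> (cos t *\<^sub>R x + sin t *\<^sub>R xi x)) has_vector_derivative
    (1/2 + \<alpha>) *s (\<gamma> x *v (\<gamma> (xi x) *v (a + b))) + (\<i> * of_nat m / 2) *s (b - a)) (at t)"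
proof -
  have field: "spinor_field \<gamma> e \<Sigma> \<psi>" using \<psi> by (simp add: trans_killing_spinor_def)
  have o: "orthonormal2 x (xi x)" using x by (simp add: orthonormal2_def norm_xi inner_xi_self)
  have xx': "xi x' = cos t *\<^sub>R xi x - sin t *\<^sub>R x" by (simp add: x' xi_simps)
  note pl = spin_exp_plane[OF o x' xx']
  have nx': "norm x' = 1" using pl(3) by (simp add: orthonormal2_def)
  obtain q where q: "q \<in> Spin \<gamma>" "spin_rot \<gamma> q e = x'" using Spin_transitive[OF nx'] by blast
  have qF: "q *v \<psi> q = a + b" using sphere_map[OF field q(1)] q(2) F by simp
  then have \<psi>q: "\<psi> q = matrix_inv q *v a + matrix_inv q *v b"
    by (metis Spin_inv_mv(2)[OF q(1)] vec.add)
  have "Omega_cmult \<gamma> e q (matrix_inv q *v a) = (- 1 * \<i> * of_nat m) *s (matrix_inv q *v a)"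
    "Omega_cmult \<gamma> e q (matrix_inv q *v b) = (1 * \<i> * of_nat m) *s (matrix_inv q *v b)"
    by (rule Omega_cmult_pure[OF q(1)], simp add: q(2) Spin_inv_mv[OF q(1)] pure)+
  then have Om: "q *v Omega_cmult \<gamma> e q (\<psi> q) = (\<i> * of_nat m) *s (b - a)"
    by (simp add: \<psi>q Omega_cmult_add mv_simps Spin_inv_mv[OF q(1)] vec.scale_right_diff_distrib)
  have "q *v spin_cov \<gamma> e 1 \<psi> q (xi x') =
      (1/2) *\<^sub>R (q *v Omega_cmult \<gamma> e q (\<psi> q)) + \<alpha> *s (\<gamma> x' *v (\<gamma> (xi x') *v (q *v \<psi> q)))"
    using \<psi> q(1) unfolding trans_killing_spinor_iff q(2)[symmetric] by blast
  then have "q *v spin_cov \<gamma> e 1 \<psi> q (xi x') =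
      (1/2) *\<^sub>R ((\<i> * of_nat m) *s (b - a)) + \<alpha> *s (\<gamma> x *v (\<gamma> (xi x) *v (a + b)))"
    by (simp only: Om qF pl(1))
  moreover have "(1/2) *\<^sub>R (\<gamma> x *v (\<gamma> (xi x) *v (a + b))) + ((1/2) *\<^sub>R ((\<i> * of_nat m) *s (b - a)) +
      \<alpha> *s (\<gamma> x *v (\<gamma> (xi x) *v (a + b)))) =
    (1/2 + \<alpha>) *s (\<gamma> x *v (\<gamma> (xi x) *v (a + b))) + (\<i> * of_nat m / 2) *s (b - a)"
    by (simp add: vec_eq_iff scaleR_conv_of_real[where 'a = complex] algebra_simps)
  ultimately show ?thesis
    using great_circle_derivative[OF field o q(1) q(2)[unfolded x']]
    by (simp only: x'[symmetric] xx'[symmetric] F)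
qed

section \<open>Integrality and vanishing of \<beta>\<close>

lemma beta_integer:
  fixes \<beta> :: complex
  assumes "sin (\<beta> * of_real pi) = 0" obtains n :: int where "\<beta> = of_int n"
proof -
  obtain n :: int where "\<beta> * of_real pi = of_real (of_int n * pi)"
    using assms sin_eq_0[of "\<beta> * of_real pi"] by auto
  then have "\<beta> = of_int n" by simp
  then show thesis by (rule that)
qed

text \<open>After an arc with \<open>\<beta> t = pi/2\<close> the spinor is, in the moving frame,
  \<open>K F\<close> with \<open>K = \<xi> Z\<close>. For a unit vector \<open>W\<close> orthogonal
  to the complex lines of \<open>x\<close> and \<open>Z\<close>, \<open>K\<close> commutes with
  \<open>W xi W\<close> but anticommutes with \<open>Z xi Z\<close>, so \<open>F\<close> and
  \<open>K F\<close> cannot both be balanced.\<close>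

lemma beta_0_if_m_ge_2:
  assumes \<psi>: "trans_killing_spinor \<gamma> e \<Sigma> \<alpha> \<beta> \<psi>" and nz: "\<psi> \<noteq> (\<lambda>_. 0)" and m2: "m \<ge> 2"
  shows "\<beta> = 0"
proof (rule ccontr)
  assume "\<beta> \<noteq> 0"
  have "spinor_field \<gamma> e \<Sigma> \<psi>" using \<psi> by (simp add: trans_killing_spinor_def)
  then obtain x where x: "norm x = 1" and Fx: "sphere_map \<psi> x \<noteq> 0"
    using sphere_map_nonzero nz by blast
  have sin: "sin (\<beta> * of_real pi) = 0" by (rule sin_beta_pi[OF \<psi> nz])
  then obtain n :: int where n: "\<beta> = of_int n" using beta_integer by blast
  define t where "t = pi / (2 * n)"
  have "\<beta> * of_real t = of_real (pi/2)" using n \<open>\<beta> \<noteq> 0\<close> by (simp add: t_def)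
  then have t: "cos (\<beta> * of_real t) = 0" "sin (\<beta> * of_real t) = 1"
    by (simp_all only: cos_of_real sin_of_real) simp_all
  obtain Z where Z: "Z \<in> horQ x" "norm Z = 1" using ex_horQ by blast
  have "card {x, Z, xi x, xi Z} \<le> 4" by (simp add: card_insert_if)
  then obtain W where W: "norm W = 1" "\<And>y. y \<in> {x, Z, xi x, xi Z} \<Longrightarrow> W \<bullet> y = 0"
    using m2 by (elim ex_orthogonal_unit[rotated]) auto
  note h = horQ_orthogonal[OF Z(1)]
  have o: "W \<bullet> x = 0" "W \<bullet> Z = 0" "W \<bullet> xi x = 0" "W \<bullet> xi Z = 0"
    "xi W \<bullet> x = 0" "xi W \<bullet> Z = 0" "xi W \<bullet> xi x = 0" "xi W \<bullet> xi Z = 0"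
    using W(2) by (auto simp: inner_xi_left inner_xi_xi xi_simps)
  let ?x' = "cos t *\<^sub>R x + sin t *\<^sub>R Z" and ?Z' = "cos t *\<^sub>R Z - sin t *\<^sub>R x"
  let ?U = "unitary_back x Z t" and ?F' = "sphere_map \<psi> ?x'" and ?F = "sphere_map \<psi> x"
  let ?K = "\<gamma> (xi x) *v (\<gamma> Z *v ?F)"
  have rot: "?Z' \<in> horQ ?x'" "norm ?x' = 1" "norm ?Z' = 1"
    using horQ_rotate[OF Z(1) x Z(2)] by auto
  have W': "W \<in> horQ ?x'" using o by (simp add: horQ_def inner_simps xi_simps)
  have Wx: "W \<in> horQ x" using o by (simp add: horQ_def)
  have U: "?U ?F' = ?K" using horizontal_transport[OF \<psi> Z(1) x Z(2), of t] t by simp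
  have "\<gamma> W *v (\<gamma> (xi W) *v ?F') = \<gamma> ?Z' *v (\<gamma> (xi ?Z') *v ?F')"
    using sphere_map_balanced[OF \<psi> sin rot(2)] W' W(1) rot(1,3) unfolding balanced_def by blast
  then have "?U (\<gamma> W *v (\<gamma> (xi W) *v ?F')) = ?U (\<gamma> ?Z' *v (\<gamma> (xi ?Z') *v ?F'))" by simp
  then have *: "\<gamma> W *v (\<gamma> (xi W) *v ?K) = \<gamma> Z *v (\<gamma> (xi Z) *v ?K)"
    by (simp only: unitary_back_gamma[OF Z(1) x Z(2) refl refl] o U)
  have bal: "\<gamma> W *v (\<gamma> (xi W) *v ?F) = \<gamma> Z *v (\<gamma> (xi Z) *v ?F)" (is "_ = ?G")
    using sphere_map_balanced[OF \<psi> sin x] Wx Z W(1) unfolding balanced_def by blast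
  have "\<gamma> W *v (\<gamma> (xi W) *v ?K) = \<gamma> (xi x) *v (\<gamma> Z *v (\<gamma> W *v (\<gamma> (xi W) *v ?F)))"
    by (simp add: gamma_anti0[of "xi W" "xi x"] gamma_anti0[of "xi W" Z] gamma_anti0[of W "xi x"]
        gamma_anti0[of W Z] o mv_simps)
  moreover have "\<gamma> Z *v (\<gamma> (xi Z) *v ?K) = - (\<gamma> (xi x) *v (\<gamma> Z *v ?G))"
    by (simp add: gamma_anti0[of "xi Z" "xi x"] gamma_anti0[of "xi Z" Z] gamma_anti0[of Z "xi x"]
        inner_xi_self h mv_simps)
  ultimately have "\<gamma> (xi x) *v (\<gamma> Z *v ?G) = - (\<gamma> (xi x) *v (\<gamma> Z *v ?G))"
    using * bal by simp
  then have "\<gamma> (xi x) *v (\<gamma> Z *v ?G) = 0" by (simp add: vec_eq_iff)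
  then show False
    using Fx x Z(2) norm_xi[of x] norm_xi[of Z] by (auto simp: gamma_eq_0)
qed

section \<open>Classification for \<open>\<beta> = 0\<close>\<close>

text \<open>The two bivectors commute; if they act oppositely on \<open>w\<close>, the two
  half-angle rotations cancel.\<close>

lemma unitary_back_id:
  assumes Z: "Z \<in> horQ x" "norm x = 1" "norm Z = 1"
    and PQ: "\<gamma> (xi x) *v (\<gamma> (xi Z) *v w) = - (\<gamma> x *v (\<gamma> Z *v w))"
  shows "unitary_back x Z t w = w"
proof -
  note h = horQ_orthogonal[OF Z(1)] and i = inner_xi_self
  have sc: "cos (t/2) * cos (t/2) + sin (t/2) * sin (t/2) = 1"
    using sin_cos_squared_add[of "t/2"] by (simp add: power2_eq_square)
  have "\<gamma> (xi x) *v (\<gamma> (xi Z) *v (\<gamma> x *v (\<gamma> Z *v w))) = \<gamma> x *v (\<gamma> Z *v (\<gamma> (xi x) *v (\<gamma> (xi Z) *v w)))"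
    by (simp add: gamma_anti0[of "xi Z" x] gamma_anti0[of "xi Z" Z] gamma_anti0[of "xi x" x]
        gamma_anti0[of "xi x" Z] h i mv_simps)
  also have "\<dots> = w" using Z by (simp add: PQ mv_simps gamma_anti0[of Z x] h gamma_sq1)
  finally have "unitary_back x Z t w = (cos (t/2) * cos (t/2)) *\<^sub>R w + (sin (t/2) * sin (t/2)) *\<^sub>R w"
    by (simp add: unitary_back_def spin_exp_mv mv_simps PQ algebra_simps)
  then show ?thesis by (simp only: sc scaleR_one flip: scaleR_left_distrib)
qed

text \<open>The rotation is special unitary, and the special unitary group fixes the vacua.\<close>

lemma vacua_unitary_back:
  assumes Z: "Z \<in> horQ x" "norm x = 1" "norm Z = 1" and w: "w \<in> vacua s" and s: "s * s = 1"
  shows "unitary_back x Z t w = w"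
proof (rule unitary_back_id[OF Z])
  note h = horQ_orthogonal[OF Z(1)]
  have "s * \<i> * (s * \<i>) = - 1" using s by (simp add: algebra_simps)
  then have "\<gamma> (xi x) *v (\<gamma> (xi Z) *v w) = \<gamma> Z *v (\<gamma> x *v w)"
    by (simp add: vacuaD[OF w] mv_simps gamma_anti0[of "xi x" Z] h)
  then show "\<gamma> (xi x) *v (\<gamma> (xi Z) *v w) = - (\<gamma> x *v (\<gamma> Z *v w))"
    by (simp add: gamma_anti0[of Z x] h)
qed

text \<open>Two points of a complex line are connected by two quarters of horizontal great circles.\<close>

lemma horizontally_constant:
  fixes H :: "complex^'n \<Rightarrow> 'a"
  assumes H: "\<And>x Z t. norm x = 1 \<Longrightarrow> norm Z = 1 \<Longrightarrow> Z \<in> horQ x \<Longrightarrow> H (cos t *\<^sub>R x + sin t *\<^sub>R Z) = H x"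
    and x: "norm x = 1" and y: "norm y = 1"
  shows "H y = H x"
proof -
  obtain r a where ra: "y \<bullet> x = r * cos a" "y \<bullet> xi x = r * sin a" using polar_Ex by metis
  define x' where "x' = cos a *\<^sub>R x + sin a *\<^sub>R xi x"
  have xx: "x \<bullet> x = 1" "xi x \<bullet> xi x = 1" using x by (auto simp: norm_eq_1 inner_xi_xi)
  have sc: "cos a * cos a + sin a * sin a = 1"
    using sin_cos_squared_add[of a] by (simp add: power2_eq_square)
  have x': "norm x' = 1" using sc by (simp add: x'_def norm_eq_1 inner_simps xx inner_xi_self)
  have hor: "Z \<in> horQ x'" if "Z \<in> horQ x" for Z
    using that by (simp add: x'_def horQ_def inner_simps xi_simps)
  have quarter: "H Z = H x" if "norm x = 1" "norm Z = 1" "Z \<in> horQ x" for x Z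
    using H[OF that, of "pi/2"] by simp
  obtain W where W: "W \<in> horQ x" "norm W = 1" using ex_horQ by blast
  \<comment> \<open>\<open>W\<close> is horizontal in \<open>x\<close> and in \<open>x'\<close>, and
    the quarter circles from both points in this direction end in \<open>W\<close>.\<close>
  have Hx': "H x' = H x" using quarter[OF x W(2,1)] quarter[OF x' W(2) hor[OF W(1)]] by simp
  define Y where "Y = projQ x y"
  have Y: "Y \<in> horQ x" unfolding Y_def by (rule projQ_horQ[OF x])
  have yY: "y = r *\<^sub>R x' + Y" by (simp add: Y_def projQ_def ra x'_def algebra_simps)
  define Z where "Z = (if Y = 0 then W else sgn Y)"
  have Z: "Z \<in> horQ x" "norm Z = 1" and YZ: "Y = norm Y *\<^sub>R Z"
    using Y W by (auto simp: Z_def horQ_def norm_sgn sgn_div_norm)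
  have "y \<bullet> y = r\<^sup>2 + (norm Y)\<^sup>2"
    using hor[OF Y] x' unfolding yY
    by (simp add: inner_simps horQ_def norm_eq_1 inner_commute power2_norm_eq_inner power2_eq_square[of r])
  then have "r\<^sup>2 + (norm Y)\<^sup>2 = 1" using y by (simp add: norm_eq_1)
  then obtain t where "r = cos t" "norm Y = sin t" using sincos_total_2pi by metis
  then have "y = cos t *\<^sub>R x' + sin t *\<^sub>R Z" using yY YZ by simp
  then show ?thesis using H[OF x' Z(2) hor[OF Z(1)]] Hx' by simp
qed

text \<open>For \<beta> zero, transport is the identity in the moving frame. That frame fixes vacua,
  so the vacuum components are constant along horizontal circles and hence everywhere; the
  derivative along one Hopf circle then yields \<alpha>.\<close>

lemma classification_beta_0:
  assumes \<psi>: "trans_killing_spinor \<gamma> e \<Sigma> \<alpha> 0 \<psi>"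
  obtains \<omega> \<eta> where "\<omega> \<in> vacua (- 1)" "\<eta> \<in> vacua 1"
    "\<And>x. norm x = 1 \<Longrightarrow> sphere_map \<psi> x = \<omega> + (if odd m then \<eta> else \<gamma> x *v \<eta>)"
    "\<omega> \<noteq> 0 \<Longrightarrow> \<alpha> = - ((of_nat m + 1) / 2)"
    "\<eta> \<noteq> 0 \<Longrightarrow> \<alpha> = (- 1) ^ m * ((of_nat m + 1) / 2)"
proof -
  have field: "spinor_field \<gamma> e \<Sigma> \<psi>" using \<psi> by (simp add: trans_killing_spinor_def)
  define a b where "a x = part (- 1) x (sphere_map \<psi> x)" and "b x = part 1 x (sphere_map \<psi> x)" for x
  \<comment> \<open>For even \<open>m\<close> the upper component is \<open>x\<close> times a
    vacuum, and \<open>- x\<close> is the inverse of \<open>x\<close>.\<close>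
  define top where "top x = (if odd m then b x else - (\<gamma> x *v b x))" for x
  define T where "T x w v = w + (if odd m then v else \<gamma> x *v v)" for x and w v :: "complex^'w"
  have bal: "balanced x (sphere_map \<psi> x)" if "norm x = 1" for x
    using sphere_map_balanced[OF \<psi> _ that] by simp
  have pure: "pure (- 1) x (a x)" "pure 1 x (b x)" if "norm x = 1" for x
    unfolding a_def b_def by (rule part_pure[OF bal[OF that]], simp)+
  have Sig: "a x \<in> \<Sigma>" "b x \<in> \<Sigma>" if "norm x = 1" for x
    unfolding a_def b_def by (rule part_Sigma[OF sphere_map_Sigma[OF field that]])+
  have a: "a x \<in> vacua (- 1)" if x: "norm x = 1" for x
    using gamma_x_xi(1)[OF x Sig(1)[OF x] pure(1)[OF x]] by (intro vacuaI[OF x pure(1)[OF x]]) auto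
  have top: "top x \<in> vacua 1" if x: "norm x = 1" for x
    unfolding top_def
    using gamma_x_xi(2)[OF x Sig(2)[OF x] pure(2)[OF x]]
    by (auto intro!: vacuaI[OF x pure(2)[OF x]] vacuaI_gamma_x[OF x pure(2)[OF x]]
        vec.subspace_neg[OF subspace_vacua])
  have F: "sphere_map \<psi> x = T x (a x) (top x)" if x: "norm x = 1" for x
    using part_sum[of x "sphere_map \<psi> x"] x by (simp add: T_def top_def a_def b_def mv_simps gamma_sq1)
  have pureT: "pure 1 x (if odd m then v else \<gamma> x *v v)" if "norm x = 1" "v \<in> vacua 1" for x v
    using pure_gamma_x[OF that(1) vacua_pure[OF that(2)]] vacua_pure[OF that(2)] by simp
  have unique: "a x = w" "top x = v"
    if x: "norm x = 1" and w: "w \<in> vacua (- 1)" and v: "v \<in> vacua 1" and "sphere_map \<psi> x = T x w v"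
    for x w v
  proof -
    have eq: "a x + (if odd m then top x else \<gamma> x *v top x) = w + (if odd m then v else \<gamma> x *v v)"
      using F[OF x] that(4) by (simp add: T_def)
    note u = pure_sum_unique[OF pure(1)[OF x] pureT[OF x top[OF x]] vacua_pure[OF w] pureT[OF x v] eq]
    show "a x = w" by (rule u(1))
    have "\<gamma> x *v (\<gamma> x *v top x) = \<gamma> x *v (\<gamma> x *v v)" if "even m" using u(2) that by simp
    then show "top x = v" using u(2) by (cases "odd m") (auto simp: gamma_sq1 x)
  qed
  have step: "a (cos t *\<^sub>R x + sin t *\<^sub>R Z) = a x \<and> top (cos t *\<^sub>R x + sin t *\<^sub>R Z) = top x"
    if x: "norm x = 1" and Z: "norm Z = 1" "Z \<in> horQ x" for x Z t
  proof -
    let ?x' = "cos t *\<^sub>R x + sin t *\<^sub>R Z"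
    have x': "norm ?x' = 1" using horQ_rotate[OF Z(2) x Z(1)] by simp
    have "sphere_map \<psi> x = unitary_back x Z t (sphere_map \<psi> ?x')"
      using horizontal_transport[OF \<psi> Z(2) x Z(1), of t] by simp
    also have "\<dots> = T x (a ?x') (top ?x')"
      unfolding F[OF x'] T_def
      using vacua_unitary_back[OF Z(2) x Z(1) a[OF x'], of t] vacua_unitary_back[OF Z(2) x Z(1) top[OF x'], of t]
        unitary_back_gamma(1)[OF Z(2) x Z(1) refl refl, of t]
      by (simp add: unitary_back_linear)
    finally show ?thesis using unique[OF x a[OF x'] top[OF x']] by simp
  qed
  define \<omega> \<eta> where "\<omega> = a e" and "\<eta> = top e"
  have \<omega>: "\<omega> \<in> vacua (- 1)" and \<eta>: "\<eta> \<in> vacua 1" unfolding \<omega>_def \<eta>_def by (rule a top; rule norm_e)+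
  have const: "a x = \<omega>" "top x = \<eta>" if "norm x = 1" for x
    unfolding \<omega>_def \<eta>_def
    using horizontally_constant[of a e x] horizontally_constant[of top e x] step norm_e that by blast+
  have FT: "sphere_map \<psi> x = T x \<omega> \<eta>" if "norm x = 1" for x
    using F[OF that] const[OF that] by simp
  have curve: "norm (cos t *\<^sub>R e + sin t *\<^sub>R xi e) = 1" for t
    using spin_exp_plane(3)[of e "xi e", OF _ refl refl] norm_e
    by (auto simp: orthonormal2_def norm_xi inner_xi_self)
  have "((\<lambda>t. sphere_map \<psi> (cos t *\<^sub>R e + sin t *\<^sub>R xi e)) has_vector_derivative
    (1/2 + \<alpha>) *s (\<gamma> e *v (\<gamma> (xi e) *v (\<omega> + (if odd m then \<eta> else \<gamma> e *v \<eta>)))) +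
    (\<i> * of_nat m / 2) *s ((if odd m then \<eta> else \<gamma> e *v \<eta>) - \<omega>)) (at 0)"
    by (rule hopf_derivative[OF \<psi> norm_e refl _ vacua_pure[OF \<omega>]])
      (use FT[OF norm_e] pureT[OF norm_e \<eta>] in \<open>auto simp: T_def\<close>)
  moreover have "((\<lambda>t. sphere_map \<psi> (cos t *\<^sub>R e + sin t *\<^sub>R xi e)) has_vector_derivative
    (if odd m then 0 else \<gamma> (xi e) *v \<eta>)) (at 0)"
  proof -
    have "((\<lambda>t. cos t *\<^sub>R (\<gamma> e *v \<eta>) + sin t *\<^sub>R (\<gamma> (xi e) *v \<eta>)) has_vector_derivative \<gamma> (xi e) *v \<eta>) (at 0)"
      by (auto intro!: derivative_eq_intros)
    from has_vector_derivative_add[OF has_vector_derivative_const[of \<omega>] this] show ?thesis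
      by (simp add: FT[OF curve] T_def gamma_simps)
  qed
  ultimately have eq: "(1/2 + \<alpha>) *s (\<gamma> e *v (\<gamma> (xi e) *v (\<omega> + (if odd m then \<eta> else \<gamma> e *v \<eta>)))) +
    (\<i> * of_nat m / 2) *s ((if odd m then \<eta> else \<gamma> e *v \<eta>) - \<omega>) = (if odd m then 0 else \<gamma> (xi e) *v \<eta>)"
    by (rule vector_derivative_unique_at)
  have g\<omega>: "\<gamma> e *v (\<gamma> (xi e) *v \<omega>) = - \<i> *s \<omega>"
    using vacuaD[OF \<omega>, of e] norm_e by (simp add: mv_simps gamma_sq1)
  have g\<eta>: "\<gamma> e *v (\<gamma> (xi e) *v \<eta>) = \<i> *s \<eta>" "\<gamma> (xi e) *v \<eta> = - \<i> *s (\<gamma> e *v \<eta>)"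
    using vacuaD[OF \<eta>, of e] norm_e by (simp_all add: mv_simps gamma_sq1)
  have g2: "\<gamma> e *v (\<gamma> (xi e) *v (\<gamma> e *v \<eta>)) = - \<i> *s (\<gamma> e *v \<eta>)"
    using gamma_xXx[OF norm_e, of "xi e" \<eta>] g\<eta>(2) by (simp add: inner_xi_self)
  \<comment> \<open>The coefficients of the two components after everything in \<open>eq\<close> is
    brought to one side. For even \<open>m\<close> the right-hand side adds \<open>i\<close> to
    \<open>B\<close>, and this causes the sign change of \<alpha>.\<close>
  define A B where "A = - \<i> * ((of_nat m + 1) / 2 + \<alpha>)"
    and "B = (if odd m then \<i> * ((of_nat m + 1) / 2 + \<alpha>) else \<i> * ((of_nat m + 1) / 2 - \<alpha>))"
  have "A *s \<omega> + B *s (if odd m then \<eta> else \<gamma> e *v \<eta>) = 0 + 0"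
  proof (cases "odd m")
    case True
    with eq have "(1/2 + \<alpha>) *s (- \<i> *s \<omega> + \<i> *s \<eta>) + (\<i> * of_nat m / 2) *s (\<eta> - \<omega>) = 0"
      by (simp only: if_True not_False_eq_True vec.add g\<omega> g\<eta>(1))
    with True show ?thesis by (simp add: A_def B_def vec_eq_iff algebra_simps add_divide_distrib)
  next
    case False
    with eq have "(1/2 + \<alpha>) *s (- \<i> *s \<omega> + - \<i> *s (\<gamma> e *v \<eta>)) +
        (\<i> * of_nat m / 2) *s (\<gamma> e *v \<eta> - \<omega>) = - \<i> *s (\<gamma> e *v \<eta>)"
      by (simp only: if_False vec.add g\<omega> g2 g\<eta>(2))
    with False show ?thesis
      by (simp add: A_def B_def vec_eq_iff algebra_simps add_divide_distrib diff_divide_distrib)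
  qed
  moreover have "pure s e 0" for s by (simp add: pure_def)
  ultimately have "A *s \<omega> = 0" "B *s (if odd m then \<eta> else \<gamma> e *v \<eta>) = 0"
    using pure_sum_unique[OF pure_smult[OF vacua_pure[OF \<omega>]] pure_smult[OF pureT[OF norm_e \<eta>]]]
    by blast+
  then have "\<omega> \<noteq> 0 \<Longrightarrow> A = 0" "\<eta> \<noteq> 0 \<Longrightarrow> B = 0"
    using norm_e by (auto simp: gamma_eq_0 split: if_splits)
  then have "\<omega> \<noteq> 0 \<Longrightarrow> \<alpha> = - ((of_nat m + 1) / 2)" "\<eta> \<noteq> 0 \<Longrightarrow> \<alpha> = (- 1) ^ m * ((of_nat m + 1) / 2)"
    by (auto simp: A_def B_def add_eq_0_iff add_divide_distrib split: if_splits)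
  with \<omega> \<eta> FT show thesis by (intro that) (auto simp: T_def)
qed

end

section \<open>The three-sphere\<close>

locale sasaki3 = sasaki \<gamma> e m \<Sigma>
  for \<gamma> :: "complex^'n \<Rightarrow> complex^'w^'w" and e m \<Sigma> +
  assumes m_1: "m = 1"
begin

text \<open>A non-zero remainder would be a fifth vector orthogonal to \<open>x\<close>,
  \<open>xi x\<close>, \<open>Z\<close>, \<open>xi Z\<close> in real dimension 4.\<close>

lemma horQ_line:
  fixes x :: "complex^'n"
  assumes x: "norm x = 1" and Z: "Z \<in> horQ x" "norm Z = 1" and W: "W \<in> horQ x"
  shows "W = (W \<bullet> Z) *\<^sub>R Z + (W \<bullet> xi Z) *\<^sub>R xi Z"
proof (rule ccontr)
  assume *: "\<not> ?thesis"
  note h = horQ_orthogonal[OF Z(1)] and hW = horQ_orthogonal[OF W]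
  define V where "V = W - (W \<bullet> Z) *\<^sub>R Z - (W \<bullet> xi Z) *\<^sub>R xi Z"
  have V0: "V \<noteq> 0" using * by (simp add: V_def algebra_simps)
  have n: "x \<bullet> x = 1" "Z \<bullet> Z = 1" "xi x \<bullet> xi x = 1" "xi Z \<bullet> xi Z = 1"
    using x Z by (simp_all add: norm_eq_1 inner_xi_xi)
  have V: "V \<bullet> x = 0" "V \<bullet> xi x = 0" "V \<bullet> Z = 0" "V \<bullet> xi Z = 0"
    by (simp_all add: V_def inner_simps h hW n inner_xi_self)
  let ?S = "{x, xi x, Z, xi Z, V}"
  have neq: "a \<noteq> b" if "a \<bullet> b = 0" "a \<noteq> 0" for a b :: "complex^'n"
    using that by auto
  have nz: "x \<noteq> 0" "xi x \<noteq> 0" "Z \<noteq> 0" "xi Z \<noteq> 0" using n by auto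
  have V': "x \<bullet> V = 0" "xi x \<bullet> V = 0" "Z \<bullet> V = 0" "xi Z \<bullet> V = 0" using V by (simp_all add: inner_commute)
  have card: "card ?S = 5"
    using neq[OF _ nz(1)] neq[OF _ nz(2)] neq[OF _ nz(3)] neq[OF _ nz(4)]
      neq[OF inner_xi_self(1) nz(1)] neq[OF inner_xi_self(1) nz(3)] h V'
    by (simp add: card_insert_if)
  have "pairwise orthogonal ?S"
    by (auto simp: pairwise_def orthogonal_def h V V' inner_xi_self)
  moreover have "0 \<notin> ?S" using nz V0 by auto
  ultimately have "independent ?S" by (rule pairwise_orthogonal_independent)
  then have "card ?S \<le> DIM(complex^'n)" by (rule independent_card_le)
  then show False using card card_n m_1 by simp
qed

text \<open>The bivector \<open>Z xi Z\<close> depends only on the complex line of \<open>Z\<close>,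
  and now there is only one horizontal line.\<close>

lemma balanced_m_1:
  assumes x: "norm x = 1" shows "balanced x w"
  unfolding balanced_def
proof (intro ballI impI)
  fix Z W assume Z: "Z \<in> horQ x" "norm Z = 1" and W: "W \<in> horQ x" "norm W = 1"
  define a b where "a = W \<bullet> Z" and "b = W \<bullet> xi Z"
  have W_eq: "W = a *\<^sub>R Z + b *\<^sub>R xi Z" unfolding a_def b_def by (rule horQ_line[OF x Z W(1)])
  have n: "Z \<bullet> Z = 1" "xi Z \<bullet> xi Z = 1" using Z by (simp_all add: norm_eq_1 inner_xi_xi)
  have "W \<bullet> W = a * a + b * b" by (subst (1 2) W_eq) (simp add: inner_simps n inner_xi_self)
  then have ab: "a * a + b * b = 1" using W by (simp add: norm_eq_1)
  have xiW: "xi W = a *\<^sub>R xi Z + (- b) *\<^sub>R Z" by (subst W_eq) (simp add: xi_simps)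
  have "\<gamma> W *v (\<gamma> (xi W) *v w) = (a * a) *\<^sub>R (\<gamma> Z *v (\<gamma> (xi Z) *v w)) + (b * b) *\<^sub>R (\<gamma> Z *v (\<gamma> (xi Z) *v w))"
    unfolding xiW by (subst W_eq)
      (simp add: gamma_simps mv_simps gamma_sq1 Z norm_xi gamma_anti0[of "xi Z" Z] inner_xi_self algebra_simps)
  then show "\<gamma> Z *v (\<gamma> (xi Z) *v w) = \<gamma> W *v (\<gamma> (xi W) *v w)"
    by (simp only: ab scaleR_one flip: scaleR_left_distrib)
qed

text \<open>In real dimension 4 the bivectors of two orthogonal complex lines agree up to sign on a
  half-spinor space; the normalization fixes the sign, as seen on the two pure components.\<close>

lemma Sigma_xi:
  assumes x: "norm x = 1" and Z: "Z \<in> horQ x" "norm Z = 1" and w: "w \<in> \<Sigma>"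
  shows "\<gamma> Z *v (\<gamma> (xi Z) *v w) = \<gamma> x *v (\<gamma> (xi x) *v w)"
proof -
  define a b where "a = part (- 1) x w" and "b = part 1 x w"
  have pure: "pure (- 1) x a" "pure 1 x b"
    unfolding a_def b_def by (rule part_pure[OF balanced_m_1[OF x]], simp)+
  have "a \<in> \<Sigma>" "b \<in> \<Sigma>" unfolding a_def b_def by (rule part_Sigma[OF w])+
  then have "\<gamma> x *v (\<gamma> (xi x) *v (a + b)) = \<gamma> Z *v (\<gamma> (xi Z) *v (a + b))"
    using gamma_x_xi(1)[OF x _ pure(1)] gamma_x_xi(2)[OF x _ pure(2)]
      pure_gamma_gamma[OF pure(1) Z] pure_gamma_gamma[OF pure(2) Z] m_1
    by (simp add: vec.add)
  then show ?thesis by (simp add: a_def b_def part_sum)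
qed

text \<open>The same duality for the other pairs of complementary planes.\<close>

lemma Sigma_PQ:
  assumes x: "norm x = 1" and Z: "Z \<in> horQ x" "norm Z = 1" and w: "w \<in> \<Sigma>"
  shows "\<gamma> (xi x) *v (\<gamma> (xi Z) *v w) = - (\<gamma> x *v (\<gamma> Z *v w))"
    and "\<gamma> (xi x) *v (\<gamma> Z *v w) = \<gamma> x *v (\<gamma> (xi Z) *v w)"
proof -
  note h = horQ_orthogonal
  have 1: "\<gamma> (xi x) *v (\<gamma> (xi Z) *v w) = - (\<gamma> x *v (\<gamma> Z *v w))" if Z: "Z \<in> horQ x" "norm Z = 1" for Z
  proof -
    have "\<gamma> (xi x) *v (\<gamma> Z *v (\<gamma> Z *v (\<gamma> (xi Z) *v w))) = \<gamma> (xi x) *v (\<gamma> Z *v (\<gamma> x *v (\<gamma> (xi x) *v w)))"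
      by (simp only: Sigma_xi[OF x Z w])
    also have "\<dots> = \<gamma> x *v (\<gamma> Z *v w)"
      by (simp add: gamma_anti0[of "xi x" Z] gamma_anti0[of "xi x" x] gamma_anti0[of Z x]
          h[OF Z(1)] inner_xi_self mv_simps gamma_sq1 norm_xi x)
    finally have "- (- (\<gamma> (xi x) *v (\<gamma> (xi Z) *v w))) = - (\<gamma> x *v (\<gamma> Z *v w))"
      by (simp add: gamma_sq1 Z mv_simps)
    then show ?thesis by simp
  qed
  show "\<gamma> (xi x) *v (\<gamma> (xi Z) *v w) = - (\<gamma> x *v (\<gamma> Z *v w))" by (rule 1[OF Z])
  show "\<gamma> (xi x) *v (\<gamma> Z *v w) = \<gamma> x *v (\<gamma> (xi Z) *v w)"
    using 1[OF horQ_xi[OF Z(1)]] Z(2) by (simp add: norm_xi xi_simps gamma_simps mv_simps)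
qed

lemma Sigma_xi_moved:
  assumes x: "norm x = 1" and Z: "Z \<in> horQ x" "norm Z = 1" and w: "w \<in> \<Sigma>"
    and x': "x' = cos t *\<^sub>R x + sin t *\<^sub>R Z"
  shows "\<gamma> x' *v (\<gamma> (xi x') *v w) = \<gamma> x *v (\<gamma> (xi x) *v w)"
proof -
  note h = horQ_orthogonal[OF Z(1)]
  have sc: "cos t * cos t + sin t * sin t = 1"
    using sin_cos_squared_add[of t] by (simp add: power2_eq_square)
  have "\<gamma> Z *v (\<gamma> (xi x) *v w) = - (\<gamma> x *v (\<gamma> (xi Z) *v w))"
    using Sigma_PQ(2)[OF x Z w] by (simp add: gamma_anti0[of Z "xi x"] h)
  then have "\<gamma> x' *v (\<gamma> (xi x') *v w) = (cos t * cos t) *\<^sub>R (\<gamma> x *v (\<gamma> (xi x) *v w)) +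
      (sin t * sin t) *\<^sub>R (\<gamma> x *v (\<gamma> (xi x) *v w))"
    by (simp add: x' xi_simps gamma_simps mv_simps Sigma_xi[OF x Z w] algebra_simps)
  then show ?thesis by (simp only: sc scaleR_one flip: scaleR_left_distrib)
qed

text \<open>By duality the two rotations in \<open>unitary_back\<close> cancel on all of \<Sigma>,
  so transport needs no moving frame.\<close>

lemma transport3:
  assumes \<psi>: "trans_killing_spinor \<gamma> e \<Sigma> \<alpha> \<beta> \<psi>"
    and x: "norm x = 1" and Z: "Z \<in> horQ x" "norm Z = 1"
  shows "sphere_map \<psi> (cos t *\<^sub>R x + sin t *\<^sub>R Z) = cos (\<beta> * of_real t) *s sphere_map \<psi> x +
    sin (\<beta> * of_real t) *s (\<gamma> (xi x) *v (\<gamma> Z *v sphere_map \<psi> x))"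
proof -
  have field: "spinor_field \<gamma> e \<Sigma> \<psi>" using \<psi> by (simp add: trans_killing_spinor_def)
  have "sphere_map \<psi> (cos t *\<^sub>R x + sin t *\<^sub>R Z) \<in> \<Sigma>"
    by (rule sphere_map_Sigma[OF field]) (use horQ_rotate[OF Z(1) x Z(2)] in auto)
  from unitary_back_id[OF Z(1) x Z(2) Sigma_PQ(1)[OF x Z this]] show ?thesis
    using horizontal_transport[OF \<psi> Z(1) x Z(2), of t] by simp
qed

text \<open>On \<Sigma> half of \<Omega> acts as \<open>1/2\<close> of \<open>x \<xi>\<close>;
  together with the \<open>1/2\<close> of the trivialization this gives the coefficient
  \<open>1 + \<alpha>\<close>.\<close>

lemma hopf_transport3:
  assumes \<psi>: "trans_killing_spinor \<gamma> e \<Sigma> \<alpha> \<beta> \<psi>" and x: "norm x = 1"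
  shows "sphere_map \<psi> (cos t *\<^sub>R x + sin t *\<^sub>R xi x) = cos ((1 + \<alpha>) * of_real t) *s sphere_map \<psi> x +
    sin ((1 + \<alpha>) * of_real t) *s (\<gamma> x *v (\<gamma> (xi x) *v sphere_map \<psi> x))"
proof -
  have field: "spinor_field \<gamma> e \<Sigma> \<psi>" using \<psi> by (simp add: trans_killing_spinor_def)
  define G where "G t = sphere_map \<psi> (cos t *\<^sub>R x + sin t *\<^sub>R xi x)" for t
  let ?I = "\<gamma> x ** \<gamma> (xi x)"
  have o: "orthonormal2 x (xi x)" using x by (simp add: orthonormal2_def norm_xi inner_xi_self)
  have "(G has_vector_derivative (1 + \<alpha>) *s (?I *v G t)) (at t)" for t
  proof -
    let ?x' = "cos t *\<^sub>R x + sin t *\<^sub>R xi x"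
    define a b where "a = part (- 1) ?x' (G t)" and "b = part 1 ?x' (G t)"
    have xx': "xi ?x' = cos t *\<^sub>R xi x - sin t *\<^sub>R x" by (simp add: xi_simps)
    note pl = spin_exp_plane[OF o refl xx']
    have x': "norm ?x' = 1" using pl(3) by (simp add: orthonormal2_def)
    have pure: "pure (- 1) ?x' a" "pure 1 ?x' b"
      unfolding a_def b_def by (rule part_pure[OF balanced_m_1[OF x']], simp)+
    have S: "a \<in> \<Sigma>" "b \<in> \<Sigma>"
      unfolding a_def b_def G_def by (intro part_Sigma sphere_map_Sigma[OF field x'])+
    have ab: "G t = a + b" by (simp add: a_def b_def part_sum)
    have I: "\<gamma> x *v (\<gamma> (xi x) *v a) = - \<i> *s a" "\<gamma> x *v (\<gamma> (xi x) *v b) = \<i> *s b"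
      using gamma_x_xi(1)[OF x' S(1) pure(1)] gamma_x_xi(2)[OF x' S(2) pure(2)] m_1 by (auto simp: pl(1))
    have "(1/2 + \<alpha>) *s (\<gamma> x *v (\<gamma> (xi x) *v (a + b))) + (\<i> * of_nat m / 2) *s (b - a) =
        (1 + \<alpha>) *s (?I *v G t)"
      by (simp add: ab mm_mv vec.add I m_1) (simp add: vec_eq_iff algebra_simps)
    then show ?thesis
      using hopf_derivative[OF \<psi> x refl ab[unfolded G_def] pure] by (simp add: G_def[abs_def])
  qed
  moreover have "?I *v (?I *v w) = - w" for w
    using gamma_gamma_square[OF o] by (simp add: mm_mv)
  ultimately have "G t = cos ((1 + \<alpha>) * of_real t) *s G 0 + sin ((1 + \<alpha>) * of_real t) *s (?I *v G 0)"
    by (rule rotation_ODE)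
  then show ?thesis by (simp add: G_def mm_mv)
qed

lemma cos_sin_derivative_0:
  "((\<lambda>t. cos (c * of_real t) *s v + sin (c * of_real t) *s w) has_vector_derivative c *s (w :: complex^'w)) (at (0::real))"
proof -
  have bl: "bounded_linear (\<lambda>c::complex. c *s (u :: complex^'w))" for u
    by (rule linear_conv_bounded_linear[THEN iffD1])
      (auto simp: linear_iff vec.scale_left_distrib scaleR_conv_of_real[where 'a = complex] scaleR_conv_smult)
  have c: "((\<lambda>t. cos (c * of_real t)) has_vector_derivative 0) (at (0::real))"
    and s: "((\<lambda>t. sin (c * of_real t)) has_vector_derivative c) (at (0::real))"
    by (rule has_vector_derivative_real_field[THEN has_vector_derivative_eq_rhs],
        auto intro!: derivative_eq_intros)+
  show ?thesis
    using has_vector_derivative_add[OF bounded_linear.has_vector_derivative[OF bl[of v] c]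
        bounded_linear.has_vector_derivative[OF bl[of w] s]] by simp
qed

text \<open>Compare a horizontal arc followed by a Hopf arc with the reverse order.\<close>

lemma alpha_0:
  assumes \<psi>: "trans_killing_spinor \<gamma> e \<Sigma> \<alpha> \<beta> \<psi>" and nz: "\<psi> \<noteq> (\<lambda>_. 0)" and \<beta>: "\<beta> \<noteq> 0"
  shows "\<alpha> = 0"
proof -
  have field: "spinor_field \<gamma> e \<Sigma> \<psi>" using \<psi> by (simp add: trans_killing_spinor_def)
  then obtain x where x: "norm x = 1" and Fx: "sphere_map \<psi> x \<noteq> 0"
    using sphere_map_nonzero nz by blast
  obtain n :: int where n: "\<beta> = of_int n" using beta_integer[OF sin_beta_pi[OF \<psi> nz]] by blast
  \<comment> \<open>For this arc transport is exactly multiplication by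
    \<open>\<xi> Z\<close>.\<close>
  define t where "t = pi / (2 * n)"
  have "\<beta> * of_real t = of_real (pi/2)" using n \<beta> by (simp add: t_def)
  then have t: "cos (\<beta> * of_real t) = 0" "sin (\<beta> * of_real t) = 1"
    by (simp_all only: cos_of_real sin_of_real) simp_all
  obtain Z where Z: "Z \<in> horQ x" "norm Z = 1" using ex_horQ by blast
  note h = horQ_orthogonal[OF Z(1)]
  let ?F = "sphere_map \<psi>"
  have FS: "?F x \<in> \<Sigma>" by (rule sphere_map_Sigma[OF field x])
  define x' where "x' = cos t *\<^sub>R x + sin t *\<^sub>R Z"
  have x': "norm x' = 1" using horQ_rotate[OF Z(1) x Z(2)] by (simp add: x'_def)
  let ?K = "\<gamma> (xi x) *v (\<gamma> Z *v ?F x)"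
  have Fx': "?F x' = ?K" using transport3[OF \<psi> x Z, of t] t by (simp add: x'_def)
  have KS: "?K \<in> \<Sigma>" by (intro Sigma_even FS)
  let ?y = "\<lambda>s. cos s *\<^sub>R x + sin s *\<^sub>R xi x" and ?Z = "\<lambda>s. cos s *\<^sub>R Z + sin s *\<^sub>R xi Z"
  have o: "orthonormal2 x (xi x)" "orthonormal2 Z (xi Z)"
    using x Z by (auto simp: orthonormal2_def norm_xi inner_xi_self)
  have y: "norm (?y s) = 1" "norm (?Z s) = 1" for s
    using spin_exp_plane(3)[OF o(1) refl refl] spin_exp_plane(3)[OF o(2) refl refl]
    by (auto simp: orthonormal2_def)
  have Zy: "?Z s \<in> horQ (?y s)" for s
    by (simp add: horQ_def inner_simps xi_simps h inner_commute[of "xi Z"])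
  \<comment> \<open>A phase rotation is linear and commutes with \<open>xi\<close>, so it carries
    the horizontal arc in direction \<open>Z\<close> to the one in the rotated direction.\<close>
  have "cos s *\<^sub>R x' + sin s *\<^sub>R xi x' = cos t *\<^sub>R ?y s + sin t *\<^sub>R ?Z s" for s
    by (simp add: x'_def xi_simps algebra_simps)
  then have comm: "?F (cos s *\<^sub>R x' + sin s *\<^sub>R xi x') = \<gamma> (xi (?y s)) *v (\<gamma> (?Z s) *v ?F (?y s))" for s
    using transport3[OF \<psi> y(1) Zy y(2), of t] t by simp
  have "((\<lambda>s. ?F (cos s *\<^sub>R x' + sin s *\<^sub>R xi x')) has_vector_derivative
      (1 + \<alpha>) *s (\<gamma> x' *v (\<gamma> (xi x') *v ?F x'))) (at 0)"
    unfolding hopf_transport3[OF \<psi> x'] by (rule cos_sin_derivative_0)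
  moreover have "((\<lambda>s. \<gamma> (xi (?y s)) *v (\<gamma> (?Z s) *v ?F (?y s))) has_vector_derivative
      \<gamma> (xi x) *v (\<gamma> Z *v ((1 + \<alpha>) *s (\<gamma> x *v (\<gamma> (xi x) *v ?F x))) + \<gamma> (xi Z) *v ?F x) +
      \<gamma> (- x) *v (\<gamma> Z *v ?F x)) (at 0)"
  proof -
    have bl: "bounded_linear \<gamma>" using linear_gamma by (simp add: linear_conv_bounded_linear)
    have "((\<lambda>s. xi (?y s)) has_vector_derivative - x) (at 0)" "(?Z has_vector_derivative xi Z) (at 0)"
      unfolding xi_simps by (auto intro!: derivative_eq_intros)
    note d = this[THEN bounded_linear.has_vector_derivative[OF bl]]
    have "((\<lambda>s. ?F (?y s)) has_vector_derivative (1 + \<alpha>) *s (\<gamma> x *v (\<gamma> (xi x) *v ?F x))) (at 0)"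
      unfolding hopf_transport3[OF \<psi> x] by (rule cos_sin_derivative_0)
    from has_vector_derivative_mv[OF d(1) has_vector_derivative_mv[OF d(2) this]]
    show ?thesis by simp
  qed
  ultimately have eq: "(1 + \<alpha>) *s (\<gamma> x' *v (\<gamma> (xi x') *v ?K)) =
      \<gamma> (xi x) *v (\<gamma> Z *v ((1 + \<alpha>) *s (\<gamma> x *v (\<gamma> (xi x) *v ?F x))) + \<gamma> (xi Z) *v ?F x) +
      \<gamma> (- x) *v (\<gamma> Z *v ?F x)"
    unfolding comm Fx' by (rule vector_derivative_unique_at)
  let ?P = "\<gamma> x *v (\<gamma> Z *v ?F x)"
  have "\<gamma> x' *v (\<gamma> (xi x') *v ?K) = - ?P"
    unfolding Sigma_xi_moved[OF x Z KS x'_def]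
    by (simp add: gamma_sq1 norm_xi x mv_simps)
  moreover have "\<gamma> (xi x) *v (\<gamma> Z *v (\<gamma> x *v (\<gamma> (xi x) *v ?F x))) = ?P"
    by (simp add: gamma_anti0[of "xi x" Z] gamma_anti0[of "xi x" x] gamma_anti0[of Z x]
        h inner_xi_self mv_simps gamma_sq1 norm_xi x)
  \<comment> \<open>\<open>x \<xi>\<close> anticommutes with the transport operator, so the Hopf
    derivatives enter with opposite signs; differentiating the two vectors in the operator
    contributes \<open>- 2 P\<close>.\<close>
  ultimately have "(1 + \<alpha>) *s - ?P = (1 + \<alpha>) *s ?P - ?P - ?P"
    using eq by (simp add: vec.add mv_simps gamma_simps Sigma_PQ(1)[OF x Z FS])
  then have "(2 * \<alpha>) *s ?P = 0"
    by (simp add: vec_eq_iff algebra_simps) 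
  moreover have "?P \<noteq> 0" using Fx x Z by (auto simp: gamma_eq_0)
  ultimately show ?thesis by simp
qed

text \<open>The two sides of \<open>eq\<close> below are the derivatives along the same arc, seen as
  moving the target of a horizontal arc from \<open>x\<close>, or as a horizontal arc from \<open>(x + Z)/\<surd>2\<close>.\<close>

lemma beta_squared:
  assumes \<psi>: "trans_killing_spinor \<gamma> e \<Sigma> 0 \<beta> \<psi>" and nz: "\<psi> \<noteq> (\<lambda>_. 0)"
  shows "\<beta> = 0 \<or> \<beta> = 1 \<or> \<beta> = - 1"
proof (cases "\<beta> = 0")
  case False
  have field: "spinor_field \<gamma> e \<Sigma> \<psi>" using \<psi> by (simp add: trans_killing_spinor_def)
  then obtain x where x: "norm x = 1" and Fx: "sphere_map \<psi> x \<noteq> 0"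
    using sphere_map_nonzero nz by blast
  obtain n :: int where n: "\<beta> = of_int n" using beta_integer[OF sin_beta_pi[OF \<psi> nz]] by blast
  obtain Z where Z: "Z \<in> horQ x" "norm Z = 1" using ex_horQ by blast
  note h = horQ_orthogonal[OF Z(1)]
  let ?F = "sphere_map \<psi>" and ?r = "pi / 4"
  define c s where "c = cos (n * ?r)" and "s = sin (n * ?r)"
  have cs: "cos (\<beta> * of_real ?r) = of_real c" "sin (\<beta> * of_real ?r) = of_real s"
  proof -
    have "\<beta> * of_real ?r = of_real (n * ?r)" by (simp add: n)
    then show "cos (\<beta> * of_real ?r) = of_real c" "sin (\<beta> * of_real ?r) = of_real s"
      by (simp_all only: cos_of_real sin_of_real c_def s_def)
  qed
  have FS: "?F x \<in> \<Sigma>" by (rule sphere_map_Sigma[OF field x])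
  let ?y = "\<lambda>t. cos t *\<^sub>R x - sin t *\<^sub>R xi x" and ?Z = "\<lambda>t. cos t *\<^sub>R Z + sin t *\<^sub>R xi Z"
  define y0 Z0 where "y0 = cos ?r *\<^sub>R x + sin ?r *\<^sub>R Z" and "Z0 = cos ?r *\<^sub>R Z - sin ?r *\<^sub>R x"
  let ?I = "\<gamma> x *v (\<gamma> (xi x) *v ?F x)" and ?P = "\<gamma> x *v (\<gamma> Z *v ?F x)"
    and ?K = "\<gamma> (xi x) *v (\<gamma> Z *v ?F x)"
  have o: "orthonormal2 x (xi x)" "orthonormal2 Z (xi Z)" "orthonormal2 x Z"
    using x Z h by (auto simp: orthonormal2_def norm_xi inner_xi_self)
  have y: "norm (?y t) = 1" "norm (?Z t) = 1" for t
    using spin_exp_plane(3)[OF o(1) refl refl, of "- t"] spin_exp_plane(3)[OF o(2) refl refl, of t]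
    by (auto simp: orthonormal2_def)
  have Zy: "?Z t \<in> horQ (?y t)" for t
    by (simp add: horQ_def inner_simps xi_simps h inner_commute[of "xi Z"])
  have Fy: "?F (?y t) = cos (- 1 * of_real t) *s ?F x + sin (- 1 * of_real t) *s ?I" for t
    using hopf_transport3[OF \<psi> x, of "- t"] by simp
  have y0: "norm y0 = 1" "Z0 \<in> horQ y0" "norm Z0 = 1"
    using horQ_rotate[OF Z(1) x Z(2)] by (auto simp: y0_def Z0_def)
  have Fy0: "?F y0 = of_real c *s ?F x + of_real s *s ?K"
    using transport3[OF \<psi> x Z, of ?r] unfolding cs y0_def .
  have F0S: "?F y0 \<in> \<Sigma>" by (rule sphere_map_Sigma[OF field y0(1)])
  \<comment> \<open>This holds because sine and cosine agree at \<open>pi/4\<close>: rotating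
    \<open>x\<close> and \<open>Z\<close> by opposite phases moves the endpoint along the horizontal
    circle in direction \<open>xi Z0\<close>.\<close>
  have "cos t *\<^sub>R y0 + sin t *\<^sub>R xi Z0 = cos ?r *\<^sub>R ?y t + sin ?r *\<^sub>R ?Z t" for t
    by (simp add: y0_def Z0_def xi_simps algebra_simps cos_45 sin_45)
  then have comm: "?F (cos t *\<^sub>R y0 + sin t *\<^sub>R xi Z0) =
      of_real c *s ?F (?y t) + of_real s *s (\<gamma> (xi (?y t)) *v (\<gamma> (?Z t) *v ?F (?y t)))" for t
    using transport3[OF \<psi> y(1) Zy y(2), of ?r t] unfolding cs by simp
  have "((\<lambda>t. ?F (cos t *\<^sub>R y0 + sin t *\<^sub>R xi Z0)) has_vector_derivative
      \<beta> *s (\<gamma> (xi y0) *v (\<gamma> (xi Z0) *v ?F y0))) (at 0)"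
    unfolding transport3[OF \<psi> y0(1) horQ_xi[OF y0(2)] norm_xi[of Z0, unfolded y0(3)]]
    by (rule cos_sin_derivative_0)
  moreover have "((\<lambda>t. of_real c *s ?F (?y t) + of_real s *s (\<gamma> (xi (?y t)) *v (\<gamma> (?Z t) *v ?F (?y t))))
      has_vector_derivative
      of_real c *s (- 1 *s ?I) +
      of_real s *s (\<gamma> (xi x) *v (\<gamma> Z *v (- 1 *s ?I) + \<gamma> (xi Z) *v ?F x) + \<gamma> x *v (\<gamma> Z *v ?F x))) (at 0)"
  proof -
    have bl: "bounded_linear \<gamma>" using linear_gamma by (simp add: linear_conv_bounded_linear)
    have bs: "bounded_linear (\<lambda>w::complex^'w. complex_of_real r *s w)" for r
      unfolding scaleR_conv_smult[symmetric] by (rule bounded_linear_scaleR_right)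
    have "((\<lambda>s. xi (?y s)) has_vector_derivative x) (at 0)" "(?Z has_vector_derivative xi Z) (at 0)"
      unfolding xi_simps by (auto intro!: derivative_eq_intros)
    note d = this[THEN bounded_linear.has_vector_derivative[OF bl]]
    have F': "((\<lambda>t. ?F (?y t)) has_vector_derivative - 1 *s ?I) (at 0)"
      unfolding Fy by (rule cos_sin_derivative_0)
    have "((\<lambda>t. \<gamma> (xi (?y t)) *v (\<gamma> (?Z t) *v ?F (?y t))) has_vector_derivative
        \<gamma> (xi x) *v (\<gamma> Z *v (- 1 *s ?I) + \<gamma> (xi Z) *v ?F x) + \<gamma> x *v (\<gamma> Z *v ?F x)) (at 0)"
      using has_vector_derivative_mv[OF d(1) has_vector_derivative_mv[OF d(2) F']] by simp
    then show ?thesis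
      by (intro has_vector_derivative_add bounded_linear.has_vector_derivative[OF bs] F')
  qed
  ultimately have eq: "\<beta> *s (\<gamma> (xi y0) *v (\<gamma> (xi Z0) *v ?F y0)) = of_real c *s (- 1 *s ?I) +
      of_real s *s (\<gamma> (xi x) *v (\<gamma> Z *v (- 1 *s ?I) + \<gamma> (xi Z) *v ?F x) + \<gamma> x *v (\<gamma> Z *v ?F x))"
    unfolding comm by (rule vector_derivative_unique_at)
  have KI: "\<gamma> (xi x) *v (\<gamma> Z *v ?I) = ?P"
    by (simp add: gamma_anti0[of "xi x" Z] gamma_anti0[of "xi x" x] gamma_anti0[of Z x]
        h inner_xi_self mv_simps gamma_sq1 norm_xi x)
  have PK: "\<gamma> x *v (\<gamma> Z *v ?K) = ?I"
    by (simp add: gamma_anti0[of Z "xi x"] h mv_simps gamma_sq1 Z)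
  have "\<gamma> (xi y0) *v (\<gamma> (xi Z0) *v ?F y0) = - (\<gamma> x *v (\<gamma> Z *v ?F y0))"
    using Sigma_PQ(1)[OF y0 F0S] spin_exp_plane(1)[OF o(3) y0_def Z0_def] by simp
  also have "\<dots> = - (of_real c *s ?P + of_real s *s ?I)"
    by (simp add: Fy0 mv_simps PK)
  finally have "- \<beta> *s (of_real c *s ?P + of_real s *s ?I) = - (of_real c *s ?I + of_real s *s ?P)"
    using eq by (simp add: mv_simps KI Sigma_PQ(1)[OF x Z FS])
  then have "(n * s - c) *\<^sub>R ?I + (n * c - s) *\<^sub>R ?P = 0"
    by (simp add: vec_eq_iff n scaleR_conv_of_real[where 'a = complex] algebra_simps)
  \<comment> \<open>Both summands are \<open>x\<close> times a vector times the same non-zero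
    spinor, so the combined vector must vanish; its components along the orthonormal
    \<open>xi x\<close> and \<open>Z\<close> give two real equations.\<close>
  then have "\<gamma> x *v (\<gamma> ((n * s - c) *\<^sub>R xi x + (n * c - s) *\<^sub>R Z) *v ?F x) = 0"
    by (simp add: gamma_simps mv_simps)
  then have z: "(n * s - c) *\<^sub>R xi x + (n * c - s) *\<^sub>R Z = 0"
    using Fx x by (auto simp: gamma_eq_0)
  have "((n * s - c) *\<^sub>R xi x + (n * c - s) *\<^sub>R Z) \<bullet> xi x = n * s - c"
    "((n * s - c) *\<^sub>R xi x + (n * c - s) *\<^sub>R Z) \<bullet> Z = n * c - s"
    using x Z by (simp_all add: inner_simps inner_xi_xi norm_eq_1 h)
  then have ns: "n * s = c" "n * c = s" unfolding z by simp_all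
  have "c\<^sup>2 + s\<^sup>2 = 1" unfolding c_def s_def by simp
  then have "(real_of_int n)\<^sup>2 = 1"
  proof -
    have "(real_of_int n)\<^sup>2 * (c\<^sup>2 + s\<^sup>2) = (n * c)\<^sup>2 + (n * s)\<^sup>2"
      by (simp add: power_mult_distrib algebra_simps)
    then show ?thesis using \<open>c\<^sup>2 + s\<^sup>2 = 1\<close> by (simp only: ns)
  qed
  then have "n\<^sup>2 = 1" by (metis of_int_eq_1_iff of_int_power)
  then have "n = 1 \<or> n = - 1" by (simp add: power2_eq_1_iff)
  then show ?thesis using n by auto
qed simp

text \<open>In polar coordinates the point is the phase \<open>A\<close> applied to the end of a
  horizontal arc of length \<open>t\<close> whose direction is \<open>Z\<close> rotated by
  \<open>B - A\<close>. Since \<open>b\<close> is a sign, transport is then linear in the real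
  coordinates.\<close>

lemma sphere_map_formula:
  assumes \<psi>: "trans_killing_spinor \<gamma> e \<Sigma> 0 (of_real b) \<psi>" and b: "b = 1 \<or> b = - 1"
    and x: "norm x = 1" and Z: "Z \<in> horQ x" "norm Z = 1"
    and p: "p1\<^sup>2 + p2\<^sup>2 + (p3\<^sup>2 + p4\<^sup>2) = 1"
  shows "sphere_map \<psi> (p1 *\<^sub>R x + p2 *\<^sub>R xi x + p3 *\<^sub>R Z + p4 *\<^sub>R xi Z) =
    p1 *\<^sub>R sphere_map \<psi> x + p2 *\<^sub>R (\<gamma> x *v (\<gamma> (xi x) *v sphere_map \<psi> x)) +
    (b * p3) *\<^sub>R (\<gamma> (xi x) *v (\<gamma> Z *v sphere_map \<psi> x)) - (b * p4) *\<^sub>R (\<gamma> x *v (\<gamma> Z *v sphere_map \<psi> x))"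
proof -
  have field: "spinor_field \<gamma> e \<Sigma> \<psi>" using \<psi> by (simp add: trans_killing_spinor_def)
  note h = horQ_orthogonal[OF Z(1)]
  obtain r A where rA: "p1 = r * cos A" "p2 = r * sin A" using polar_Ex by metis
  obtain q B where qB: "p3 = q * cos B" "p4 = q * sin B" using polar_Ex by metis
  have "p1\<^sup>2 + p2\<^sup>2 = r\<^sup>2" "p3\<^sup>2 + p4\<^sup>2 = q\<^sup>2"
    unfolding rA qB by (simp_all add: power_mult_distrib flip: distrib_left)
  then have "r\<^sup>2 + q\<^sup>2 = 1" using p by simp
  then obtain t where t: "r = cos t" "q = sin t" using sincos_total_2pi by metis
  define C where "C = B - A"
  have BC: "B = A + C" by (simp add: C_def)
  let ?F = "sphere_map \<psi>"
  let ?I = "\<gamma> x *v (\<gamma> (xi x) *v ?F x)" and ?P = "\<gamma> x *v (\<gamma> Z *v ?F x)"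
    and ?K = "\<gamma> (xi x) *v (\<gamma> Z *v ?F x)"
  have FS: "?F x \<in> \<Sigma>" by (rule sphere_map_Sigma[OF field x])
  define Y where "Y = cos C *\<^sub>R Z + sin C *\<^sub>R xi Z"
  have o: "orthonormal2 Z (xi Z)" using Z by (simp add: orthonormal2_def norm_xi inner_xi_self)
  have Y: "Y \<in> horQ x" "norm Y = 1"
    using Z(1) horQ_xi[OF Z(1)] spin_exp_plane(3)[OF o refl refl, of C]
    by (auto simp: Y_def horQ_def inner_simps orthonormal2_def)
  define y where "y = cos t *\<^sub>R x + sin t *\<^sub>R Y"
  have y: "norm y = 1" using horQ_rotate[OF Y(1) x Y(2)] by (simp add: y_def)
  have "p1 *\<^sub>R x + p2 *\<^sub>R xi x + p3 *\<^sub>R Z + p4 *\<^sub>R xi Z = cos A *\<^sub>R y + sin A *\<^sub>R xi y"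
    unfolding y_def Y_def rA qB t BC by (simp add: xi_simps cos_add sin_add algebra_simps)
  then have "?F (p1 *\<^sub>R x + p2 *\<^sub>R xi x + p3 *\<^sub>R Z + p4 *\<^sub>R xi Z) =
      cos A *\<^sub>R ?F y + sin A *\<^sub>R (\<gamma> y *v (\<gamma> (xi y) *v ?F y))"
    using hopf_transport3[OF \<psi> y, of A] by (simp add: cos_of_real sin_of_real scaleR_conv_smult)
  also have "\<gamma> y *v (\<gamma> (xi y) *v ?F y) = \<gamma> x *v (\<gamma> (xi x) *v ?F y)"
    by (rule Sigma_xi_moved[OF x Y sphere_map_Sigma[OF field y] y_def])
  also have "?F y = cos t *\<^sub>R ?F x + (b * sin t) *\<^sub>R (\<gamma> (xi x) *v (\<gamma> Y *v ?F x))"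
  proof -
    have "cos (of_real b * of_real t) = complex_of_real (cos t)"
      "sin (of_real b * of_real t) = complex_of_real (b * sin t)"
      using b by (auto simp: cos_of_real sin_of_real)
    then show ?thesis
      using transport3[OF \<psi> x Y, of t] by (simp only: y_def scaleR_conv_smult)
  qed
  also have "\<gamma> (xi x) *v (\<gamma> Y *v ?F x) = cos C *\<^sub>R ?K - sin C *\<^sub>R ?P"
    by (simp add: Y_def gamma_simps mv_simps Sigma_PQ(1)[OF x Z FS])
  also have "cos A *\<^sub>R (cos t *\<^sub>R ?F x + (b * sin t) *\<^sub>R (cos C *\<^sub>R ?K - sin C *\<^sub>R ?P)) +
      sin A *\<^sub>R (\<gamma> x *v (\<gamma> (xi x) *v (cos t *\<^sub>R ?F x + (b * sin t) *\<^sub>R (cos C *\<^sub>R ?K - sin C *\<^sub>R ?P)))) =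
    p1 *\<^sub>R ?F x + p2 *\<^sub>R ?I + (b * p3) *\<^sub>R ?K - (b * p4) *\<^sub>R ?P"
  proof -
    have IK: "\<gamma> x *v (\<gamma> (xi x) *v ?K) = - ?P" by (simp add: gamma_sq1 norm_xi x mv_simps)
    have IP: "\<gamma> x *v (\<gamma> (xi x) *v ?P) = ?K"
      by (simp add: gamma_anti0[of "xi x" x] inner_xi_self gamma_sq1 x mv_simps)
    show ?thesis
      unfolding rA qB t BC
      by (simp add: mv_simps IK IP cos_add sin_add algebra_simps)
  qed
  finally show ?thesis .
qed

end

section \<open>The Hopf fibration\<close>

text \<open>Quaternions as matrices: the unit ones form the spin group of \<open>real^3\<close>, and
  the values of \<open>pauli\<close> are the imaginary ones.\<close>

definition su2 :: "complex \<Rightarrow> complex \<Rightarrow> complex^2^2" where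
  "su2 a b = vector [vector [a, - cnj b], vector [b, cnj a]]"

lemma su2_entries: "su2 a b $ 1 $ 1 = a" "su2 a b $ 1 $ 2 = - cnj b" "su2 a b $ 2 $ 1 = b" "su2 a b $ 2 $ 2 = cnj a"
  by (simp_all add: su2_def)

lemma su2_mult: "su2 a b ** su2 c d = su2 (a * c - cnj b * d) (b * c + cnj a * d)"
  by (simp add: vec_eq_iff forall_2 matrix_matrix_mult_def sum_2 su2_entries algebra_simps)

lemma pauli_su2: "pauli v = su2 (Complex 0 (v $ 3)) (Complex (- (v $ 2)) (v $ 1))"
  by (simp add: pauli_def su2_def vec_eq_iff forall_2 complex_eq_iff)

lemma su2_mv: "(su2 a b *v w) $ 1 = a * w $ 1 - cnj b * w $ 2" "(su2 a b *v w) $ 2 = b * w $ 1 + cnj a * w $ 2"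
  by (simp_all add: matrix_vector_mult_def sum_2 su2_entries)

lemma norm_real3: "(norm (v :: real^3))\<^sup>2 = (v $ 1)\<^sup>2 + (v $ 2)\<^sup>2 + (v $ 3)\<^sup>2"
  unfolding power2_norm_eq_inner by (simp add: inner_vec_def sum_3 power2_eq_square)

lemma Spin_pauli:
  assumes "q \<in> Spin pauli"
  obtains a b where "q = su2 a b" "(cmod a)\<^sup>2 + (cmod b)\<^sup>2 = 1"
proof -
  define U :: "(complex^2^2) set" where "U = {su2 a b |a b. (cmod a)\<^sup>2 + (cmod b)\<^sup>2 = 1}"
  have mult: "p ** q \<in> U" if pq: "p \<in> U" "q \<in> U" for p q
  proof -
    obtain a b c d where p: "p = su2 a b" "(cmod a)\<^sup>2 + (cmod b)\<^sup>2 = 1"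
      and q: "q = su2 c d" "(cmod c)\<^sup>2 + (cmod d)\<^sup>2 = 1"
      using pq by (auto simp: U_def)
    have "(cmod (a * c - cnj b * d))\<^sup>2 + (cmod (b * c + cnj a * d))\<^sup>2 =
        ((cmod a)\<^sup>2 + (cmod b)\<^sup>2) * ((cmod c)\<^sup>2 + (cmod d)\<^sup>2)"
      unfolding cmod_power2 by (simp add: power2_eq_square algebra_simps)
    then show ?thesis unfolding U_def p(1) q(1) su2_mult using p(2) q(2) by auto
  qed
  have unit: "pauli v \<in> U" if "norm v = 1" for v
  proof -
    have "(cmod (Complex 0 (v $ 3)))\<^sup>2 + (cmod (Complex (- (v $ 2)) (v $ 1)))\<^sup>2 = 1"
      using norm_real3[of v] that by (simp add: cmod_power2)
    then show ?thesis unfolding U_def pauli_su2 by blast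
  qed
  have "mat 1 = su2 1 0" by (simp add: su2_def vec_eq_iff forall_2 mat_def)
  moreover have "(cmod 1)\<^sup>2 + (cmod 0)\<^sup>2 = 1" by simp
  ultimately have "mat 1 \<in> U" unfolding U_def by blast
  with assms have "q \<in> U" by (induction rule: Spin.induct) (auto intro: mult unit)
  then show thesis using that unfolding U_def by blast
qed

interpretation pauli: irreducible_clifford pauli
proof unfold_locales
  show "clifford_rep pauli" by (rule clifford_rep_pauli)
  show "2 \<le> DIM(real^3)" by simp
  show "even CARD(2)" by simp
  fix A :: "complex^2^2" assume A: "\<And>v. A ** pauli v = pauli v ** A"
  \<comment> \<open>Commuting with the first matrix makes \<open>A\<close> diagonal, commuting with
    the second makes its diagonal entries equal.\<close>
  have pa: "pauli (axis 3 1) = su2 \<i> 0" "pauli (axis 2 1) = su2 0 (- 1)"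
    by (simp_all add: pauli_su2 axis_def, simp_all add: su2_def vec_eq_iff forall_2 complex_eq_iff)
  have A': "(A ** su2 \<i> 0) $ r $ c = (su2 \<i> 0 ** A) $ r $ c"
    "(A ** su2 0 (- 1)) $ r $ c = (su2 0 (- 1) ** A) $ r $ c" for r c
    using A[of "axis 3 1"] A[of "axis 2 1"] by (simp_all only: pa)
  have "A $ 1 $ 2 = 0" "A $ 2 $ 1 = 0"
    using A'(1)[of 1 2] A'(1)[of 2 1]
    by (simp_all add: matrix_matrix_mult_def sum_2 su2_entries)
  moreover have "A $ 1 $ 1 = A $ 2 $ 2"
    using A'(2)[of 1 2] by (simp add: matrix_matrix_mult_def sum_2 su2_entries)
  ultimately have "A = mat (A $ 1 $ 1)" by (simp add: vec_eq_iff forall_2 mat_def)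
  then show "\<exists>c. A = mat c" ..
qed

section \<open>Rotations of the base sphere and the derivative of the Hopf map\<close>

lemma orthogonal_e3: "v \<bullet> e3 = 0 \<longleftrightarrow> v $ 3 = 0"
  by (simp add: e3_def inner_axis)

lemma cmod_mult_self: "cmod z * cmod z = Re z * Re z + Im z * Im z"
  using cmod_power2[of z] by (simp add: power2_eq_square)

lemma su2_inverse:
  assumes "(cmod a)\<^sup>2 + (cmod b)\<^sup>2 = 1"
  shows "su2 (cnj a) (- b) ** su2 a b = mat 1" "su2 a b ** su2 (cnj a) (- b) = mat 1"
proof -
  have "su2 1 0 = mat 1" by (simp add: su2_def vec_eq_iff forall_2 mat_def)
  moreover have "cnj a * a + cnj b * b = 1"
    using assms by (simp add: complex_eq_iff cmod_mult_self power2_eq_square)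
  ultimately show "su2 (cnj a) (- b) ** su2 a b = mat 1" "su2 a b ** su2 (cnj a) (- b) = mat 1"
    by (simp_all add: su2_mult mult.commute)
qed

lemma pauli_conjugation:
  assumes q: "su2 a b \<in> Spin pauli" and ab: "(cmod a)\<^sup>2 + (cmod b)\<^sup>2 = 1"
    and V: "pauli V = su2 a b ** pauli v ** su2 (cnj a) (- b)"
  shows "spin_rot pauli (su2 a b) v = V"
proof (rule pauli.spin_rot_eqI[OF q])
  fix w
  have "su2 a b ** pauli v = pauli V ** su2 a b"
    unfolding V by (simp add: su2_inverse[OF ab] flip: matrix_mul_assoc)
  then show "su2 a b *v (pauli v *v w) = pauli V *v (su2 a b *v w)" by (metis mm_mv)
qed

lemma spin_rot_pauli_e3:
  assumes "su2 a b \<in> Spin pauli" "(cmod a)\<^sup>2 + (cmod b)\<^sup>2 = 1"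
  shows "spin_rot pauli (su2 a b) e3 =
    vector [2 * Re (cnj a * b), 2 * Im (cnj a * b), (cmod a)\<^sup>2 - (cmod b)\<^sup>2]"
  by (rule pauli_conjugation[OF assms], unfold pauli_su2 su2_mult, rule arg_cong2[where f = su2])
    (simp_all add: e3_def axis_def complex_eq_iff cmod_mult_self power2_eq_square algebra_simps)

lemma spin_rot_pauli_horizontal:
  assumes "su2 a b \<in> Spin pauli" "(cmod a)\<^sup>2 + (cmod b)\<^sup>2 = 1" and v: "v $ 3 = 0"
    and \<zeta>: "\<zeta> = Complex (v $ 1) (- (v $ 2))"
  shows "spin_rot pauli (su2 a b) v =
    vector [Re (cnj \<zeta> * (cnj a)\<^sup>2 - \<zeta> * b\<^sup>2), Im (cnj \<zeta> * (cnj a)\<^sup>2 - \<zeta> * b\<^sup>2), - 2 * Re (\<zeta> * a * b)]"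
  by (rule pauli_conjugation[OF assms(1,2)], unfold pauli_su2 su2_mult, rule arg_cong2[where f = su2])
    (simp_all add: v \<zeta> complex_eq_iff power2_eq_square algebra_simps)

lemma hopf_derivative_at:
  "frechet_derivative (hopf j k) (at x) Y =
    vector [Re (Y $ j * cnj (x $ k) + x $ j * cnj (Y $ k)), Im (Y $ j * cnj (x $ k) + x $ j * cnj (Y $ k)),
            Re (cnj (x $ j) * Y $ j) - Re (cnj (x $ k) * Y $ k)]" (is "_ = ?D Y")
proof -
  have R: "((\<lambda>x. Re (x $ i)) has_derivative (\<lambda>x. Re (x $ i))) (at x)"
    and I: "((\<lambda>x. Im (x $ i)) has_derivative (\<lambda>x. Im (x $ i))) (at x)" for i and x :: "complex^'n"
    by (intro bounded_linear_imp_has_derivative bounded_linear_compose[OF bounded_linear_Re]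
        bounded_linear_compose[OF bounded_linear_Im] bounded_linear_vec_nth)+
  note d = has_derivative_add has_derivative_diff has_derivative_mult R I
  have 1: "((\<lambda>x. Re (x $ j) * Re (x $ k) + Im (x $ j) * Im (x $ k)) has_derivative (\<lambda>Y. ?D Y $ 1)) (at x)"
    by (rule has_derivative_eq_rhs, (rule d)+) (auto simp: algebra_simps)
  have 2: "((\<lambda>x. Im (x $ j) * Re (x $ k) - Re (x $ j) * Im (x $ k)) has_derivative (\<lambda>Y. ?D Y $ 2)) (at x)"
    by (rule has_derivative_eq_rhs, (rule d)+) (auto simp: algebra_simps)
  have 3: "((\<lambda>x. (1/2) * (Re (x $ j) * Re (x $ j) + Im (x $ j) * Im (x $ j) -
      (Re (x $ k) * Re (x $ k) + Im (x $ k) * Im (x $ k)))) has_derivative (\<lambda>Y. ?D Y $ 3)) (at x)"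
    by (rule has_derivative_eq_rhs, rule has_derivative_mult_right, (rule d)+) (auto simp: algebra_simps)
  have "(hopf j k has_derivative ?D) (at x)"
    unfolding has_derivative_componentwise_within[of "hopf j k"]
  proof
    fix i :: "real^3" assume "i \<in> Basis"
    then obtain l where l: "i = axis l 1" by (auto simp: Basis_vec_def)
    have "l = 1 \<or> l = 2 \<or> l = 3" by (rule exhaust_3)
    then show "((\<lambda>x. hopf j k x \<bullet> i) has_derivative (\<lambda>Y. ?D Y \<bullet> i)) (at x)"
      using 1 2 3 unfolding l
      by (elim disjE) (simp_all add: hopf_def inner_axis cmod_mult_self power2_eq_square)
  qed
  then show ?thesis by (simp add: frechet_derivative_at[symmetric])
qed

locale hopf3 = sasaki3 \<gamma> e m \<Sigma>
  for \<gamma> :: "complex^'n \<Rightarrow> complex^'w^'w" and e m \<Sigma> +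
  fixes j k :: 'n
  assumes jk: "UNIV = {j, k}"
begin

lemma j_neq_k: "j \<noteq> k"
proof
  assume "j = k"
  moreover have "CARD('n) = card {j, k}" by (simp only: jk)
  ultimately show False using card_n m_1 by simp
qed

section \<open>The quaternionic structure of the half-spinor space\<close>

definition f :: "complex^'n" where "f = axis j 1"
definition g :: "complex^'n" where "g = axis k 1"

lemma fg: "norm f = 1" "norm g = 1" "g \<in> horQ f"
  using j_neq_k by (auto simp: f_def g_def norm_axis_1 horQ_def xi_axis inner_axis_axis)

lemma vec_eq_jk: "(y :: complex^'n) = y' \<longleftrightarrow> y $ j = y' $ j \<and> y $ k = y' $ k"
  using jk by (auto simp: vec_eq_iff)

lemma sum_jk: "(\<Sum>i\<in>UNIV. h i) = h j + h k" for h :: "'n \<Rightarrow> 'a::comm_monoid_add"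
  unfolding jk using j_neq_k by simp

lemma fg_entries: "f $ j = 1" "f $ k = 0" "g $ j = 0" "g $ k = 1"
  using j_neq_k by (auto simp: f_def g_def axis_def)

lemma xi_entries: "xi y $ i = \<i> * y $ i"
  by (simp add: xi_def)

lemma expand: "y = Re (y $ j) *\<^sub>R f + Im (y $ j) *\<^sub>R xi f + Re (y $ k) *\<^sub>R g + Im (y $ k) *\<^sub>R xi g"
  by (simp add: vec_eq_jk fg_entries xi_entries complex_eq_iff)

text \<open>The complex structure of \<open>\<Sigma>\<close> given by \<open>x \<cdot> i x = \<Omega>\<close>, which does not depend on the point.\<close>

definition Sm :: "complex \<Rightarrow> complex^'w^'w" where
  "Sm z = Re z *\<^sub>R mat 1 + Im z *\<^sub>R (\<gamma> f ** \<gamma> (xi f))"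

text \<open>A second unit quaternion, anticommuting with the complex structure of \<open>Sm\<close>;
  the two generate the quaternions acting on \<Sigma>.\<close>

definition Mm :: "complex^'w^'w" where
  "Mm = \<gamma> f ** \<gamma> g"

lemma Sm_mv: "Sm z *v w = Re z *\<^sub>R w + Im z *\<^sub>R (\<gamma> f *v (\<gamma> (xi f) *v w))"
  by (simp add: Sm_def mv_simps)

lemma Mm_mv: "Mm *v w = \<gamma> f *v (\<gamma> g *v w)"
  by (simp add: Mm_def mm_mv)

lemma o_ff: "orthonormal2 f (xi f)"
  using fg by (simp add: orthonormal2_def norm_xi inner_xi_self)

lemma Sm_mult: "Sm z *v (Sm z' *v w) = Sm (z * z') *v w"
  by (simp add: Sm_mv mv_simps gamma_gamma_square[OF o_ff] algebra_simps)

lemma Sm_1: "Sm 1 *v w = w"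
  by (simp add: Sm_mv)

lemma Sm_minus: "Sm (- z) *v w = - (Sm z *v w)"
  by (simp add: Sm_mv)

lemma Mm_Sm: "Mm *v (Sm z *v w) = Sm (cnj z) *v (Mm *v w)"
  using fg horQ_orthogonal[OF fg(3)]
  by (simp add: Sm_mv Mm_mv mv_simps gamma_anti0[of g f] gamma_anti0[of "xi f" f] gamma_anti0[of g "xi f"]
      inner_xi_self gamma_sq1)

lemma Mm_Mm: "Mm *v (Mm *v w) = - w"
  using fg horQ_orthogonal[OF fg(3)]
  by (simp add: Mm_mv mv_simps gamma_anti0[of g f] gamma_sq1)

lemma Sm_Sigma: "w \<in> \<Sigma> \<Longrightarrow> Sm z *v w \<in> \<Sigma>" and Mm_Sigma: "w \<in> \<Sigma> \<Longrightarrow> Mm *v w \<in> \<Sigma>"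
  by (auto simp: Sm_mv Mm_mv Sigma_even Sigma_closed Sigma_scaleR)

text \<open>Even elements of the Clifford algebra act on \<Sigma> through one quaternion algebra.
  The \<open>Sm\<close> part of a product is minus the Hermitian product, the part along
  \<open>Mm\<close> the complex determinant of the two vectors.\<close>

lemma product_formula:
  assumes w: "w \<in> \<Sigma>"
  shows "\<gamma> y *v (\<gamma> y' *v w) = Sm (- (y $ j * cnj (y' $ j) + y $ k * cnj (y' $ k))) *v w +
    Sm (y $ j * y' $ k - y $ k * y' $ j) *v (Mm *v w)"
proof -
  note h = horQ_orthogonal[OF fg(3)]
  have r: "\<gamma> g *v (\<gamma> (xi g) *v w) = \<gamma> f *v (\<gamma> (xi f) *v w)"
    "\<gamma> (xi g) *v (\<gamma> g *v w) = - (\<gamma> f *v (\<gamma> (xi f) *v w))"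
    "\<gamma> (xi f) *v (\<gamma> f *v w) = - (\<gamma> f *v (\<gamma> (xi f) *v w))"
    "\<gamma> (xi f) *v (\<gamma> (xi g) *v w) = - (\<gamma> f *v (\<gamma> g *v w))"
    "\<gamma> (xi f) *v (\<gamma> g *v w) = \<gamma> f *v (\<gamma> (xi g) *v w)"
    "\<gamma> g *v (\<gamma> f *v w) = - (\<gamma> f *v (\<gamma> g *v w))"
    "\<gamma> (xi g) *v (\<gamma> f *v w) = - (\<gamma> f *v (\<gamma> (xi g) *v w))"
    "\<gamma> g *v (\<gamma> (xi f) *v w) = - (\<gamma> f *v (\<gamma> (xi g) *v w))"
    "\<gamma> (xi g) *v (\<gamma> (xi f) *v w) = \<gamma> f *v (\<gamma> g *v w)"
    using Sigma_xi[OF fg(1,3,2) w] Sigma_PQ[OF fg(1,3,2) w]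
    by (simp_all add: gamma_anti0[of "xi g" g] gamma_anti0[of "xi f" f] gamma_anti0[of g f]
        gamma_anti0[of "xi g" f] gamma_anti0[of g "xi f"] gamma_anti0[of "xi g" "xi f"] h inner_xi_self)
  have IM: "\<gamma> f *v (\<gamma> (xi f) *v (\<gamma> f *v (\<gamma> g *v w))) = \<gamma> f *v (\<gamma> (xi g) *v w)"
    by (simp add: gamma_anti0[of "xi f" f] inner_xi_self mv_simps gamma_sq1 fg r)
  have sq: "\<gamma> f *v (\<gamma> f *v w) = - w" "\<gamma> g *v (\<gamma> g *v w) = - w"
    "\<gamma> (xi f) *v (\<gamma> (xi f) *v w) = - w" "\<gamma> (xi g) *v (\<gamma> (xi g) *v w) = - w"
    by (simp_all add: gamma_sq1 fg norm_xi)
  show ?thesis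
    by (subst expand[of y], subst expand[of y'])
      (simp add: gamma_simps mv_simps r sq Sm_mv Mm_mv IM algebra_simps)
qed

text \<open>The sum of \<Sigma> and \<open>e \<Sigma>\<close> is invariant under Clifford
  multiplication, hence the whole module.\<close>

lemma Sigma_complement:
  assumes "\<And>w. w \<in> \<Sigma> \<Longrightarrow> A *v w = B *v w" "\<And>w. w \<in> \<Sigma> \<Longrightarrow> A *v (\<gamma> e *v w) = B *v (\<gamma> e *v w)"
  shows "A = B"
proof -
  let ?U = "{a + \<gamma> e *v b |a b. a \<in> \<Sigma> \<and> b \<in> \<Sigma>}"
  obtain w0 where w0: "w0 \<in> \<Sigma>" "w0 \<noteq> 0" using ex_pure_in_Sigma[of 1] by auto
  have "vec.subspace ?U"
    unfolding vec.subspace_def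
  proof (intro conjI ballI allI)
    have "0 = 0 + \<gamma> e *v 0" by simp
    then show "0 \<in> ?U" using Sigma_closed(5) by blast
  next
    fix v w assume "v \<in> ?U" "w \<in> ?U"
    then obtain a b a' b' where "v = a + \<gamma> e *v b" "w = a' + \<gamma> e *v b'" and S: "a \<in> \<Sigma>" "b \<in> \<Sigma>" "a' \<in> \<Sigma>" "b' \<in> \<Sigma>"
      by blast
    then have "v + w = (a + a') + \<gamma> e *v (b + b')" by (simp add: vec.add)
    then show "v + w \<in> ?U" using S Sigma_closed(1) by blast
  next
    fix c v assume "v \<in> ?U"
    then obtain a b where "v = a + \<gamma> e *v b" and S: "a \<in> \<Sigma>" "b \<in> \<Sigma>" by blast
    then have "c *s v = c *s a + \<gamma> e *v (c *s b)" by (simp add: mv_simps vec.scale_right_distrib)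
    then show "c *s v \<in> ?U" using S Sigma_closed(3) by blast
  qed
  moreover have "\<gamma> v *v w \<in> ?U" if "w \<in> ?U" for v w
  proof -
    obtain a b where w: "w = a + \<gamma> e *v b" and S: "a \<in> \<Sigma>" "b \<in> \<Sigma>" using \<open>w \<in> ?U\<close> by blast
    have "\<gamma> v *v w = \<gamma> v *v (\<gamma> e *v b) + \<gamma> e *v (- (\<gamma> e *v (\<gamma> v *v a)))"
      by (simp add: w mv_simps gamma_sq1 norm_e)
    moreover have "\<gamma> v *v (\<gamma> e *v b) \<in> \<Sigma>" "- (\<gamma> e *v (\<gamma> v *v a)) \<in> \<Sigma>"
      using S by (auto intro: Sigma_closed Sigma_even)
    ultimately show ?thesis by blast
  qed
  moreover have "w0 \<in> ?U"
  proof -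
    have "w0 = w0 + \<gamma> e *v 0" by simp
    then show ?thesis using w0(1) Sigma_closed(5) by blast
  qed
  ultimately have "?U = UNIV" using w0(2) by (rule invariant_UNIV)
  moreover have "A *v w = B *v w" if "w \<in> ?U" for w
    using that assms by (auto simp: vec.add)
  ultimately show ?thesis by (metis UNIV_I matrix_eq)
qed

lemma Sm_cis: "Sm (cis t) *v w = cos t *\<^sub>R w + sin t *\<^sub>R (\<gamma> f *v (\<gamma> (xi f) *v w))"
  by (simp add: Sm_mv)

lemma gamma_xi_Sm:
  assumes "norm y = 1" "w \<in> \<Sigma>"
  shows "\<gamma> y *v (\<gamma> (xi y) *v w) = \<gamma> f *v (\<gamma> (xi f) *v w)"
proof -
  have "Re (y $ j) * Re (y $ j) + Im (y $ j) * Im (y $ j) + (Re (y $ k) * Re (y $ k) + Im (y $ k) * Im (y $ k)) = 1"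
    using assms(1) by (simp add: norm_eq_1 inner_vec_def sum_jk inner_complex_def)
  then have "- (y $ j * cnj (xi y $ j) + y $ k * cnj (xi y $ k)) = \<i>"
    by (simp add: xi_entries complex_eq_iff algebra_simps)
  moreover have "y $ j * xi y $ k - y $ k * xi y $ j = 0"
    by (simp add: xi_entries)
  ultimately show ?thesis
    unfolding product_formula[OF assms(2), of y "xi y"] by (simp add: Sm_mv)
qed

text \<open>A phase rotation and a special unitary rotation carry \<open>e\<close> to
  \<open>x\<close>, and only the former acts on \<Sigma>. A rotation in the horizontal plane at
  \<open>e\<close>, which fixes \<open>e\<close>, adjusts the total phase to
  \<open>lam\<close>.\<close>

lemma spin_lift_exists:
  assumes x: "norm x = 1" and lam: "cmod lam = 1"
  obtains p where "p \<in> Spin \<gamma>" "spin_rot \<gamma> p e = x" "\<And>w. w \<in> \<Sigma> \<Longrightarrow> p *v w = Sm lam *v w"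
proof -
  obtain r a where ra: "x \<bullet> e = r * cos a" "x \<bullet> xi e = r * sin a" using polar_Ex by metis
  define x' where "x' = cos a *\<^sub>R e + sin a *\<^sub>R xi e"
  have o: "orthonormal2 e (xi e)" using norm_e by (simp add: orthonormal2_def norm_xi inner_xi_self)
  have x': "norm x' = 1" using spin_exp_plane(3)[OF o x'_def refl] by (simp add: orthonormal2_def)
  obtain W where W: "W \<in> horQ e" "norm W = 1" using ex_horQ by blast
  have oW: "orthonormal2 W (xi W)" using W by (simp add: orthonormal2_def norm_xi inner_xi_self)
  have hor: "Z \<in> horQ x'" if "Z \<in> horQ e" for Z
    using that by (simp add: x'_def horQ_def inner_simps xi_simps)
  define Y where "Y = projQ e x"
  have Y: "Y \<in> horQ e" unfolding Y_def by (rule projQ_horQ[OF norm_e])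
  have xY: "x = r *\<^sub>R x' + Y" by (simp add: Y_def projQ_def ra x'_def algebra_simps)
  define Z where "Z = (if Y = 0 then W else sgn Y)"
  have Z: "Z \<in> horQ e" "norm Z = 1" and YZ: "Y = norm Y *\<^sub>R Z"
    using Y W by (auto simp: Z_def horQ_def norm_sgn sgn_div_norm)
  have "x \<bullet> x = r\<^sup>2 + (norm Y)\<^sup>2"
    using hor[OF Y] x' unfolding xY
    by (simp add: inner_simps horQ_def norm_eq_1 inner_commute power2_norm_eq_inner power2_eq_square[of r])
  then have "r\<^sup>2 + (norm Y)\<^sup>2 = 1" using x by (simp add: norm_eq_1)
  then obtain t where "r = cos t" "norm Y = sin t" using sincos_total_2pi by metis
  then have xt: "x = cos t *\<^sub>R x' + sin t *\<^sub>R Z" using xY YZ by simp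
  obtain \<theta> where \<theta>: "lam = cis \<theta>"
    using lam by (metis complex_norm_eq_1_exp_eq cis_conv_exp)
  note oZ = horQ_orthonormal2[OF hor[OF Z(1)] x' Z(2)] and hZ = horQ_orthogonal[OF hor[OF Z(1)]]
  \<comment> \<open>The phase rotation by \<open>a\<close> already contributes the half angle
    \<open>a/2\<close> on \<Sigma>, and the angle \<open>2 \<theta> - a\<close> supplies the
    remaining \<open>\<theta> - a/2\<close>.\<close>
  define p where "p = spin_exp (xi x') (xi Z) t ** (spin_exp x' Z t ** (spin_exp e (xi e) a ** spin_exp W (xi W) (2 * \<theta> - a)))"
  note S = spin_exp_Spin[OF oZ(1)] spin_exp_Spin[OF oZ(2)] spin_exp_Spin[OF o] spin_exp_Spin[OF oW]
  have p: "p \<in> Spin \<gamma>" unfolding p_def by (intro Spin_mult S)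
  have "spin_rot \<gamma> p e = plane_rot (xi x') (xi Z) t (plane_rot x' Z t (plane_rot e (xi e) a (plane_rot W (xi W) (2 * \<theta> - a) e)))"
    unfolding p_def by (simp add: spin_rot_mult Spin_mult S spin_rot_spin_exp o oW oZ)
  also have "plane_rot W (xi W) (2 * \<theta> - a) e = e"
    by (rule plane_rot_simps(3)[OF oW]) (use horQ_orthogonal[OF W(1)] in auto)
  also have "plane_rot e (xi e) a e = x'" unfolding x'_def by (rule plane_rot_simps(1)[OF o])
  also have "plane_rot x' Z t x' = x" unfolding xt by (rule plane_rot_simps(1)[OF oZ(1)])
  also have "plane_rot (xi x') (xi Z) t x = x"
    by (rule plane_rot_simps(3)[OF oZ(2)]) (simp_all add: xt inner_simps inner_xi_self hZ)
  finally have pe: "spin_rot \<gamma> p e = x" .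
  have act: "p *v w = Sm lam *v w" if w: "w \<in> \<Sigma>" for w
  proof -
    have "spin_exp W (xi W) (2 * \<theta> - a) *v w = Sm (cis ((2 * \<theta> - a) / 2)) *v w"
      by (simp only: spin_exp_mv Sm_cis gamma_xi_Sm[OF W(2) w])
    moreover have "spin_exp e (xi e) a *v v = Sm (cis (a / 2)) *v v" if "v \<in> \<Sigma>" for v
      by (simp only: spin_exp_mv Sm_cis gamma_xi_Sm[OF norm_e that])
    moreover have "spin_exp (xi x') (xi Z) t *v (spin_exp x' Z t *v v) = v" if "v \<in> \<Sigma>" for v
      using unitary_back_id[OF hor[OF Z(1)] x' Z(2) Sigma_PQ(1)[OF x' hor[OF Z(1)] Z(2) that], of "- t"]
      by (simp add: unitary_back_def)
    moreover have "cis (a / 2) * cis ((2 * \<theta> - a) / 2) = lam"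
      unfolding \<theta> cis_mult by (simp add: field_simps)
    ultimately show ?thesis using w by (simp add: p_def mm_mv Sm_Sigma Sm_mult)
  qed
  show thesis by (rule that[OF p pe act])
qed

text \<open>The projection to \<Sigma> along the opposite half-spinor space: the volume element acts
  as \<open>- 1\<close> on \<Sigma> and as \<open>1\<close> on its images under vectors.\<close>

definition P :: "complex^'w^'w" where
  "P = (1/2) *\<^sub>R (mat 1 - \<gamma> f ** \<gamma> (xi f) ** \<gamma> g ** \<gamma> (xi g))"

lemma P_Sigma: assumes "w \<in> \<Sigma>" shows "P *v w = w" "P *v (\<gamma> v *v w) = 0"
proof -
  note h = horQ_orthogonal[OF fg(3)]
  let ?vol = "\<lambda>w. \<gamma> f *v (\<gamma> (xi f) *v (\<gamma> g *v (\<gamma> (xi g) *v w)))"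
  have vol: "?vol w = - w"
    by (simp add: Sigma_xi[OF fg(1,3,2) assms] gamma_gamma_square[OF o_ff])
  then show "P *v w = w" by (simp add: P_def mv_simps scaleR_diff_right)
  have "?vol (\<gamma> v *v w) = - (\<gamma> v *v ?vol w)" for v
    by (subst (1 2) expand[of v])
      (simp add: gamma_simps mv_simps gamma_sq1 fg norm_xi gamma_anti0[of "xi g" g] gamma_anti0[of "xi f" f] gamma_anti0[of g f]
        gamma_anti0[of "xi g" f] gamma_anti0[of g "xi f"] gamma_anti0[of "xi g" "xi f"] h inner_xi_self)
  with vol show "P *v (\<gamma> v *v w) = 0" by (simp add: P_def mv_simps)
qed

text \<open>The Hermitian product of \<open>x\<close> with the conjugate of the first column of
  \<open>q\<close>; over the Hopf fibration it is the unit number that locates \<open>x\<close> in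
  its fibre.\<close>

definition lam :: "complex^'n \<Rightarrow> complex^2^2 \<Rightarrow> complex" where
  "lam x q = x $ j * q $ 1 $ 1 + x $ k * q $ 2 $ 1"

text \<open>Prescribed as \<open>Sm (lam x q)\<close> on \<Sigma>; on \<open>e \<Sigma>\<close> it
  is then forced, because its rotation has to take \<open>e\<close> to \<open>x\<close>. The closed
  formula makes the lift continuous without any choice.\<close>

definition Phi :: "complex^'n \<Rightarrow> complex^2^2 \<Rightarrow> complex^'w^'w" where
  "Phi x q = Sm (lam x q) ** P - \<gamma> x ** Sm (lam x q) ** P ** \<gamma> e"

lemma Phi_Sigma:
  assumes "w \<in> \<Sigma>"
  shows "Phi x q *v w = Sm (lam x q) *v w" "Phi x q *v (\<gamma> e *v w) = \<gamma> x *v (Sm (lam x q) *v w)"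
proof -
  show "Phi x q *v w = Sm (lam x q) *v w" using P_Sigma[OF assms] by (simp add: Phi_def mv_simps)
  have "Phi x q *v (\<gamma> e *v w) = - (\<gamma> x *v (Sm (lam x q) *v (P *v (\<gamma> e *v (\<gamma> e *v w)))))"
    using P_Sigma[OF assms] by (simp add: Phi_def mv_simps)
  also have "\<dots> = \<gamma> x *v (Sm (lam x q) *v w)"
    by (simp add: gamma_sq1 norm_e P_Sigma[OF assms] mv_simps)
  finally show "Phi x q *v (\<gamma> e *v w) = \<gamma> x *v (Sm (lam x q) *v w)" .
qed

lemma Phi_Spin:
  assumes x: "norm x = 1" and lam: "cmod (lam x q) = 1"
  shows "Phi x q \<in> Spin \<gamma>" "spin_rot \<gamma> (Phi x q) e = x"
proof -
  obtain p where p: "p \<in> Spin \<gamma>" "spin_rot \<gamma> p e = x" "\<And>w. w \<in> \<Sigma> \<Longrightarrow> p *v w = Sm (lam x q) *v w"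
    using spin_lift_exists[OF x lam] by blast
  have "Phi x q = p"
  proof (rule Sigma_complement)
    fix w assume w: "w \<in> \<Sigma>"
    show "Phi x q *v w = p *v w" by (simp add: Phi_Sigma w p(3))
    show "Phi x q *v (\<gamma> e *v w) = p *v (\<gamma> e *v w)"
      by (simp add: Phi_Sigma w p(3) spin_rot[OF p(1)] p(2))
  qed
  with p show "Phi x q \<in> Spin \<gamma>" "spin_rot \<gamma> (Phi x q) e = x" by auto
qed

text \<open>A spin frame \<open>q\<close> over the image of \<open>x\<close> differs from \<open>x\<close> by a phase.\<close>

lemma hopf_pullback_cases:
  assumes "(x, q) \<in> hopf_pullback j k"
  obtains a b where "q = su2 a b" "(cmod a)\<^sup>2 + (cmod b)\<^sup>2 = 1" "cmod (lam x q) = 1"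
    "x $ j = lam x q * cnj a" "x $ k = lam x q * cnj b" "norm x = 1" "q \<in> Spin pauli"
    "lam x q = x $ j * a + x $ k * b"
proof -
  have x: "norm x = 1" and q: "q \<in> Spin pauli" and hopf: "hopf j k x = (1/2) *\<^sub>R spin_rot pauli q e3"
    using assms by (auto simp: hopf_pullback_def)
  obtain a b where ab: "q = su2 a b" "(cmod a)\<^sup>2 + (cmod b)\<^sup>2 = 1" using Spin_pauli[OF q] by blast
  have l: "lam x q = x $ j * a + x $ k * b" by (simp add: lam_def ab(1) su2_entries)
  have xx: "(cmod (x $ j))\<^sup>2 + (cmod (x $ k))\<^sup>2 = 1"
    using x by (simp add: norm_eq_1 inner_vec_def sum_jk inner_complex_def cmod_mult_self power2_eq_square)
  have h: "hopf j k x $ i = ((1/2) *\<^sub>R (vector [2 * Re (cnj a * b), 2 * Im (cnj a * b), (cmod a)\<^sup>2 - (cmod b)\<^sup>2] :: real^3)) $ i" for i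
    using hopf spin_rot_pauli_e3[of a b] q ab by simp
  have 1: "x $ j * cnj (x $ k) = cnj a * b"
    using h[of 1] h[of 2] by (simp add: hopf_def complex_eq_iff)
  have "(cmod (x $ j))\<^sup>2 - (cmod (x $ k))\<^sup>2 = (cmod a)\<^sup>2 - (cmod b)\<^sup>2"
    using h[of 3] by (simp add: hopf_def)
  then have 2: "(cmod (x $ j))\<^sup>2 = (cmod a)\<^sup>2" "(cmod (x $ k))\<^sup>2 = (cmod b)\<^sup>2" using xx ab(2) by linarith+
  have sq: "z * cnj z = of_real ((cmod z)\<^sup>2)" for z using complex_norm_square[of z] by simp
  have c1: "cnj (x $ j) * x $ k = a * cnj b" using arg_cong[OF 1, of cnj] by simp
  have "lam x q * cnj a = x $ j * (a * cnj a) + x $ k * (cnj a * b)" by (simp add: l algebra_simps)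
  also have "\<dots> = x $ j * (of_real ((cmod (x $ j))\<^sup>2) + of_real ((cmod (x $ k))\<^sup>2))"
    unfolding sq 2[symmetric] unfolding 1[symmetric] sq[symmetric] by (simp add: algebra_simps)
  also have "\<dots> = x $ j" by (simp only: xx of_real_1 mult_1_right flip: of_real_add)
  finally have xj: "x $ j = lam x q * cnj a" by simp
  have "lam x q * cnj b = x $ k * (b * cnj b) + x $ j * (a * cnj b)" by (simp add: l algebra_simps)
  also have "\<dots> = x $ k * (of_real ((cmod (x $ j))\<^sup>2) + of_real ((cmod (x $ k))\<^sup>2))"
    unfolding sq 2[symmetric] unfolding c1[symmetric] sq[symmetric] by (simp add: algebra_simps)
  also have "\<dots> = x $ k" by (simp only: xx of_real_1 mult_1_right flip: of_real_add)
  finally have xk: "x $ k = lam x q * cnj b" by simp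
  have "1 = (cmod (lam x q))\<^sup>2 * ((cmod a)\<^sup>2 + (cmod b)\<^sup>2)"
    using xx unfolding xj xk by (simp add: norm_mult power_mult_distrib algebra_simps)
  then have "cmod (lam x q) = 1" using ab(2) abs_square_eq_1[of "cmod (lam x q)"] by simp
  with ab xj xk x q l show thesis by (intro that)
qed

section \<open>Horizontal vectors and the lift of the spin frames\<close>

lemma inner_jk: "y \<bullet> y' = Re (y $ j * cnj (y' $ j) + y $ k * cnj (y' $ k))" for y y' :: "complex^'n"
  by (simp add: inner_vec_def sum_jk inner_complex_def)

lemma norm_jk: "norm y = 1 \<Longrightarrow> y $ j * cnj (y $ j) + y $ k * cnj (y $ k) = 1" for y :: "complex^'n"
  by (simp add: norm_eq_1 inner_jk complex_eq_iff)

lemma horQ_jk: "Y \<in> horQ x \<longleftrightarrow> x $ j * cnj (Y $ j) + x $ k * cnj (Y $ k) = 0" for x :: "complex^'n"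
  by (auto simp: horQ_def inner_jk xi_entries complex_eq_iff algebra_simps)

text \<open>A complex coordinate \<open>c\<close> on the horizontal line in \<open>x\<close>,
  isometric for unit \<open>x\<close>.\<close>

definition perp :: "complex \<Rightarrow> complex^'n \<Rightarrow> complex^'n" where
  "perp c x = (\<chi> i. if i = j then - c * cnj (x $ k) else c * cnj (x $ j))"

lemma perp_entries: "perp c x $ j = - c * cnj (x $ k)" "perp c x $ k = c * cnj (x $ j)"
  using j_neq_k by (auto simp: perp_def)

lemma perp_horQ: "perp c x \<in> horQ x"
  by (simp add: horQ_jk perp_entries)

lemma norm_perp: assumes "norm x = 1" shows "norm (perp c x) = cmod c"
proof -
  have "perp c x \<bullet> perp c x = Re ((c * cnj c) * (x $ j * cnj (x $ j) + x $ k * cnj (x $ k)))"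
    by (simp add: inner_jk perp_entries algebra_simps)
  also have "\<dots> = (cmod c)\<^sup>2" by (simp add: norm_jk[OF assms] cmod_mult_self power2_eq_square)
  finally show ?thesis by (simp add: norm_eq_sqrt_inner)
qed

lemma gamma_perp:
  assumes x: "norm x = 1" and w: "w \<in> \<Sigma>"
  shows "\<gamma> x *v (\<gamma> (perp c x) *v w) = Sm c *v (Mm *v w)"
proof -
  have "x $ j * perp c x $ k - x $ k * perp c x $ j = c * (x $ j * cnj (x $ j) + x $ k * cnj (x $ k))"
    by (simp add: perp_entries algebra_simps)
  moreover have "x $ j * cnj (perp c x $ j) + x $ k * cnj (perp c x $ k) = 0"
    using perp_horQ[of c x] by (simp add: horQ_jk)
  ultimately show ?thesis
    unfolding product_formula[OF w, of x] by (simp add: norm_jk[OF x]) (simp add: Sm_mv)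
qed

lemma gamma_perp_perp:
  assumes x: "norm x = 1" and w: "w \<in> \<Sigma>"
  shows "\<gamma> (perp c x) *v (\<gamma> (perp d x) *v w) = Sm (- c * cnj d) *v w"
proof -
  have "perp c x $ j * perp d x $ k - perp c x $ k * perp d x $ j = 0"
    by (simp add: perp_entries)
  moreover have "- (perp c x $ j * cnj (perp d x $ j) + perp c x $ k * cnj (perp d x $ k)) =
      (- c * cnj d) * (x $ j * cnj (x $ j) + x $ k * cnj (x $ k))"
    by (simp add: perp_entries algebra_simps)
  ultimately show ?thesis
    unfolding product_formula[OF w, of "perp c x"] by (simp only: norm_jk[OF x]) (simp add: Sm_mv)
qed

text \<open>The conjugate of the usual coordinate of the plane: with this orientation the derivative
  of the Hopf map takes the lifted frames to the frames of the base.\<close>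

definition zeta :: "real^3 \<Rightarrow> complex" where
  "zeta v = Complex (v $ 1) (- (v $ 2))"

definition iota :: "real^3 \<Rightarrow> complex^'n" where
  "iota v = perp (zeta v) e"

lemma cmod_zeta: "v \<bullet> e3 = 0 \<Longrightarrow> cmod (zeta v) = norm v"
  using norm_real3[of v] real_sqrt_unique[of "norm v" "(v $ 1)\<^sup>2 + (v $ 2)\<^sup>2"]
  by (simp add: orthogonal_e3 zeta_def cmod_def)

lemma pauli_zeta: "v \<bullet> e3 = 0 \<Longrightarrow> pauli v = su2 0 (\<i> * cnj (zeta v))"
  by (auto simp: pauli_su2 orthogonal_e3 zeta_def complex_eq_iff intro!: arg_cong2[where f = su2])

text \<open>Both identities are tested on one spinor of \<Sigma>. The square of \<open>lam\<close>
  arises because \<open>Mm\<close> conjugates phases: one factor comes from each side of the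
  intertwining relation.\<close>

lemma Phi_rot:
  assumes xq: "(x, q) \<in> hopf_pullback j k"
  shows "spin_rot \<gamma> (Phi x q) (xi e) = xi x"
    and "spin_rot \<gamma> (Phi x q) (perp c e) = perp ((lam x q)\<^sup>2 * c) x"
proof -
  obtain a b where l: "cmod (lam x q) = 1" and x: "norm x = 1"
    using hopf_pullback_cases[OF xq] by metis
  note S = Phi_Spin[OF x l]
  have ll: "lam x q * cnj (lam x q) = 1" using l complex_norm_square[of "lam x q"] by simp
  obtain w where w: "w \<in> \<Sigma>" "w \<noteq> 0" using ex_pure_in_Sigma[of 1] by auto
  have move: "Phi x q *v (\<gamma> v *v w) = - (\<gamma> x *v (Sm (lam x q) *v (\<gamma> e *v (\<gamma> v *v w))))" for v
  proof -
    have "\<gamma> v *v w = \<gamma> e *v (- (\<gamma> e *v (\<gamma> v *v w)))" by (simp add: mv_simps gamma_sq1 norm_e)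
    moreover have "- (\<gamma> e *v (\<gamma> v *v w)) \<in> \<Sigma>" using w(1) by (auto intro: Sigma_closed Sigma_even)
    ultimately have "Phi x q *v (\<gamma> v *v w) = \<gamma> x *v (Sm (lam x q) *v - (\<gamma> e *v (\<gamma> v *v w)))"
      using Phi_Sigma(2) by metis
    then show ?thesis by (simp add: mv_simps)
  qed
  have shift: "\<gamma> Y *v (Phi x q *v w) = - (\<gamma> x *v (\<gamma> x *v (\<gamma> Y *v (Sm (lam x q) *v w))))" for Y
    by (simp add: gamma_sq1 x Phi_Sigma(1)[OF w(1)])
  have Sw: "Sm (lam x q) *v w \<in> \<Sigma>" by (rule Sm_Sigma[OF w(1)])
  have I: "\<gamma> f *v (\<gamma> (xi f) *v v) = Sm \<i> *v v" for v by (simp add: Sm_mv)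
  show "spin_rot \<gamma> (Phi x q) (xi e) = xi x"
    by (rule spin_rot_unique[OF S(1) w(2)])
      (simp add: move shift gamma_xi_Sm[OF norm_e w(1)] gamma_xi_Sm[OF x Sw] I Sm_mult mult.commute)
  have "(lam x q)\<^sup>2 * c * cnj (lam x q) = lam x q * c * (lam x q * cnj (lam x q))"
    by (simp add: power2_eq_square)
  also have "\<dots> = lam x q * c" by (simp only: ll mult_1_right)
  finally have cl: "(lam x q)\<^sup>2 * c * cnj (lam x q) = lam x q * c" .
  show "spin_rot \<gamma> (Phi x q) (perp c e) = perp ((lam x q)\<^sup>2 * c) x"
    by (intro spin_rot_unique[OF S(1) w(2)])
      (simp add: move shift gamma_perp[OF norm_e w(1)] gamma_perp[OF x Sw] Mm_Sm Sm_mult cl)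
qed

lemma hopf_derivative_perp:
  assumes xq: "(x, q) \<in> hopf_pullback j k" and v: "v \<bullet> e3 = 0"
  shows "frechet_derivative (hopf j k) (at x) (perp ((lam x q)\<^sup>2 * zeta v) x) = spin_rot pauli q v"
proof -
  obtain a b where q: "q = su2 a b" "(cmod a)\<^sup>2 + (cmod b)\<^sup>2 = 1" "q \<in> Spin pauli"
    and l: "cmod (lam x q) = 1" and x: "x $ j = lam x q * cnj a" "x $ k = lam x q * cnj b"
    using hopf_pullback_cases[OF xq] by metis
  define l where "l = lam x q"
  have ll: "l * cnj l = 1" using l complex_norm_square[of "lam x q"] by (simp add: l_def)
  let ?Y = "perp (l\<^sup>2 * zeta v) x" and ?z = "zeta v"
  have "?Y $ j * cnj (x $ k) + x $ j * cnj (?Y $ k) =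
      (l * cnj l)\<^sup>2 * (cnj ?z * (cnj a)\<^sup>2 - ?z * b\<^sup>2)"
    by (simp add: perp_entries x l_def[symmetric] power2_eq_square algebra_simps)
  then have 1: "?Y $ j * cnj (x $ k) + x $ j * cnj (?Y $ k) = cnj ?z * (cnj a)\<^sup>2 - ?z * b\<^sup>2"
    by (simp add: ll)
  have "cnj (x $ j) * ?Y $ j = - ((l * cnj l)\<^sup>2 * (?z * a * b))"
    "cnj (x $ k) * ?Y $ k = (l * cnj l)\<^sup>2 * (?z * a * b)"
    by (simp_all add: perp_entries x l_def[symmetric] power2_eq_square algebra_simps)
  then have 2: "Re (cnj (x $ j) * ?Y $ j) - Re (cnj (x $ k) * ?Y $ k) = - 2 * Re (?z * a * b)"
    by (simp only: ll) simp
  have "spin_rot pauli q v = vector [Re (cnj ?z * (cnj a)\<^sup>2 - ?z * b\<^sup>2), Im (cnj ?z * (cnj a)\<^sup>2 - ?z * b\<^sup>2), - 2 * Re (?z * a * b)]"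
    unfolding q(1) by (rule spin_rot_pauli_horizontal)
      (use q v in \<open>auto simp: orthogonal_e3 zeta_def\<close>)
  then show ?thesis unfolding hopf_derivative_at l_def[symmetric] 1 2 by simp
qed

lemma continuous_Phi: "continuous_on S (\<lambda>(x, q). Phi x q)"
proof -
  have bl: "bounded_linear \<gamma>" using linear_gamma by (simp add: linear_conv_bounded_linear)
  have l: "continuous_on S (\<lambda>z. lam (fst z) (snd z))"
    unfolding lam_def by (intro continuous_intros)
  have Sm: "continuous_on S (\<lambda>z. Sm (lam (fst z) (snd z)))"
    unfolding Sm_def by (intro continuous_intros l)
  have \<gamma>: "continuous_on S (\<lambda>z. \<gamma> (fst z))"
    by (intro bounded_linear.continuous_on[OF bl] continuous_intros)
  note mm = bounded_bilinear.continuous_on[OF bounded_bilinear_mm]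
  show ?thesis
    unfolding case_prod_beta Phi_def
    by (intro continuous_on_diff mm Sm \<gamma> continuous_on_const)
qed

text \<open>Changing the frame \<open>q\<close> multiplies \<open>lam\<close> by
  \<open>- zeta u * cnj (zeta v)\<close>, which is also the action of \<open>iota u iota v\<close>
  on \<Sigma>; \<open>e\<close> commutes with this product.\<close>

lemma Phi_equivariant:
  assumes xq: "(x, q) \<in> hopf_pullback j k" and uv: "u \<bullet> e3 = 0" "v \<bullet> e3 = 0"
  shows "Phi x (q ** pauli u ** pauli v) = Phi x q ** \<gamma> (iota u) ** \<gamma> (iota v)"
proof -
  obtain a b where q: "q = su2 a b" using hopf_pullback_cases[OF xq] by metis
  let ?\<mu> = "- zeta u * cnj (zeta v)"
  have lam: "lam x (q ** pauli u ** pauli v) = lam x q * ?\<mu>"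
    unfolding q pauli_zeta[OF uv(1)] pauli_zeta[OF uv(2)] su2_mult lam_def su2_entries
    by (simp add: algebra_simps)
  show ?thesis
  proof (rule Sigma_complement)
    fix w assume w: "w \<in> \<Sigma>"
    have G: "\<gamma> (iota u) *v (\<gamma> (iota v) *v w) = Sm ?\<mu> *v w"
      unfolding iota_def by (rule gamma_perp_perp[OF norm_e w])
    show "Phi x (q ** pauli u ** pauli v) *v w = (Phi x q ** \<gamma> (iota u) ** \<gamma> (iota v)) *v w"
      by (simp add: mm_mv G Phi_Sigma w Sm_Sigma lam Sm_mult)
    have h: "iota u \<bullet> e = 0" "iota v \<bullet> e = 0"
      using perp_horQ[of _ e] by (auto simp: iota_def horQ_def)
    have "\<gamma> (iota u) *v (\<gamma> (iota v) *v (\<gamma> e *v w)) = \<gamma> e *v (Sm ?\<mu> *v w)"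
      by (simp add: gamma_anti0[OF h(1)] gamma_anti0[OF h(2)] mv_minus G)
    then show "Phi x (q ** pauli u ** pauli v) *v (\<gamma> e *v w) = (Phi x q ** \<gamma> (iota u) ** \<gamma> (iota v)) *v (\<gamma> e *v w)"
      by (simp add: mm_mv Phi_Sigma w Sm_Sigma lam Sm_mult)
  qed
qed

lemma hopf_spin_lift_Phi: "hopf_spin_lift \<gamma> e j k iota Phi"
  unfolding hopf_spin_lift_def
proof (intro conjI)
  show "linear iota"
    by (rule linearI)
      (simp_all add: iota_def vec_eq_jk perp_entries zeta_def complex_eq_iff algebra_simps)
  show "\<forall>v. v \<bullet> e3 = 0 \<longrightarrow> iota v \<in> horQ e \<and> norm (iota v) = norm v"
    by (simp add: iota_def perp_horQ norm_perp norm_e cmod_zeta)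
  show "continuous_on (hopf_pullback j k) (\<lambda>(x, q). Phi x q)" by (rule continuous_Phi)
  show "\<forall>(x, q)\<in>hopf_pullback j k. Phi x q \<in> Spin \<gamma> \<and> spin_rot \<gamma> (Phi x q) e = x \<and>
        spin_rot \<gamma> (Phi x q) (xi e) = xi x \<and>
        (\<forall>v. v \<bullet> e3 = 0 \<longrightarrow> spin_rot \<gamma> (Phi x q) (iota v) \<in> horQ x \<and>
           frechet_derivative (hopf j k) (at x) (spin_rot \<gamma> (Phi x q) (iota v)) = spin_rot pauli q v) \<and>
        (\<forall>u v. u \<bullet> e3 = 0 \<longrightarrow> v \<bullet> e3 = 0 \<longrightarrow> norm u = 1 \<longrightarrow> norm v = 1 \<longrightarrow>
           Phi x (q ** pauli u ** pauli v) = Phi x q ** \<gamma> (iota u) ** \<gamma> (iota v))"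
  proof (intro ballI, safe)
    fix x q assume xq: "(x, q) \<in> hopf_pullback j k"
    obtain a b where l: "cmod (lam x q) = 1" and x: "norm x = 1"
      using hopf_pullback_cases[OF xq] by metis
    show "Phi x q \<in> Spin \<gamma>" "spin_rot \<gamma> (Phi x q) e = x" by (rule Phi_Spin[OF x l])+
    show "spin_rot \<gamma> (Phi x q) (xi e) = xi x" by (rule Phi_rot(1)[OF xq])
    fix v :: "real^3" assume v: "v \<bullet> e3 = 0"
    show "spin_rot \<gamma> (Phi x q) (iota v) \<in> horQ x"
      unfolding iota_def Phi_rot(2)[OF xq] by (rule perp_horQ)
    show "frechet_derivative (hopf j k) (at x) (spin_rot \<gamma> (Phi x q) (iota v)) = spin_rot pauli q v"
      unfolding iota_def Phi_rot(2)[OF xq] by (rule hopf_derivative_perp[OF xq v])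
    fix u :: "real^3" assume "u \<bullet> e3 = 0"
    then show "Phi x (q ** pauli v ** pauli u) = Phi x q ** \<gamma> (iota v) ** \<gamma> (iota u)"
      by (rule Phi_equivariant[OF xq v])
  qed
qed

lemma eigen_vacua:
  assumes w: "w \<in> \<Sigma>" and I: "Sm \<i> *v w = (s * \<i>) *s w" and s: "s * s = 1"
  shows "w \<in> vacua s"
proof -
  have I': "\<gamma> f *v (\<gamma> (xi f) *v w) = (s * \<i>) *s w" using I by (simp add: Sm_mv)
  have "pure s f w"
    by (rule pureI) (simp add: Sigma_xi[OF fg(1) _ _ w] I')
  then show ?thesis by (rule vacuaI[OF fg(1) _ s I'])
qed

text \<open>The value is complex linear in the coordinates of \<open>x\<close> for the structure
  \<open>Sm\<close>. Hence moving \<open>x\<close> in its Hopf fibre multiplies it by a phase,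
  exactly as \<open>Phi\<close> does on \<Sigma>, and the spinor descends to the base.\<close>

lemma sphere_map_hopf:
  assumes \<psi>: "trans_killing_spinor \<gamma> e \<Sigma> 0 (of_real b) \<psi>" and b: "b = 1 \<or> b = - 1" and x: "norm x = 1"
  shows "sphere_map \<psi> x = Sm (x $ j) *v sphere_map \<psi> f +
    b *\<^sub>R (Sm (x $ k) *v (Sm \<i> *v (Mm *v sphere_map \<psi> f)))"
proof -
  let ?F = "sphere_map \<psi>"
  have p: "(Re (x $ j))\<^sup>2 + (Im (x $ j))\<^sup>2 + ((Re (x $ k))\<^sup>2 + (Im (x $ k))\<^sup>2) = 1"
    using norm_jk[OF x] by (simp add: complex_eq_iff power2_eq_square)
  have K: "\<gamma> (xi f) *v (\<gamma> g *v ?F f) = Sm \<i> *v (Mm *v ?F f)"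
    by (simp add: Sm_mv Mm_mv gamma_anti0[of "xi f" f] inner_xi_self mv_simps gamma_sq1 fg)
  have M: "\<gamma> f *v (\<gamma> g *v ?F f) = - (Sm \<i> *v (Sm \<i> *v (Mm *v ?F f)))"
    by (simp add: Sm_mult Sm_minus Sm_1 Mm_mv)
  have "?F x = Re (x $ j) *\<^sub>R ?F f + Im (x $ j) *\<^sub>R (\<gamma> f *v (\<gamma> (xi f) *v ?F f)) +
      (b * Re (x $ k)) *\<^sub>R (\<gamma> (xi f) *v (\<gamma> g *v ?F f)) - (b * Im (x $ k)) *\<^sub>R (\<gamma> f *v (\<gamma> g *v ?F f))"
    by (subst expand[of x]) (rule sphere_map_formula[OF \<psi> b fg(1,3,2) p])
  also have "\<dots> = Sm (x $ j) *v ?F f + b *\<^sub>R (Sm (x $ k) *v (Sm \<i> *v (Mm *v ?F f)))"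
    unfolding K M by (simp add: Sm_mv[of "x $ j"] Sm_mv[of "x $ k"] Sm_mv[of \<i> "Sm \<i> *v _"] algebra_simps)
  finally show ?thesis .
qed

lemma hopf_classification:
  assumes \<psi>: "trans_killing_spinor \<gamma> e \<Sigma> 0 \<beta> \<psi>" and \<beta>: "\<beta> = 1 \<or> \<beta> = - 1"
  shows "\<exists>\<phi>. killing_spinor pauli e3 (1/2) UNIV \<beta> \<phi> \<and> hopf_induced \<gamma> e \<Sigma> j k \<phi> \<psi>"
proof -
  have field: "spinor_field \<gamma> e \<Sigma> \<psi>" using \<psi> by (simp add: trans_killing_spinor_def)
  obtain b :: real where b: "\<beta> = of_real b" "b = 1 \<or> b = - 1"
  proof (cases "\<beta> = 1")
    case True then show ?thesis using that[of 1] by simp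
  next
    case False then show ?thesis using that[of "- 1"] \<beta> by simp
  qed
  obtain w1 where w1: "w1 \<noteq> 0" "vacua 1 = range (\<lambda>a. a *s w1)" using vacua_line[of 1] by auto
  then have "w1 \<in> vacua 1" by (metis rangeI vec.scale_one)
  then have w1S: "w1 \<in> \<Sigma>" using vacua_plus_subset m_1 by auto
  have Sw1: "Sm z *v w1 = z *s w1" for z
    using vacuaD[OF \<open>w1 \<in> vacua 1\<close>, of f]
    by (simp add: Sm_mv mv_simps gamma_sq1 fg)
      (simp add: vec_eq_iff scaleR_conv_of_real[where 'a = complex] complex_eq_iff algebra_simps)
  \<comment> \<open>\<open>Mm\<close> exchanges the two eigenlines of \<open>Sm\<close>; the factor
    \<open>Sm \<i>\<close> normalizes the basis so that \<theta> below intertwines the Pauli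
    matrices.\<close>
  define w2 where "w2 = Sm \<i> *v (Mm *v w1)"
  have w2S: "w2 \<in> \<Sigma>" unfolding w2_def by (intro Sm_Sigma Mm_Sigma w1S)
  have Sw2: "Sm z *v w2 = cnj z *s w2" for z
  proof -
    have "Sm z *v w2 = Sm \<i> *v (Sm (cnj (cnj z)) *v (Mm *v w1))" by (simp add: w2_def Sm_mult mult.commute)
    also have "\<dots> = Sm \<i> *v (Mm *v (Sm (cnj z) *v w1))" by (simp only: Mm_Sm)
    also have "\<dots> = cnj z *s w2" by (simp add: Sw1 mv_simps w2_def)
    finally show ?thesis .
  qed
  have M1: "Mm *v w1 = \<i> *s w2"
  proof -
    have "Sm (- \<i>) *v w2 = Mm *v w1" by (simp add: w2_def Sm_mult Sm_1)
    then show ?thesis by (simp add: Sw2)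
  qed
  have M2: "Mm *v w2 = \<i> *s w1"
  proof -
    have "Mm *v (Mm *v w1) = \<i> *s (Mm *v w2)" by (simp add: M1 mv_simps)
    then have "\<i> *s (Mm *v w2) = - w1" by (simp add: Mm_Mm)
    then have "(- \<i>) *s (\<i> *s (Mm *v w2)) = (- \<i>) *s (- w1)" by simp
    then show ?thesis by simp
  qed
  have w2: "w2 \<noteq> 0" using M2 w1(1) by auto
  define \<theta> :: "complex^2 \<Rightarrow> complex^'w" where "\<theta> w = w $ 1 *s w1 + w $ 2 *s w2" for w
  have span: "\<exists>c d. w = c *s w1 + d *s w2" if w: "w \<in> \<Sigma>" for w
  proof -
    define a where "a = (1/2) *s (w - \<i> *s (Sm \<i> *v w))"
    define a' where "a' = (1/2) *s (w + \<i> *s (Sm \<i> *v w))"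
    have S: "a \<in> \<Sigma>" "a' \<in> \<Sigma>" unfolding a_def a'_def by (intro Sigma_closed Sm_Sigma w)+
    have II: "Sm \<i> *v (Sm \<i> *v w) = - w" by (simp add: Sm_mult Sm_minus Sm_1)
    have "Sm \<i> *v a = (1 * \<i>) *s a"
      by (simp add: a_def mv_simps II vec.scale_right_distrib vec.scale_right_diff_distrib)
    then have "a \<in> vacua 1" by (intro eigen_vacua S) auto
    then obtain c where c: "a = c *s w1" using w1(2) by auto
    have a': "Sm (- \<i>) *v a' = \<i> *s a'"
      by (simp add: Sm_minus a'_def mv_simps II vec.scale_right_distrib vec.scale_right_diff_distrib)
    have "Sm \<i> *v (Mm *v a') = (1 * \<i>) *s (Mm *v a')"
      using arg_cong[OF a', of "\<lambda>v. Mm *v v"] by (simp add: Mm_Sm mv_simps)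
    then have "Mm *v a' \<in> vacua 1" by (intro eigen_vacua Mm_Sigma S) auto
    then obtain d where d: "Mm *v a' = d *s w1" using w1(2) by auto
    have "- a' = d *s (\<i> *s w2)" using Mm_Mm[of a'] by (simp add: d mv_simps M1)
    then have "a' = (- d * \<i>) *s w2" by (metis minus_minus vec.scale_minus_left vec.scale_scale mult_minus_left)
    moreover have "w = a + a'" by (simp add: a_def a'_def vec_eq_iff field_simps)
    ultimately show ?thesis using c by blast
  qed
  have linear: "Vector_Spaces.linear (*s) (*s) \<theta>"
    by unfold_locales (simp_all add: \<theta>_def vec_eq_iff algebra_simps)
  have bij: "bij_betw \<theta> UNIV \<Sigma>"
    unfolding bij_betw_def
  proof
    show "inj \<theta>"
    proof (rule injI)
      fix v w assume "\<theta> v = \<theta> w"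
      define c d where "c = v $ 1 - w $ 1" and "d = v $ 2 - w $ 2"
      have 1: "c *s w1 + d *s w2 = 0"
        using \<open>\<theta> v = \<theta> w\<close> by (simp add: \<theta>_def c_def d_def vec_eq_iff algebra_simps)
      have "Sm \<i> *v (c *s w1 + d *s w2) = 0" unfolding 1 by simp
      then have 2: "\<i> *s (c *s w1 - d *s w2) = 0" by (simp add: mv_simps Sw1 Sw2 vec_eq_iff algebra_simps)
      then have 3: "c *s w1 - d *s w2 = 0" by (rule iffD1[OF vec.scale_eq_0_iff, THEN disjE]) simp_all
      have "(2 * c) *s w1 = (c *s w1 + d *s w2) + (c *s w1 - d *s w2)"
        "(2 * d) *s w2 = (c *s w1 + d *s w2) - (c *s w1 - d *s w2)"
        by (simp_all add: vec_eq_iff algebra_simps)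
      then have "(2 * c) *s w1 = 0" "(2 * d) *s w2 = 0"
        unfolding 1 3 by simp_all
      then have "c = 0" "d = 0" using w1(1) w2 by simp_all
      then show "v = w" by (simp add: c_def d_def vec_eq_iff forall_2)
    qed
    show "range \<theta> = \<Sigma>"
    proof
      show "range \<theta> \<subseteq> \<Sigma>" using w1S w2S by (auto simp: \<theta>_def intro!: Sigma_closed)
      show "\<Sigma> \<subseteq> range \<theta>"
      proof
        fix w assume "w \<in> \<Sigma>"
        then obtain c d where "w = c *s w1 + d *s w2" using span by blast
        then have "w = \<theta> (vector [c, d])" by (simp add: \<theta>_def)
        then show "w \<in> range \<theta>" by blast
      qed
    qed
  qed
  have \<theta>_pauli: "\<theta> ((pauli e3 ** pauli v) *v w) = (\<gamma> e ** \<gamma> (xi e)) *v ((\<gamma> e ** \<gamma> (iota v)) *v \<theta> w)"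
    if v: "v \<bullet> e3 = 0" for v w
  proof -
    have tS: "\<theta> w \<in> \<Sigma>" using w1S w2S by (auto simp: \<theta>_def intro!: Sigma_closed)
    have e3: "pauli e3 = su2 \<i> 0"
      by (auto simp: pauli_su2 e3_def axis_def complex_eq_iff intro!: arg_cong2[where f = su2])
    have "(\<gamma> e ** \<gamma> (xi e)) *v ((\<gamma> e ** \<gamma> (iota v)) *v \<theta> w) = Sm \<i> *v (Sm (zeta v) *v (Mm *v \<theta> w))"
      by (simp add: mm_mv iota_def gamma_perp[OF norm_e tS] gamma_xi_Sm[OF norm_e] Sm_Sigma Mm_Sigma tS)
        (simp add: Sm_mv)
    also have "\<dots> = (- zeta v * w $ 2) *s w1 + (cnj (zeta v) * w $ 1) *s w2"
      by (simp add: \<theta>_def mv_simps M1 M2 Sm_mult Sw1 Sw2) (simp add: vec_eq_iff algebra_simps)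
    also have "\<dots> = \<theta> ((pauli e3 ** pauli v) *v w)"
      unfolding e3 pauli_zeta[OF v] su2_mult \<theta>_def by (simp add: su2_mv)
    finally show ?thesis by simp
  qed
  have fS: "sphere_map \<psi> f \<in> \<Sigma>" by (rule sphere_map_Sigma[OF field fg(1)])
  then obtain c1 c2 where c: "sphere_map \<psi> f = c1 *s w1 + c2 *s w2" using span by blast
  \<comment> \<open>The sign of the Killing constant selects \<open>A\<close>. The vector \<eta> is
    chosen such that \<open>A \<eta> = (c1, c2)\<close>, the coordinates of the spinor in the point
    \<open>f\<close>; the entries \<open>- i\<close> and \<open>i\<close> invert
    \<open>pauli e3\<close>.\<close>
  define A and \<eta> :: "complex^2" where "A = (if b = 1 then pauli e3 else mat 1)"
    and "\<eta> = (if b = 1 then vector [- \<i> * c1, \<i> * c2] else vector [c1, c2])"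
  let ?\<phi> = "pauli.const_spinor A \<eta>"
  have "norm e3 = 1" by (simp add: e3_def norm_axis_1)
  then have killing: "killing_spinor pauli e3 (1/2) UNIV \<beta> ?\<phi>"
    unfolding b(1) by (rule pauli.killing_spinor_const_spinor) (use b(2) in \<open>auto simp: A_def\<close>)
  have \<phi>: "?\<phi> (su2 a d) = vector [c1 * cnj a - of_real b * c2 * cnj d, c2 * a + of_real b * c1 * d]"
    if S: "su2 a d \<in> Spin pauli" and n: "(cmod a)\<^sup>2 + (cmod d)\<^sup>2 = 1" for a d
  proof -
    have mi: "matrix_inv (su2 a d) = su2 (cnj a) (- d)"
      using pauli.matrix_inv_Spin(2)[OF S] su2_inverse[OF n]
      by (metis matrix_mul_assoc matrix_mul_lid matrix_mul_rid)
    have pe: "pauli e3 = su2 \<i> 0"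
      by (auto simp: pauli_su2 e3_def axis_def complex_eq_iff intro!: arg_cong2[where f = su2])
    show ?thesis
      using S b(2)
      by (auto simp: pauli.const_spinor_def A_def \<eta>_def vec_eq_iff forall_2 mi pe su2_mv algebra_simps)
  qed
  have "hopf_induced \<gamma> e \<Sigma> j k ?\<phi> \<psi>"
    unfolding hopf_induced_def
  proof (intro exI[of _ iota] exI[of _ Phi] exI[of _ \<theta>] conjI hopf_spin_lift_Phi linear bij allI impI \<theta>_pauli, safe)
    fix x q assume xq: "(x, q) \<in> hopf_pullback j k"
    obtain a d where q: "q = su2 a d" "(cmod a)\<^sup>2 + (cmod d)\<^sup>2 = 1" "q \<in> Spin pauli"
      and l: "cmod (lam x q) = 1" and x: "x $ j = lam x q * cnj a" "x $ k = lam x q * cnj d" and nx: "norm x = 1"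
      using hopf_pullback_cases[OF xq] by metis
    note S = Phi_Spin[OF nx l]
    have tS: "\<theta> v \<in> \<Sigma>" for v using w1S w2S by (auto simp: \<theta>_def intro!: Sigma_closed)
    have "sphere_map \<psi> x = Sm (lam x q) *v (Sm (cnj a) *v sphere_map \<psi> f +
        of_real b *s (Sm (cnj d) *v (Sm \<i> *v (Mm *v sphere_map \<psi> f))))"
      using sphere_map_hopf[OF \<psi>[unfolded b(1)] b(2) nx]
      by (simp add: x mv_simps scaleR_conv_smult) (simp add: Sm_mult mult.assoc)
    also have "\<dots> = Sm (lam x q) *v \<theta> (?\<phi> q)"
      using \<phi>[of a d] q
      by (simp add: \<theta>_def c mv_simps Sw1 Sw2 M1 M2) (simp add: vec_eq_iff algebra_simps)
    also have "\<dots> = Phi x q *v \<theta> (?\<phi> q)" by (simp add: Phi_Sigma(1) tS)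
    finally have "Phi x q *v \<psi> (Phi x q) = Phi x q *v \<theta> (?\<phi> q)"
      using sphere_map[OF field S(1)] S(2) by simp
    then show "\<psi> (Phi x q) = \<theta> (?\<phi> q)" by (metis Spin_inv_mv(2)[OF S(1)])
  qed
  with killing show ?thesis by blast
qed

end

section \<open>The classification\<close>

context sasaki
begin

text \<open>In a spin frame the factor \<open>x\<close> that occurs for even \<open>m\<close>
  becomes \<open>e\<close>.\<close>

definition top_factor :: "complex^'w^'w" where
  "top_factor = (if odd m then mat 1 else \<gamma> e)"

lemma one_spinor_in_TKS:
  assumes "\<omega> \<in> vacua (- 1)"
  shows "const_spinor (mat 1) \<omega> \<in> TKS_in \<gamma> e m \<Sigma> 0 (- ((of_nat m + 1) / 2)) 0"
proof -
  have S: "\<omega> \<in> \<Sigma>" using assms vacua_minus_subset by blast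
  note T = const_spinor_TKS[OF _ assms S]
  have "const_spinor (mat 1) \<omega> p \<in> \<Sigma>" if "p \<in> Spin \<gamma>" for p
    using T(1) that by (simp add: trans_killing_spinor_def spinor_field_def)
  then show ?thesis
    unfolding TKS_in_def using T by (auto intro: pure_imp_Sigma_r(1))
qed

lemma top_spinor_in_TKS:
  assumes "\<eta> \<in> vacua 1"
  shows "const_spinor top_factor \<eta> \<in> TKS_in \<gamma> e m \<Sigma> m ((- 1) ^ m * ((of_nat m + 1) / 2)) 0"
proof -
  have T: "trans_killing_spinor \<gamma> e \<Sigma> ((- 1) ^ m * ((of_nat m + 1) / 2)) 0 (const_spinor top_factor \<eta>)"
    "\<And>p. p \<in> Spin \<gamma> \<Longrightarrow> pure 1 (spin_rot \<gamma> p e) (p *v const_spinor top_factor \<eta> p)"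
  proof -
    show "trans_killing_spinor \<gamma> e \<Sigma> ((- 1) ^ m * ((of_nat m + 1) / 2)) 0 (const_spinor top_factor \<eta>)"
    proof (cases "odd m")
      case True
      then have 1: "(- 1) ^ m = (- 1 :: complex)" and tf: "top_factor = mat 1"
        by (simp_all add: top_factor_def)
      have "\<eta> \<in> \<Sigma>" using vacua_plus_subset[OF True] assms by blast
      then have "trans_killing_spinor \<gamma> e \<Sigma> (- ((of_nat m + 1) / 2)) 0 (const_spinor (mat 1) \<eta>)"
        by (intro const_spinor_TKS(1)[of 1] assms) simp_all
      then show ?thesis by (simp only: 1 tf mult_minus1)
    next
      case False
      then show ?thesis using gamma_spinor_TKS(1)[OF _ assms] by (simp add: top_factor_def)
    qed
    show "pure 1 (spin_rot \<gamma> p e) (p *v const_spinor top_factor \<eta> p)" if "p \<in> Spin \<gamma>" for p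
      using const_spinor_TKS(2)[OF _ assms _ that] gamma_spinor_TKS(2)[OF _ assms that] vacua_plus_subset assms
      by (cases "odd m") (auto simp: top_factor_def)
  qed
  have "const_spinor top_factor \<eta> p \<in> \<Sigma>" if "p \<in> Spin \<gamma>" for p
    using T(1) that by (simp add: trans_killing_spinor_def spinor_field_def)
  then show ?thesis
    unfolding TKS_in_def using T by (auto intro: pure_imp_Sigma_r(2))
qed

lemma decomposition_beta_0:
  assumes \<psi>: "trans_killing_spinor \<gamma> e \<Sigma> \<alpha> 0 \<psi>"
  obtains \<omega> \<eta> where "\<omega> \<in> vacua (- 1)" "\<eta> \<in> vacua 1"
    "\<psi> = (\<lambda>p. const_spinor (mat 1) \<omega> p + const_spinor top_factor \<eta> p)"
    "\<omega> \<noteq> 0 \<Longrightarrow> \<alpha> = - ((of_nat m + 1) / 2)"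
    "\<eta> \<noteq> 0 \<Longrightarrow> \<alpha> = (- 1) ^ m * ((of_nat m + 1) / 2)"
proof -
  have field: "spinor_field \<gamma> e \<Sigma> \<psi>" using \<psi> by (simp add: trans_killing_spinor_def)
  obtain \<omega> \<eta> where c: "\<omega> \<in> vacua (- 1)" "\<eta> \<in> vacua 1"
    "\<And>x. norm x = 1 \<Longrightarrow> sphere_map \<psi> x = \<omega> + (if odd m then \<eta> else \<gamma> x *v \<eta>)"
    "\<omega> \<noteq> 0 \<Longrightarrow> \<alpha> = - ((of_nat m + 1) / 2)" "\<eta> \<noteq> 0 \<Longrightarrow> \<alpha> = (- 1) ^ m * ((of_nat m + 1) / 2)"
    using classification_beta_0[OF \<psi>] by blast
  have "\<psi> p = const_spinor (mat 1) \<omega> p + const_spinor top_factor \<eta> p" for p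
  proof (cases "p \<in> Spin \<gamma>")
    case True
    then show ?thesis
      using spinor_from_sphere_map[OF field True] c(3)[OF norm_point[OF True]]
      by (simp add: const_spinor_def top_factor_def mv_simps spin_rot_inv)
  next
    case False
    then show ?thesis using field by (simp add: spinor_field_def const_spinor_def)
  qed
  with c show thesis by (intro that) auto
qed

lemma const_spinor_smult: "const_spinor A (c *s w) = (\<lambda>p. c *s const_spinor A w p)"
  by (auto simp: const_spinor_def mv_simps)

lemma const_spinor_zero: "const_spinor A 0 p = 0"
  by (simp add: const_spinor_def)

lemma top_factor_mv_eq_0: "top_factor *v w = 0 \<longleftrightarrow> w = 0"
  using norm_e by (auto simp: top_factor_def gamma_eq_0)

lemma const_spinor_nonzero:
  assumes "A = mat 1 \<or> A = top_factor" "w \<noteq> 0" shows "const_spinor A w \<noteq> (\<lambda>_. 0)"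
proof
  assume "const_spinor A w = (\<lambda>_. 0)"
  then have "A *v (matrix_inv (mat 1) *v w) = 0"
    by (auto simp: const_spinor_def Spin.one fun_eq_iff split: if_splits)
  then have "matrix_inv (mat 1 :: complex^'w^'w) *v w = 0" using assms(1) by (auto simp: top_factor_mv_eq_0)
  then show False using assms(2) Spin_mv_eq_0[OF matrix_inv_Spin(1)[OF Spin.one]] by simp
qed

text \<open>The Clifford action of \<open>\<Omega>\<close> separates the two components.\<close>

lemma component_zero:
  assumes \<omega>: "\<omega> \<in> vacua (- 1)" and \<eta>: "\<eta> \<in> vacua 1"
    and S: "\<forall>p\<in>Spin \<gamma>. const_spinor (mat 1) \<omega> p + const_spinor top_factor \<eta> p \<in> Sigma_r \<gamma> e m \<Sigma> r p"
  shows "r = 0 \<Longrightarrow> \<eta> = 0" and "r = m \<Longrightarrow> \<omega> = 0"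
proof -
  let ?a = "const_spinor (mat 1) \<omega> (mat 1)" and ?b = "const_spinor top_factor \<eta> (mat 1)"
  have one: "mat 1 \<in> Spin \<gamma>" by (rule Spin.one)
  have inv: "matrix_inv (mat 1) *v w = w" for w :: "complex^'w"
    using Spin_inv_mv(1)[OF one, of w] by simp
  have ab: "?a = \<omega>" "?b = top_factor *v \<eta>"
    using one by (simp_all add: const_spinor_def inv)
  have "?a \<in> Sigma_r \<gamma> e m \<Sigma> 0 (mat 1)" "?b \<in> Sigma_r \<gamma> e m \<Sigma> m (mat 1)"
    using one_spinor_in_TKS[OF \<omega>] top_spinor_in_TKS[OF \<eta>] one by (auto simp: TKS_in_def)
  then have Om: "Omega_cmult \<gamma> e (mat 1) ?a = - (\<i> * of_nat m) *s ?a"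
    "Omega_cmult \<gamma> e (mat 1) ?b = (\<i> * of_nat m) *s ?b"
    by (simp_all add: Sigma_r_def)
  have *: "(\<i> * of_nat m) *s (?b - ?a) = (\<i> * of_real (2 * real r - real m)) *s (?a + ?b)"
    using S one Omega_cmult_add[of "mat 1" ?a ?b]
    by (simp add: Sigma_r_def Om vec.scale_right_diff_distrib)
  have m0: "(of_nat m :: complex) \<noteq> 0" using m1 by simp
  show "\<eta> = 0" if "r = 0"
  proof -
    have "(2 * (\<i> * of_nat m)) *s ?b = 0"
      using * that by (simp add: vec_eq_iff algebra_simps)
    then show ?thesis using m0 by (simp add: ab top_factor_mv_eq_0)
  qed
  show "\<omega> = 0" if "r = m"
  proof -
    have "(2 * (\<i> * of_nat m)) *s ?a = 0"
      using * that by (simp add: vec_eq_iff algebra_simps)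
    then show ?thesis using m0 by (simp add: ab)
  qed
qed

lemma TKS_0_eq:
  "TKS_in \<gamma> e m \<Sigma> 0 (- ((of_nat m + 1) / 2)) 0 = const_spinor (mat 1) ` vacua (- 1)"
proof (intro equalityI subsetI)
  fix \<psi> assume "\<psi> \<in> TKS_in \<gamma> e m \<Sigma> 0 (- ((of_nat m + 1) / 2)) 0"
  then have \<psi>: "trans_killing_spinor \<gamma> e \<Sigma> (- ((of_nat m + 1) / 2)) 0 \<psi>"
    and S: "\<forall>p\<in>Spin \<gamma>. \<psi> p \<in> Sigma_r \<gamma> e m \<Sigma> 0 p" by (auto simp: TKS_in_def)
  obtain \<omega> \<eta> where "\<omega> \<in> vacua (- 1)" "\<eta> \<in> vacua 1"
    "\<psi> = (\<lambda>p. const_spinor (mat 1) \<omega> p + const_spinor top_factor \<eta> p)"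
    using decomposition_beta_0[OF \<psi>] by blast
  moreover from this have "\<eta> = 0" using component_zero(1)[of \<omega> \<eta> 0] S by simp
  ultimately show "\<psi> \<in> const_spinor (mat 1) ` vacua (- 1)" by (auto simp: const_spinor_zero)
qed (blast intro: one_spinor_in_TKS)

lemma TKS_m_eq:
  "TKS_in \<gamma> e m \<Sigma> m ((- 1) ^ m * ((of_nat m + 1) / 2)) 0 = const_spinor top_factor ` vacua 1"
proof (intro equalityI subsetI)
  fix \<psi> assume "\<psi> \<in> TKS_in \<gamma> e m \<Sigma> m ((- 1) ^ m * ((of_nat m + 1) / 2)) 0"
  then have \<psi>: "trans_killing_spinor \<gamma> e \<Sigma> ((- 1) ^ m * ((of_nat m + 1) / 2)) 0 \<psi>"
    and S: "\<forall>p\<in>Spin \<gamma>. \<psi> p \<in> Sigma_r \<gamma> e m \<Sigma> m p" by (auto simp: TKS_in_def)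
  obtain \<omega> \<eta> where "\<omega> \<in> vacua (- 1)" "\<eta> \<in> vacua 1"
    "\<psi> = (\<lambda>p. const_spinor (mat 1) \<omega> p + const_spinor top_factor \<eta> p)"
    using decomposition_beta_0[OF \<psi>] by blast
  moreover from this have "\<omega> = 0" using component_zero(2)[of \<omega> \<eta> m] S by simp
  ultimately show "\<psi> \<in> const_spinor top_factor ` vacua 1" by (auto simp: const_spinor_zero)
qed (blast intro: top_spinor_in_TKS)

lemma one_dimensional_const_spinor:
  assumes A: "A = mat 1 \<or> A = top_factor" and s: "s * s = 1"
  shows "one_dimensional (const_spinor A ` vacua s)"
proof -
  obtain w0 where w0: "w0 \<noteq> 0" "vacua s = range (\<lambda>a. a *s w0)" using vacua_line[OF s] by blast
  have "const_spinor A ` vacua s = range (\<lambda>a p. a *s const_spinor A w0 p)"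
    by (simp add: w0(2) image_image const_spinor_smult)
  with const_spinor_nonzero[OF A w0(1)] show ?thesis unfolding one_dimensional_def by blast
qed

lemma beta_nonzero:
  assumes \<psi>: "trans_killing_spinor \<gamma> e \<Sigma> \<alpha> \<beta> \<psi>" and nz: "\<psi> \<noteq> (\<lambda>_. 0)" and \<beta>: "\<beta> \<noteq> 0"
  shows "\<alpha> = 0" "m = 1" "\<beta> = 1 \<or> \<beta> = - 1"
    and "UNIV = {j, k} \<Longrightarrow> \<exists>\<phi>. killing_spinor pauli e3 (1/2) UNIV \<beta> \<phi> \<and> hopf_induced \<gamma> e \<Sigma> j k \<phi> \<psi>"
proof -
  have "\<not> m \<ge> 2" using beta_0_if_m_ge_2[OF \<psi> nz] \<beta> by blast
  then show m: "m = 1" using m1 by simp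
  interpret sasaki3 \<gamma> e m \<Sigma> by unfold_locales (rule m)
  show \<alpha>: "\<alpha> = 0" by (rule alpha_0[OF \<psi> nz \<beta>])
  show b: "\<beta> = 1 \<or> \<beta> = - 1" using beta_squared[OF \<psi>[unfolded \<alpha>] nz] \<beta> by blast
  assume jk: "UNIV = {j, k}"
  interpret hopf3 \<gamma> e m \<Sigma> j k by unfold_locales (rule jk)
  show "\<exists>\<phi>. killing_spinor pauli e3 (1/2) UNIV \<beta> \<phi> \<and> hopf_induced \<gamma> e \<Sigma> j k \<phi> \<psi>"
    by (rule hopf_classification[OF \<psi>[unfolded \<alpha>] b])
qed

end

theorem proposition5p8:
  fixes m :: nat
    and \<gamma> :: "complex^'n \<Rightarrow> complex^'w^'w"
    and e :: "complex^'n"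
    and \<Sigma> :: "(complex^'w) set"
  assumes "m \<ge> 1" and "CARD('n) = m + 1" and "e \<in> Basis"
    and "sasaki_spinor_module \<gamma> e m \<Sigma>"
  shows
    "(let A = TKS_in \<gamma> e m \<Sigma> 0 (- ((of_nat m + 1) / 2)) 0;
          B = TKS_in \<gamma> e m \<Sigma> m ((-1) ^ m * ((of_nat m + 1) / 2)) 0
      in one_dimensional A \<and> one_dimensional B \<and>
         (\<forall>\<alpha> \<beta> \<psi>. trans_killing_spinor \<gamma> e \<Sigma> \<alpha> \<beta> \<psi> \<and> \<psi> \<noteq> (\<lambda>_. 0) \<longrightarrow>
            \<alpha> * \<beta> = 0 \<and>
            (\<alpha> = 0 \<longrightarrow>
               m = 1 \<and> \<beta>\<^sup>2 = 1 \<and>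
               (\<forall>j k. UNIV = {j, k} \<longrightarrow>
                  (\<exists>\<phi>. killing_spinor pauli e3 (1/2) UNIV \<beta> \<phi> \<and> hopf_induced \<gamma> e \<Sigma> j k \<phi> \<psi>))) \<and>
            (\<alpha> \<noteq> 0 \<longrightarrow>
               \<beta> = 0 \<and> (\<exists>\<epsilon>\<in>{1, -1}. \<alpha> = \<epsilon> * ((of_nat m + 1) / 2)) \<and>
               (\<psi> \<in> A \<or> \<psi> \<in> B \<or>
                odd m \<and> (\<exists>\<psi>\<^sub>0\<in>A. \<exists>\<psi>\<^sub>1\<in>B. \<psi> = (\<lambda>p. \<psi>\<^sub>0 p + \<psi>\<^sub>1 p))))))"
proof -
  interpret sasaki \<gamma> e m \<Sigma> by unfold_locales (rule assms)+
  let ?A = "const_spinor (mat 1) ` vacua (- 1)" and ?B = "const_spinor top_factor ` vacua 1"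
  define c :: complex where "c = (of_nat m + 1) / 2"
  have "(of_nat (Suc m) :: complex) \<noteq> 0" by (rule of_nat_neq_0)
  then have c0: "c \<noteq> 0" by (simp add: c_def add.commute)
  have main: "\<alpha> * \<beta> = 0 \<and>
      (\<alpha> = 0 \<longrightarrow> m = 1 \<and> \<beta>\<^sup>2 = 1 \<and> (\<forall>j k. UNIV = {j, k} \<longrightarrow>
        (\<exists>\<phi>. killing_spinor pauli e3 (1/2) UNIV \<beta> \<phi> \<and> hopf_induced \<gamma> e \<Sigma> j k \<phi> \<psi>))) \<and>
      (\<alpha> \<noteq> 0 \<longrightarrow> \<beta> = 0 \<and> (\<exists>\<epsilon>\<in>{1, -1}. \<alpha> = \<epsilon> * c) \<and>
        (\<psi> \<in> ?A \<or> \<psi> \<in> ?B \<or> odd m \<and> (\<exists>\<psi>\<^sub>0\<in>?A. \<exists>\<psi>\<^sub>1\<in>?B. \<psi> = (\<lambda>p. \<psi>\<^sub>0 p + \<psi>\<^sub>1 p))))"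
    if \<psi>: "trans_killing_spinor \<gamma> e \<Sigma> \<alpha> \<beta> \<psi>" and nz: "\<psi> \<noteq> (\<lambda>_. 0)" for \<alpha> \<beta> \<psi>
  proof (cases "\<beta> = 0")
    case False
    note b = beta_nonzero[OF \<psi> nz False]
    have "\<beta>\<^sup>2 = 1" using b(3) by auto
    with b show ?thesis by simp
  next
    case True
    obtain \<omega> \<eta> where d: "\<omega> \<in> vacua (- 1)" "\<eta> \<in> vacua 1"
      "\<psi> = (\<lambda>p. const_spinor (mat 1) \<omega> p + const_spinor top_factor \<eta> p)"
      "\<omega> \<noteq> 0 \<Longrightarrow> \<alpha> = - c" "\<eta> \<noteq> 0 \<Longrightarrow> \<alpha> = (- 1) ^ m * c"
      using decomposition_beta_0[OF \<psi>[unfolded True]] unfolding c_def by blast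
    have "\<omega> \<noteq> 0 \<or> \<eta> \<noteq> 0" using nz d(3) by (auto simp: const_spinor_zero)
    then have \<alpha>: "\<alpha> = c \<or> \<alpha> = - c" using d(4,5) by (cases "even m") auto
    have "\<psi> \<in> ?A \<or> \<psi> \<in> ?B \<or> odd m \<and> (\<exists>\<psi>\<^sub>0\<in>?A. \<exists>\<psi>\<^sub>1\<in>?B. \<psi> = (\<lambda>p. \<psi>\<^sub>0 p + \<psi>\<^sub>1 p))"
    proof -
      consider "\<omega> = 0" | "\<eta> = 0" | "\<omega> \<noteq> 0" "\<eta> \<noteq> 0" by blast
      then show ?thesis
      proof cases
        case 1 then show ?thesis using d(2,3) by (auto simp: const_spinor_zero)
      next
        case 2 then show ?thesis using d(1,3) by (auto simp: const_spinor_zero)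
      next
        case 3
        \<comment> \<open>Both components can occur only if their two values of \<alpha> coincide,
          and \<open>c\<close> is non-zero.\<close>
        then have "- c = (- 1) ^ m * c" using d(4,5) by simp
        then have "odd m" using c0 by (cases "even m") auto
        then show ?thesis using d(1-3) by blast
      qed
    qed
    moreover have "\<exists>\<epsilon>\<in>{1, -1}. \<alpha> = \<epsilon> * c" using \<alpha> by auto
    moreover have "\<alpha> \<noteq> 0" using \<alpha> c0 by auto
    ultimately show ?thesis using True by simp
  qed
  show ?thesis
    unfolding Let_def TKS_0_eq TKS_m_eq
    using one_dimensional_const_spinor[of "mat 1" "- 1"] one_dimensional_const_spinor[of top_factor 1]
    by (intro conjI; (simp; fail)?) (intro allI, rule impI, erule conjE, rule main[unfolded c_def])
qed

end
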